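(* Let $m\ge 4$ be a positive integer and let $G$ be a finite group. Then (groups being considered up to isomorphism): (1) $G$ is $m$PCI if and only if $G=\mathbb{Z}_1$, or $G=\mathbb{Z}_2$, or $G\in\{\mathbb{Z}_3, D_6\}$ with $m=4$ or $5$; (2) $G$ is $m$PDCI if and only if $G=\mathbb{Z}_1$ or $G=\mathbb{Z}_2$.
   Context: $D_6$ is the dihedral group of order $6$, and $\mathbb{Z}_1$ is the trivial group. Digraphs are finite without loops or multiple arcs; a graph is a digraph with symmetric arc set. $V=\bigcup_{i=1}^m G_i$ is a disjoint union of copies $G_i=\{x_i:x\in G\}$ of $G$. For subsets $S_{i,j}\subseteq G$ ($1\le i,j\le m$) with $S_{i,i}=\emptyset$ for all $i$, the $m$-PCayley digraph $\mathrm{Cay}(G,S_{i,j}:1\le i,j\le m)$ of $G$ has vertex set $V$ and arc set $\bigcup_{i,j}\{(x_i,(sx)_j): s\in S_{i,j},x\in G\}$; it is an $m$-PCayley graph if it is a graph, i.e. $S_{i,j}=S_{j,i}^{-1}$ for all $i,j$. $R(G)=\{R(g):g\in G\}$ with $R(g):x_i\mapsto(xg)_i$ for all $x\in G$ and all $i$, and $N=N_{\mathrm{S}_V}(R(G))$ is its normalizer in the symmetric group on $V$. For a permutation $n$ of $V$, $\Gamma^n$ is the digraph with vertex set $V$ and arcs $(u^n,v^n)$ for $(u,v)$ an arc of $\Gamma$. An $m$-PCayley (di)graph $\Gamma$ of $G$ is $m$PCI if for every $m$-PCayley (di)graph $\Sigma$ of $G$ for which there is an isomorphism from $\Gamma$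 to $\Sigma$ mapping each $G_i$ onto some $G_j$, there is $n\in N$ with $\Gamma^n=\Sigma$. The group $G$ is $m$PDCI (resp. $m$PCI) if every $m$-PCayley digraph (resp. $m$-PCayley graph) of $G$ is $m$PCI. *)

theory Defs
  imports "HOL-Algebra.Algebra" "Graph_Theory.Graph_Theory"
begin

section \<open>The dihedral groups\<close>

text \<open>
  The dihedral group of order \<open>2 n\<close> (for \<open>n \<ge> 1\<close>): the pair \<open>(a, s)\<close> stands for
  the element \<open>r\<^sup>a t\<^sup>s\<close>, where \<open>r\<close> is the rotation of order \<open>n\<close> and \<open>t\<close> a reflection,
  so that \<open>t r\<^sup>b = r\<^sup>-\<^sup>b t\<close>.  Note that the argument is \<open>n\<close> and not the order \<open>2 n\<close>.
\<close>

definition dihedral_group :: "nat \<Rightarrow> (int \<times> bool) monoid" where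
  "dihedral_group n =
     \<lparr>carrier = {0..<int n} \<times> UNIV,
      monoid.mult = (\<lambda>(a, s) (b, t). ((if s then a - b else a + b) mod int n, s \<noteq> t)),
      one = (0, False)\<rparr>"

lemma group_dihedral_group:
  assumes "n > 0"
  shows "group (dihedral_group n)"
proof (rule groupI)
  fix x assume x: "x \<in> carrier (dihedral_group n)"
  obtain a s where [simp]: "x = (a, s)" by (cases x)
  show "\<exists>y\<in>carrier (dihedral_group n). y \<otimes>\<^bsub>dihedral_group n\<^esub> x = \<one>\<^bsub>dihedral_group n\<^esub>"
    by (rule bexI[of _ "(if s then a else (- a) mod int n, s)"])
       (use x assms in \<open>auto simp: dihedral_group_def mod_simps\<close>)
qed (use assms in \<open>auto simp: dihedral_group_def mod_simps algebra_simps\<close>)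

lemma order_dihedral_group: "order (dihedral_group n) = 2 * n"
  by (simp add: order_def dihedral_group_def card_cartesian_product UNIV_bool)


section \<open>\<open>m\<close>-partite Cayley digraphs\<close>

text \<open>The vertex \<open>x\<^sub>i\<close> is the pair \<open>(x, i)\<close>; the index \<open>i\<close> ranges over \<open>{1..m}\<close>.\<close>

definition copy :: "('a, 'b) monoid_scheme \<Rightarrow> nat \<Rightarrow> ('a \<times> nat) set" where
  "copy G i = (\<lambda>x. (x, i)) ` carrier G"

definition copies :: "('a, 'b) monoid_scheme \<Rightarrow> nat \<Rightarrow> ('a \<times> nat) set" where
  "copies G m = (\<Union>i\<in>{1..m}. copy G i)"

definition Cay ::
  "('a, 'b) monoid_scheme \<Rightarrow> nat \<Rightarrow> (nat \<Rightarrow> nat \<Rightarrow> 'a set) \<Rightarrow> ('a \<times> nat) pair_pre_digraph" where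
  "Cay G m S =
     \<lparr>pverts = copies G m,
      parcs = (\<Union>i\<in>{1..m}. \<Union>j\<in>{1..m}.
        {((x, i), (s \<otimes>\<^bsub>G\<^esub> x, j)) | s x. s \<in> S i j \<and> x \<in> carrier G})\<rparr>"

definition PCayley_family ::
  "('a, 'b) monoid_scheme \<Rightarrow> nat \<Rightarrow> (nat \<Rightarrow> nat \<Rightarrow> 'a set) \<Rightarrow> bool" where
  "PCayley_family G m S \<longleftrightarrow>
     (\<forall>i\<in>{1..m}. \<forall>j\<in>{1..m}. S i j \<subseteq> carrier G) \<and> (\<forall>i\<in>{1..m}. S i i = {})"

definition PCayley_digraph ::
  "('a, 'b) monoid_scheme \<Rightarrow> nat \<Rightarrow> ('a \<times> nat) pair_pre_digraph \<Rightarrow> bool" where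
  "PCayley_digraph G m \<Gamma> \<longleftrightarrow> (\<exists>S. PCayley_family G m S \<and> \<Gamma> = Cay G m S)"

definition PCayley_graph ::
  "('a, 'b) monoid_scheme \<Rightarrow> nat \<Rightarrow> ('a \<times> nat) pair_pre_digraph \<Rightarrow> bool" where
  "PCayley_graph G m \<Gamma> \<longleftrightarrow> PCayley_digraph G m \<Gamma> \<and> symmetric (with_proj \<Gamma>)"

lemma in_copies: "(x, i) \<in> copies G m \<longleftrightarrow> x \<in> carrier G \<and> i \<in> {1..m}"
  by (auto simp: copies_def copy_def)

lemma in_parcs_Cay:
  "((x, i), (y, j)) \<in> parcs (Cay G m S) \<longleftrightarrow>
     i \<in> {1..m} \<and> j \<in> {1..m} \<and> x \<in> carrier G \<and> (\<exists>s\<in>S i j. y = s \<otimes>\<^bsub>G\<^esub> x)"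
  by (auto simp: Cay_def)

text \<open>Finiteness, absence of loops and the description of graphs by \<open>S\<^sub>i\<^sub>j = S\<^sub>j\<^sub>i\<^sup>-\<^sup>1\<close> are
  consequences of the definitions.\<close>

lemma (in group) pair_digraph_PCayley_digraph:
  assumes "finite (carrier G)" "PCayley_digraph G m \<Gamma>"
  shows "pair_digraph \<Gamma>"
proof -
  obtain S where S: "PCayley_family G m S" and \<Gamma>: "\<Gamma> = Cay G m S"
    using assms(2) by (auto simp: PCayley_digraph_def)
  have verts: "finite (pverts \<Gamma>)"
    using assms(1) by (auto simp: \<Gamma> Cay_def copies_def copy_def)
  have arcs: "parcs \<Gamma> \<subseteq> pverts \<Gamma> \<times> pverts \<Gamma>"
  proof
    fix e assume e: "e \<in> parcs \<Gamma>"
    obtain x i y j where [simp]: "e = ((x, i), (y, j))" by (metis surj_pair)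
    from e obtain s where "i \<in> {1..m}" "j \<in> {1..m}" "x \<in> carrier G" "s \<in> S i j" "y = s \<otimes> x"
      by (auto simp: \<Gamma> in_parcs_Cay)
    moreover from this have "s \<in> carrier G" using S unfolding PCayley_family_def by blast
    ultimately show "e \<in> pverts \<Gamma> \<times> pverts \<Gamma>"
      by (simp add: \<Gamma> Cay_def in_copies)
  qed
  show ?thesis
  proof
    show "finite (parcs \<Gamma>)" using verts arcs finite_subset by blast
    show "fst e \<noteq> snd e" if "e \<in> parcs \<Gamma>" for e
      using that S by (auto simp: \<Gamma> Cay_def PCayley_family_def)
  qed (use verts arcs in auto)
qed

lemma (in group) symmetric_Cay_iff:
  assumes "PCayley_family G m S"
  shows "symmetric (with_proj (Cay G m S)) \<longleftrightarrow>
           (\<forall>i\<in>{1..m}. \<forall>j\<in>{1..m}. S i j = m_inv G ` S j i)"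
proof -
  have S: "s \<in> carrier G" if "s \<in> S i j" "i \<in> {1..m}" "j \<in> {1..m}" for s i j
    using that assms unfolding PCayley_family_def by blast
  have arc: "((x, i), (s \<otimes> x, j)) \<in> parcs (Cay G m S) \<longleftrightarrow> s \<in> S i j"
    if "i \<in> {1..m}" "j \<in> {1..m}" "x \<in> carrier G" "s \<in> carrier G" for x s i j
    using that S by (auto simp: in_parcs_Cay)
  show ?thesis
  proof
    assume sym: "symmetric (with_proj (Cay G m S))"
    have inv: "inv s \<in> S j i" if "s \<in> S i j" "i \<in> {1..m}" "j \<in> {1..m}" for s i j
    proof -
      have s: "s \<in> carrier G" using S that by blast
      have "((\<one>, i), (s \<otimes> \<one>, j)) \<in> parcs (Cay G m S)" using arc that s by blast
      then have "((s, j), (inv s \<otimes> s, i)) \<in> parcs (Cay G m S)"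
        using sym s by (simp add: symmetric_def sym_def)
      then show ?thesis using arc[of j i s "inv s"] that s by simp
    qed
    show "\<forall>i\<in>{1..m}. \<forall>j\<in>{1..m}. S i j = m_inv G ` S j i"
    proof (intro ballI equalityI subsetI)
      fix i j s assume *: "i \<in> {1..m}" "j \<in> {1..m}" "s \<in> S i j"
      show "s \<in> m_inv G ` S j i"
        using inv[of s i j] * S[of s i j] by (metis image_eqI inv_inv)
    qed (use inv in auto)
  next
    assume eq: "\<forall>i\<in>{1..m}. \<forall>j\<in>{1..m}. S i j = m_inv G ` S j i"
    have "((y, j), (x, i)) \<in> parcs (Cay G m S)"
      if e: "((x, i), (y, j)) \<in> parcs (Cay G m S)" for x i y j
    proof -
      from e obtain s where s: "i \<in> {1..m}" "j \<in> {1..m}" "x \<in> carrier G" "s \<in> S i j" "y = s \<otimes> x"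
        by (auto simp: in_parcs_Cay)
      have sG: "s \<in> carrier G" using S s by blast
      have "inv s \<in> S j i" using eq s by blast
      moreover have "x = inv s \<otimes> y" using s sG by (simp add: m_assoc[symmetric])
      ultimately show ?thesis using s sG by (auto simp: in_parcs_Cay)
    qed
    then show "symmetric (with_proj (Cay G m S))"
      by (auto simp: symmetric_def sym_def)
  qed
qed


section \<open>The \<open>m\<close>PCI and \<open>m\<close>PDCI properties\<close>

definition right_mult ::
  "('a, 'b) monoid_scheme \<Rightarrow> nat \<Rightarrow> 'a \<Rightarrow> 'a \<times> nat \<Rightarrow> 'a \<times> nat" where
  "right_mult G m g = (\<lambda>(x, i) \<in> copies G m. (x \<otimes>\<^bsub>G\<^esub> g, i))"

text \<open>
  \<^const>\<open>BijGroup\<close> composes functions from right to left, whereas permutations acting on the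
  right compose from left to right.  The normalizer of \<open>R(G)\<close> is the same set in both cases.
\<close>

definition normalizer_R :: "('a, 'b) monoid_scheme \<Rightarrow> nat \<Rightarrow> ('a \<times> nat \<Rightarrow> 'a \<times> nat) set" where
  "normalizer_R G m = normalizer (BijGroup (copies G m)) (right_mult G m ` carrier G)"

definition perm_digraph :: "('v \<Rightarrow> 'v) \<Rightarrow> 'v pair_pre_digraph \<Rightarrow> 'v pair_pre_digraph" where
  "perm_digraph n \<Gamma> = \<lparr>pverts = pverts \<Gamma>, parcs = {(n u, n v) | u v. (u, v) \<in> parcs \<Gamma>}\<rparr>"

definition copy_preserving_iso ::
  "('a, 'b) monoid_scheme \<Rightarrow> nat \<Rightarrow>
     ('a \<times> nat) pair_pre_digraph \<Rightarrow> ('a \<times> nat) pair_pre_digraph \<Rightarrow> bool" where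
  "copy_preserving_iso G m \<Gamma> \<Sigma> \<longleftrightarrow>
     (\<exists>f. pre_digraph.digraph_isomorphism (with_proj \<Gamma>) f \<and>
          with_proj \<Sigma> = app_iso f (with_proj \<Gamma>) \<and>
          (\<forall>i\<in>{1..m}. \<exists>j\<in>{1..m}. iso_verts f ` copy G i = copy G j))"

definition mPCI_digraph ::
  "('a, 'b) monoid_scheme \<Rightarrow> nat \<Rightarrow> ('a \<times> nat) pair_pre_digraph \<Rightarrow> bool" where
  "mPCI_digraph G m \<Gamma> \<longleftrightarrow>
     (\<forall>\<Sigma>. PCayley_digraph G m \<Sigma> \<and> copy_preserving_iso G m \<Gamma> \<Sigma> \<longrightarrow>
        (\<exists>n\<in>normalizer_R G m. perm_digraph n \<Gamma> = \<Sigma>))"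

definition mPCI_graph ::
  "('a, 'b) monoid_scheme \<Rightarrow> nat \<Rightarrow> ('a \<times> nat) pair_pre_digraph \<Rightarrow> bool" where
  "mPCI_graph G m \<Gamma> \<longleftrightarrow>
     (\<forall>\<Sigma>. PCayley_graph G m \<Sigma> \<and> copy_preserving_iso G m \<Gamma> \<Sigma> \<longrightarrow>
        (\<exists>n\<in>normalizer_R G m. perm_digraph n \<Gamma> = \<Sigma>))"

definition mPDCI_group :: "('a, 'b) monoid_scheme \<Rightarrow> nat \<Rightarrow> bool" where
  "mPDCI_group G m \<longleftrightarrow> (\<forall>\<Gamma>. PCayley_digraph G m \<Gamma> \<longrightarrow> mPCI_digraph G m \<Gamma>)"

definition mPCI_group :: "('a, 'b) monoid_scheme \<Rightarrow> nat \<Rightarrow> bool" where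
  "mPCI_group G m \<longleftrightarrow> (\<forall>\<Gamma>. PCayley_graph G m \<Gamma> \<longrightarrow> mPCI_graph G m \<Gamma>)"

end

theory Submission
  imports Defs "HOL-Library.Numeral_Type"
begin

text \<open>
  Translated into connection sets, the two properties compare two equivalence relations on families
  \<open>S\<^sub>i\<^sub>j\<close>.  A permutation of the vertices normalizes \<open>R(G)\<close> exactly if it has the form
  \<open>x\<^sub>i \<mapsto> (g\<^sub>i \<alpha>(x))\<^bsub>\<sigma>(i)\<^esub>\<close> with a permutation \<open>\<sigma>\<close> of the indices, an automorphism \<open>\<alpha>\<close> of \<open>G\<close> and
  elements \<open>g\<^sub>i\<close> (\<open>normalizer_R_affine\<close>, \<open>affine_normalizer_R\<close>).  So the claim that \<open>G\<close> has the
  property says that an isomorphism \<open>x\<^sub>i \<mapsto> f\<^sub>i(x)\<^bsub>\<sigma>(i)\<^esub>\<close> between Cayley digraphs, with arbitrary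
  permutations \<open>f\<^sub>i\<close> of \<open>G\<close>, can always be replaced by one in which every \<open>f\<^sub>i\<close> is \<open>x \<mapsto> g\<^sub>i \<alpha>(x)\<close>
  for one common \<open>\<alpha>\<close> (\<open>mPDCI_group_iff\<close>, \<open>mPCI_group_iff\<close>).  If \<open>G\<close> has at most two elements, every
  permutation of \<open>G\<close> is a translation and there is nothing to do.

  Necessity rests on one construction.  Let \<open>K \<le> H\<close> be subgroups, \<open>H\<close> commutative, and let
  \<open>\<theta>\<close> be an automorphism of \<open>H\<close> that is trivial modulo \<open>K\<close>.  Applying \<open>\<theta>\<close> within each coset of \<open>H\<close>
  on some of the copies of \<open>G\<close>, and the identity on the others, transports every digraph whose
  connection sets lie in \<open>H\<close> and are \<open>\<emptyset>\<close> or \<open>K\<close> between the two groups of copies: the sets inside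
  the first group of copies become their images under \<open>\<theta>\<close>, the others remain
  (\<open>copy_isomorphic_twisted\<close>).  A single \<open>\<alpha>\<close> cannot imitate both \<open>\<theta>\<close> and the identity.  The graph
  of \<open>not_mPCI_group_if_twist\<close> on four copies detects this for cyclic subgroups of order at least
  four, for the four-group and for noncyclic subgroups of order nine, which leaves
  \<open>\<int>\<^sub>1, \<int>\<^sub>2, \<int>\<^sub>3, D\<^sub>6\<close>.  For an element of order three the only twist is inversion.  A graph sees it
  only through the orientation of a triangle of copies, and two such triangles need six copies
  (\<open>not_mPCI_group_if_order3\<close>); in a digraph two copies already form a directed cycle, so that four
  copies suffice (\<open>not_mPDCI_group_if_order3\<close>).

  For sufficiency let \<open>G\<close> be \<open>\<int>\<^sub>3\<close> or \<open>D\<^sub>6\<close>, with \<open>m \<le> 5\<close>, and let \<open>a\<close> have order three.  Sylow's theorem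
  in the group of automorphisms of the graph that fix every copy makes it possible to choose the
  isomorphism so that each \<open>f\<^sub>i\<close> maps cosets of \<open>\<langle>a\<rangle>\<close> to cosets of \<open>\<langle>a\<rangle>\<close>
  (\<open>copy_isomorphism_normalizing_order3\<close>).  Every permutation of a set of three elements is affine
  over \<open>\<int>\<^sub>3\<close>, so on each coset \<open>f\<^sub>i\<close> is described by a sign and a translation.  Where two signs
  disagree, the connection sets between the cosets concerned are unions of cosets and see neither
  signs nor translations.  What remains is to make all signs equal: those copies whose two
  signs are both \<open>+\<close> and those whose two signs are both \<open>-\<close> compete, and as there are at most five
  copies, one of the two kinds occurs at most twice.  A pair of copies can be reflected, because every
  subset of \<open>\<int>\<^sub>3\<close> is a translate of its negative (\<open>ex_uniform_correction\<close>).
\<close>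

section \<open>Connection sets and copy-preserving isomorphisms\<close>

lemma perm_digraph_image:
  "perm_digraph f \<Gamma> = \<lparr>pverts = pverts \<Gamma>, parcs = (\<lambda>(u, v). (f u, f v)) ` parcs \<Gamma>\<rparr>"
proof -
  have "{(f u, f v) | u v. (u, v) \<in> parcs \<Gamma>} = (\<lambda>(u, v). (f u, f v)) ` parcs \<Gamma>"
    by auto
  then show ?thesis by (simp only: perm_digraph_def)
qed

lemma pverts_Cay [simp]: "pverts (Cay G m S) = copies G m"
  by (simp add: Cay_def)

context group begin

text \<open>
  Arcs are determined by \<open>y x\<^sup>-\<^sup>1 \<in> S\<^sub>i\<^sub>j\<close>, which makes sense for all pairs and has no existential
  quantifier; arcs are compared in this form from here on.
\<close>

definition adjacent :: "(nat \<Rightarrow> nat \<Rightarrow> 'a set) \<Rightarrow> 'a \<times> nat \<Rightarrow> 'a \<times> nat \<Rightarrow> bool" where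
  "adjacent S u v \<longleftrightarrow> fst v \<otimes> inv fst u \<in> S (snd u) (snd v)"

definition copy_isomorphic ::
  "nat \<Rightarrow> (nat \<Rightarrow> nat \<Rightarrow> 'a set) \<Rightarrow> (nat \<Rightarrow> nat \<Rightarrow> 'a set) \<Rightarrow> bool" where
  "copy_isomorphic m S T \<longleftrightarrow>
     (\<exists>\<phi>. bij_betw \<phi> (copies G m) (copies G m) \<and>
          (\<forall>i\<in>{1..m}. \<exists>j\<in>{1..m}. \<phi> ` copy G i = copy G j) \<and>
          (\<forall>u\<in>copies G m. \<forall>v\<in>copies G m. adjacent T (\<phi> u) (\<phi> v) \<longleftrightarrow> adjacent S u v))"

text \<open>
  The relation \<open>T\<^bsub>\<sigma>(i),\<sigma>(j)\<^esub> = g\<^sub>j \<alpha>(S\<^sub>i\<^sub>j) g\<^sub>i\<^sup>-\<^sup>1\<close> is what \<open>x\<^sub>i \<mapsto> (g\<^sub>i \<alpha>(x))\<^bsub>\<sigma>(i)\<^esub>\<close> does to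
  connection sets. It is phrased by membership, so that no image has to be computed.
\<close>

definition affinely_equivalent ::
  "nat \<Rightarrow> (nat \<Rightarrow> nat \<Rightarrow> 'a set) \<Rightarrow> (nat \<Rightarrow> nat \<Rightarrow> 'a set) \<Rightarrow> bool" where
  "affinely_equivalent m S T \<longleftrightarrow>
     (\<exists>\<sigma> \<alpha> g. bij_betw \<sigma> {1..m} {1..m} \<and> \<alpha> \<in> iso G G \<and> g \<in> {1..m} \<rightarrow> carrier G \<and>
        (\<forall>i\<in>{1..m}. \<forall>j\<in>{1..m}. \<forall>z\<in>carrier G.
           g j \<otimes> \<alpha> z \<otimes> inv (g i) \<in> T (\<sigma> i) (\<sigma> j) \<longleftrightarrow> z \<in> S i j))"

definition inverse_symmetric :: "nat \<Rightarrow> (nat \<Rightarrow> nat \<Rightarrow> 'a set) \<Rightarrow> bool" where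
  "inverse_symmetric m S \<longleftrightarrow> (\<forall>i\<in>{1..m}. \<forall>j\<in>{1..m}. S i j = m_inv G ` S j i)"

lemma arc_iff_adjacent:
  assumes "PCayley_family G m S" "u \<in> copies G m" "v \<in> copies G m"
  shows "(u, v) \<in> parcs (Cay G m S) \<longleftrightarrow> adjacent S u v"
proof -
  obtain x i y j where [simp]: "u = (x, i)" "v = (y, j)" by (metis surj_pair)
  have *: "x \<in> carrier G" "y \<in> carrier G" "i \<in> {1..m}" "j \<in> {1..m}"
    using assms by (auto simp: in_copies)
  have S: "S i j \<subseteq> carrier G" using assms(1) * unfolding PCayley_family_def by blast
  show ?thesis
  proof
    assume "(u, v) \<in> parcs (Cay G m S)"
    then obtain s where s: "s \<in> S i j" "y = s \<otimes> x" by (auto simp: in_parcs_Cay)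
    then have "s \<in> carrier G" using S by blast
    then have "y \<otimes> inv x = s" using * s(2) by (simp add: m_assoc)
    then show "adjacent S u v" using s(1) by (simp add: adjacent_def)
  next
    assume "adjacent S u v"
    then have "y \<otimes> inv x \<in> S i j" by (simp add: adjacent_def)
    moreover have "y = (y \<otimes> inv x) \<otimes> x" using * by (simp add: m_assoc)
    ultimately show "(u, v) \<in> parcs (Cay G m S)" using * by (auto simp: in_parcs_Cay)
  qed
qed

lemma parcs_Cay_subset:
  assumes "PCayley_family G m S"
  shows "parcs (Cay G m S) \<subseteq> copies G m \<times> copies G m"
proof
  fix e assume e: "e \<in> parcs (Cay G m S)"
  obtain x i y j where [simp]: "e = ((x, i), (y, j))" by (metis surj_pair)
  from e obtain s where "i \<in> {1..m}" "j \<in> {1..m}" "x \<in> carrier G" "s \<in> S i j" "y = s \<otimes> x"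
    by (auto simp: in_parcs_Cay)
  moreover from this have "s \<in> carrier G" using assms unfolding PCayley_family_def by blast
  ultimately show "e \<in> copies G m \<times> copies G m" by (simp add: in_copies)
qed

lemma perm_digraph_Cay_iff:
  assumes S: "PCayley_family G m S" and T: "PCayley_family G m T"
    and \<phi>: "bij_betw \<phi> (copies G m) (copies G m)"
  shows "perm_digraph \<phi> (Cay G m S) = Cay G m T \<longleftrightarrow>
    (\<forall>u\<in>copies G m. \<forall>v\<in>copies G m. adjacent T (\<phi> u) (\<phi> v) \<longleftrightarrow> adjacent S u v)"
    (is "?L \<longleftrightarrow> ?R")
proof -
  have im: "\<phi> ` copies G m = copies G m" and inj: "inj_on \<phi> (copies G m)"
    using \<phi> by (auto simp: bij_betw_def)
  have mem: "\<phi> u \<in> copies G m" if "u \<in> copies G m" for u using im that by blast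
  let ?\<Phi> = "\<lambda>(u, v). (\<phi> u, \<phi> v)"
  have inj2: "inj_on ?\<Phi> (copies G m \<times> copies G m)"
    using map_prod_inj_on[OF inj inj] by (simp add: map_prod_def)
  have im2: "?\<Phi> ` (copies G m \<times> copies G m) = copies G m \<times> copies G m"
    using map_prod_surj_on[OF im im] by (simp add: map_prod_def)
  have T': "Cay G m T = \<lparr>pverts = copies G m, parcs = parcs (Cay G m T)\<rparr>"
    by (simp add: Cay_def)
  have "?L \<longleftrightarrow> ?\<Phi> ` parcs (Cay G m S) = parcs (Cay G m T)"
    unfolding perm_digraph_image pverts_Cay by (subst T') simp
  also have "\<dots> \<longleftrightarrow>
      (\<forall>e\<in>copies G m \<times> copies G m. ?\<Phi> e \<in> parcs (Cay G m T) \<longleftrightarrow> e \<in> parcs (Cay G m S))"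
  proof
    assume eq: "?\<Phi> ` parcs (Cay G m S) = parcs (Cay G m T)"
    show "\<forall>e\<in>copies G m \<times> copies G m. ?\<Phi> e \<in> parcs (Cay G m T) \<longleftrightarrow> e \<in> parcs (Cay G m S)"
      unfolding eq[symmetric] using inj_on_image_mem_iff[OF inj2 _ parcs_Cay_subset[OF S]] by blast
  next
    assume R: "\<forall>e\<in>copies G m \<times> copies G m.
      ?\<Phi> e \<in> parcs (Cay G m T) \<longleftrightarrow> e \<in> parcs (Cay G m S)"
    show "?\<Phi> ` parcs (Cay G m S) = parcs (Cay G m T)"
    proof (intro equalityI subsetI)
      fix e assume "e \<in> ?\<Phi> ` parcs (Cay G m S)"
      then obtain e' where e': "e' \<in> parcs (Cay G m S)" "e = ?\<Phi> e'" by (rule imageE)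
      show "e \<in> parcs (Cay G m T)"
        unfolding e'(2) using bspec[OF R subsetD[OF parcs_Cay_subset[OF S] e'(1)]] e'(1) by (rule iffD2)
    next
      fix e assume e: "e \<in> parcs (Cay G m T)"
      then have "e \<in> ?\<Phi> ` (copies G m \<times> copies G m)"
        unfolding im2 using parcs_Cay_subset[OF T] by (rule subsetD[rotated])
      then obtain e' where e': "e' \<in> copies G m \<times> copies G m" "e = ?\<Phi> e'" by (rule imageE)
      then have "e' \<in> parcs (Cay G m S)" using bspec[OF R e'(1)] e by (simp only:)
      then show "e \<in> ?\<Phi> ` parcs (Cay G m S)" unfolding e'(2) by (rule imageI)
    qed
  qed
  also have "\<dots> \<longleftrightarrow> (\<forall>u\<in>copies G m. \<forall>v\<in>copies G m.
      (\<phi> u, \<phi> v) \<in> parcs (Cay G m T) \<longleftrightarrow> (u, v) \<in> parcs (Cay G m S))"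
    by simp
  also have "\<dots> \<longleftrightarrow> ?R"
    by (intro ball_cong refl) (simp add: arc_iff_adjacent[OF S] arc_iff_adjacent[OF T] mem)
  finally show ?thesis .
qed

text \<open>
  A digraph isomorphism also carries a map on arcs; since arcs are pairs of vertices, this map is
  determined by the map on vertices, in both directions.
\<close>

lemma copy_preserving_iso_iff_copy_isomorphic:
  assumes S: "PCayley_family G m S" and T: "PCayley_family G m T"
  shows "copy_preserving_iso G m (Cay G m S) (Cay G m T) \<longleftrightarrow> copy_isomorphic m S T"
proof
  assume "copy_preserving_iso G m (Cay G m S) (Cay G m T)"
  then obtain f where f: "pre_digraph.digraph_isomorphism (with_proj (Cay G m S)) f"
    and eq: "with_proj (Cay G m T) = app_iso f (with_proj (Cay G m S))"
    and cop: "\<forall>i\<in>{1..m}. \<exists>j\<in>{1..m}. iso_verts f ` copy G i = copy G j"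
    unfolding copy_preserving_iso_def by blast
  have inj: "inj_on (iso_verts f) (copies G m)"
    using f by (simp add: pre_digraph.digraph_isomorphism_def)
  have eqs: "copies G m = iso_verts f ` copies G m" "iso_tail f = fst" "iso_head f = snd"
    "parcs (Cay G m T) = iso_arcs f ` parcs (Cay G m S)"
  proof -
    show "copies G m = iso_verts f ` copies G m"
      using arg_cong[OF eq, of verts] unfolding with_proj_simps app_iso_simps pverts_Cay .
    show "iso_tail f = fst" "iso_head f = snd"
      using arg_cong[OF eq, of tail] arg_cong[OF eq, of head]
      unfolding with_proj_simps app_iso_simps by simp_all
    show "parcs (Cay G m T) = iso_arcs f ` parcs (Cay G m S)"
      using arg_cong[OF eq, of arcs] unfolding with_proj_simps app_iso_simps .
  qed
  have "iso_arcs f (u, v) = (iso_verts f u, iso_verts f v)" if "(u, v) \<in> parcs (Cay G m S)" for u v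
  proof -
    have "\<forall>a\<in>parcs (Cay G m S). iso_verts f (fst a) = fst (iso_arcs f a) \<and>
        iso_verts f (snd a) = snd (iso_arcs f a)"
      using f eqs(2,3) by (simp add: pre_digraph.digraph_isomorphism_def)
    then show ?thesis using that by (metis fst_conv snd_conv prod.collapse)
  qed
  then have "iso_arcs f e = (\<lambda>(u, v). (iso_verts f u, iso_verts f v)) e"
    if "e \<in> parcs (Cay G m S)" for e
    using that by (cases e) simp
  then have "parcs (Cay G m T) = (\<lambda>(u, v). (iso_verts f u, iso_verts f v)) ` parcs (Cay G m S)"
    unfolding eqs(4) by (rule image_cong[OF refl])
  then have "perm_digraph (iso_verts f) (Cay G m S) = Cay G m T"
    by (simp add: perm_digraph_image)
  moreover have "bij_betw (iso_verts f) (copies G m) (copies G m)"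
    unfolding bij_betw_def using inj eqs(1)[symmetric] by blast
  ultimately show "copy_isomorphic m S T"
    unfolding copy_isomorphic_def using cop perm_digraph_Cay_iff[OF S T] by blast
next
  assume "copy_isomorphic m S T"
  then obtain \<phi> where bij: "bij_betw \<phi> (copies G m) (copies G m)"
    and cop: "\<forall>i\<in>{1..m}. \<exists>j\<in>{1..m}. \<phi> ` copy G i = copy G j"
    and "\<forall>u\<in>copies G m. \<forall>v\<in>copies G m. adjacent T (\<phi> u) (\<phi> v) \<longleftrightarrow> adjacent S u v"
    unfolding copy_isomorphic_def by blast
  then have perm: "perm_digraph \<phi> (Cay G m S) = Cay G m T"
    using perm_digraph_Cay_iff[OF S T bij] by blast
  define f where "f = \<lparr>iso_verts = \<phi>, iso_arcs = (\<lambda>(u, v). (\<phi> u, \<phi> v)),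
                       iso_head = snd, iso_tail = fst\<rparr>"
  have inj: "inj_on \<phi> (copies G m)" and im: "\<phi> ` copies G m = copies G m"
    using bij by (auto simp: bij_betw_def)
  have wf: "wf_digraph (with_proj (Cay G m S))"
    unfolding wf_digraph_wp_iff pair_wf_digraph_def using parcs_Cay_subset[OF S] by auto
  have inj2: "inj_on (\<lambda>(u, v). (\<phi> u, \<phi> v)) (parcs (Cay G m S))"
    by (rule inj_on_subset[OF map_prod_inj_on[OF inj inj, unfolded map_prod_def] parcs_Cay_subset[OF S]])
  have iso: "pre_digraph.digraph_isomorphism (with_proj (Cay G m S)) f"
    unfolding pre_digraph.digraph_isomorphism_def with_proj_simps pverts_Cay
    using wf inj inj2 by (simp add: f_def split_beta)
  have "parcs (Cay G m T) = (\<lambda>(u, v). (\<phi> u, \<phi> v)) ` parcs (Cay G m S)"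
    using arg_cong[OF perm, of parcs, symmetric]
    by (simp only: perm_digraph_image pair_pre_digraph.simps)
  then have arcs: "arcs (with_proj (Cay G m T)) = arcs (app_iso f (with_proj (Cay G m S)))"
    by (simp only: with_proj_simps app_iso_simps f_def digraph_isomorphism.simps)
  have "with_proj (Cay G m T) = app_iso f (with_proj (Cay G m S))"
  proof (rule pre_digraph.equality[OF _ arcs])
    show "verts (with_proj (Cay G m T)) = verts (app_iso f (with_proj (Cay G m S)))"
      by (simp only: with_proj_simps app_iso_simps pverts_Cay f_def digraph_isomorphism.simps im)
    show "tail (with_proj (Cay G m T)) = tail (app_iso f (with_proj (Cay G m S)))"
      by (simp only: with_proj_simps app_iso_simps f_def digraph_isomorphism.simps)
    show "head (with_proj (Cay G m T)) = head (app_iso f (with_proj (Cay G m S)))"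
      by (simp only: with_proj_simps app_iso_simps f_def digraph_isomorphism.simps)
    show "pre_digraph.more (with_proj (Cay G m T)) = pre_digraph.more (app_iso f (with_proj (Cay G m S)))"
      by (rule trans[OF unit_eq unit_eq[symmetric]])
  qed
  moreover have "iso_verts f = \<phi>" by (simp add: f_def)
  ultimately show "copy_preserving_iso G m (Cay G m S) (Cay G m T)"
    unfolding copy_preserving_iso_def using iso cop by blast
qed

end

section \<open>The normalizer of the right regular representation\<close>

context group begin

lemma right_mult_apply:
  "x \<in> carrier G \<Longrightarrow> i \<in> {1..m} \<Longrightarrow> right_mult G m g (x, i) = (x \<otimes> g, i)"
  by (simp add: right_mult_def in_copies)

lemma right_mult_Bij:
  assumes g: "g \<in> carrier G"
  shows "right_mult G m g \<in> Bij (copies G m)"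
proof -
  have "bij_betw (right_mult G m g) (copies G m) (copies G m)"
  proof (rule bij_betw_byWitness[where f' = "right_mult G m (inv g)"])
    show "\<forall>a\<in>copies G m. right_mult G m (inv g) (right_mult G m g a) = a"
      using g by (auto simp: in_copies right_mult_apply m_assoc)
    show "\<forall>a\<in>copies G m. right_mult G m g (right_mult G m (inv g) a) = a"
      using g by (auto simp: in_copies right_mult_apply m_assoc)
    show "right_mult G m g ` copies G m \<subseteq> copies G m"
      using g by (auto simp: in_copies right_mult_apply)
    show "right_mult G m (inv g) ` copies G m \<subseteq> copies G m"
      using g by (auto simp: in_copies right_mult_apply)
  qed
  moreover have "right_mult G m g \<in> extensional (copies G m)"
    by (simp add: right_mult_def)
  ultimately show ?thesis by (simp add: Bij_def)
qed

lemma BijGroup_mult: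
  "n \<in> Bij V \<Longrightarrow> k \<in> Bij V \<Longrightarrow> n \<otimes>\<^bsub>BijGroup V\<^esub> k = compose V n k"
  by (simp add: BijGroup_def)

lemma carrier_BijGroup: "carrier (BijGroup V) = Bij V"
  by (simp add: BijGroup_def)

lemma normalizer_R_iff:
  "n \<in> normalizer_R G m \<longleftrightarrow> n \<in> Bij (copies G m) \<and>
     n <#\<^bsub>BijGroup (copies G m)\<^esub> (right_mult G m ` carrier G)
       #>\<^bsub>BijGroup (copies G m)\<^esub> inv\<^bsub>BijGroup (copies G m)\<^esub> n = right_mult G m ` carrier G"
proof -
  have "right_mult G m ` carrier G \<subseteq> carrier (BijGroup (copies G m))"
    using right_mult_Bij by (auto simp: carrier_BijGroup)
  then show ?thesis
    by (simp add: normalizer_R_def normalizer_def stabilizer_def carrier_BijGroup)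
qed

text \<open>
  Rewritten without inverses, \<open>n R(g) n\<^sup>-\<^sup>1 = R(h)\<close> becomes \<open>n R(g) = R(h) n\<close>, which can be
  evaluated at a vertex.
\<close>

lemma normalizer_RD:
  assumes n: "n \<in> normalizer_R G m" and g: "g \<in> carrier G"
  obtains h where "h \<in> carrier G"
    "\<And>x i. x \<in> carrier G \<Longrightarrow> i \<in> {1..m} \<Longrightarrow> n (x \<otimes> g, i) = (fst (n (x, i)) \<otimes> h, snd (n (x, i)))"
proof -
  let ?V = "copies G m" and ?R = "right_mult G m"
  interpret B: group "BijGroup ?V" by (rule group_BijGroup)
  have nB: "n \<in> carrier (BijGroup ?V)" and RB: "\<And>g. g \<in> carrier G \<Longrightarrow> ?R g \<in> carrier (BijGroup ?V)"
    using n right_mult_Bij by (auto simp: normalizer_R_iff carrier_BijGroup)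
  have "n \<otimes>\<^bsub>BijGroup ?V\<^esub> ?R g \<otimes>\<^bsub>BijGroup ?V\<^esub> inv\<^bsub>BijGroup ?V\<^esub> n \<in> ?R ` carrier G"
    using n g unfolding normalizer_R_iff l_coset_def r_coset_def by blast
  then obtain h where h: "h \<in> carrier G"
    and eq: "n \<otimes>\<^bsub>BijGroup ?V\<^esub> ?R g \<otimes>\<^bsub>BijGroup ?V\<^esub> inv\<^bsub>BijGroup ?V\<^esub> n = ?R h"
    by blast
  have "?R h \<otimes>\<^bsub>BijGroup ?V\<^esub> n = n \<otimes>\<^bsub>BijGroup ?V\<^esub> ?R g"
    unfolding eq[symmetric] using nB RB[OF g] by (simp add: B.m_assoc)
  then have comp: "compose ?V (?R h) n = compose ?V n (?R g)"
    using nB RB[OF g] RB[OF h] by (simp add: BijGroup_mult carrier_BijGroup)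
  have "n (x \<otimes> g, i) = (fst (n (x, i)) \<otimes> h, snd (n (x, i)))"
    if "x \<in> carrier G" "i \<in> {1..m}" for x i
  proof -
    have xi: "(x, i) \<in> ?V" using that by (simp add: in_copies)
    then have "n (x, i) \<in> ?V" using nB Bij_imp_funcset unfolding carrier_BijGroup by blast
    then have "?R h (n (x, i)) = (fst (n (x, i)) \<otimes> h, snd (n (x, i)))"
      by (metis in_copies prod.collapse right_mult_apply)
    then show ?thesis
      using fun_cong[OF comp, of "(x, i)"] xi that by (simp add: compose_eq right_mult_apply)
  qed
  with h show thesis using that by blast
qed

lemma normalizer_RI:
  assumes n: "n \<in> Bij (copies G m)" and \<alpha>: "\<alpha> ` carrier G = carrier G"
    and eq: "\<And>g x i. g \<in> carrier G \<Longrightarrow> x \<in> carrier G \<Longrightarrow> i \<in> {1..m} \<Longrightarrow>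
               n (x \<otimes> g, i) = (fst (n (x, i)) \<otimes> \<alpha> g, snd (n (x, i)))"
  shows "n \<in> normalizer_R G m"
proof -
  let ?V = "copies G m" and ?R = "right_mult G m"
  interpret B: group "BijGroup ?V" by (rule group_BijGroup)
  have nB: "n \<in> carrier (BijGroup ?V)" and RB: "\<And>g. g \<in> carrier G \<Longrightarrow> ?R g \<in> carrier (BijGroup ?V)"
    using n right_mult_Bij by (auto simp: carrier_BijGroup)
  have conj: "n \<otimes>\<^bsub>BijGroup ?V\<^esub> ?R g \<otimes>\<^bsub>BijGroup ?V\<^esub> inv\<^bsub>BijGroup ?V\<^esub> n = ?R (\<alpha> g)"
    if g: "g \<in> carrier G" for g
  proof -
    have \<alpha>g: "\<alpha> g \<in> carrier G" using \<alpha> g by blast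
    have "compose ?V n (?R g) = compose ?V (?R (\<alpha> g)) n"
    proof (rule extensionalityI[of _ ?V])
      fix u assume u: "u \<in> ?V"
      obtain x i where [simp]: "u = (x, i)" by (cases u)
      have xi: "x \<in> carrier G" "i \<in> {1..m}" using u by (auto simp: in_copies)
      have "n u \<in> ?V" using n u Bij_imp_funcset by blast
      then have "?R (\<alpha> g) (n u) = (fst (n u) \<otimes> \<alpha> g, snd (n u))"
        by (metis in_copies prod.collapse right_mult_apply)
      then show "compose ?V n (?R g) u = compose ?V (?R (\<alpha> g)) n u"
        using u xi eq[OF g xi] by (simp add: compose_eq right_mult_apply)
    qed (simp_all add: compose_def)
    then have "n \<otimes>\<^bsub>BijGroup ?V\<^esub> ?R g = ?R (\<alpha> g) \<otimes>\<^bsub>BijGroup ?V\<^esub> n"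
      using nB RB[OF g] RB[OF \<alpha>g] by (simp add: BijGroup_mult carrier_BijGroup)
    then show ?thesis using nB RB[OF \<alpha>g] by (simp add: B.m_assoc)
  qed
  have "n <#\<^bsub>BijGroup ?V\<^esub> (?R ` carrier G) #>\<^bsub>BijGroup ?V\<^esub> inv\<^bsub>BijGroup ?V\<^esub> n
      = (\<lambda>g. n \<otimes>\<^bsub>BijGroup ?V\<^esub> ?R g \<otimes>\<^bsub>BijGroup ?V\<^esub> inv\<^bsub>BijGroup ?V\<^esub> n) ` carrier G"
    unfolding l_coset_def r_coset_def by blast
  also have "\<dots> = (\<lambda>g. ?R (\<alpha> g)) ` carrier G"
    using conj by (rule image_cong[OF refl])
  also have "\<dots> = ?R ` carrier G"
    using \<alpha> by (metis image_image)
  finally show ?thesis using n by (simp add: normalizer_R_iff)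
qed

text \<open>
  The map \<open>\<alpha>\<close> is conjugation of \<open>R(G)\<close> by \<open>n\<close>, read on \<open>G\<close>; the vertices \<open>\<one>\<^sub>i\<close> then determine \<open>n\<close>
  because \<open>R(G)\<close> is transitive on each copy.
\<close>

lemma normalizer_R_affine:
  assumes fin: "finite (carrier G)" and m: "m > 0" and n: "n \<in> normalizer_R G m"
  obtains \<sigma> \<alpha> g where "bij_betw \<sigma> {1..m} {1..m}" "\<alpha> \<in> iso G G" "g \<in> {1..m} \<rightarrow> carrier G"
    "\<And>x i. x \<in> carrier G \<Longrightarrow> i \<in> {1..m} \<Longrightarrow> n (x, i) = (g i \<otimes> \<alpha> x, \<sigma> i)"
proof -
  have bij: "bij_betw n (copies G m) (copies G m)"
    using n by (simp add: normalizer_R_iff Bij_def)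
  then have inj: "inj_on n (copies G m)" by (simp add: bij_betw_def)
  have mem: "n u \<in> copies G m" if "u \<in> copies G m" for u
    using bij that by (rule bij_betwE[THEN bspec])
  have "\<exists>h\<in>carrier G. \<forall>x\<in>carrier G. \<forall>i\<in>{1..m}.
      n (x \<otimes> g, i) = (fst (n (x, i)) \<otimes> h, snd (n (x, i)))" if "g \<in> carrier G" for g
    by (rule normalizer_RD[OF n that]) blast
  then obtain \<alpha> where \<alpha>: "\<And>g. g \<in> carrier G \<Longrightarrow> \<alpha> g \<in> carrier G"
    and \<alpha>n: "\<And>g x i. g \<in> carrier G \<Longrightarrow> x \<in> carrier G \<Longrightarrow> i \<in> {1..m} \<Longrightarrow>
               n (x \<otimes> g, i) = (fst (n (x, i)) \<otimes> \<alpha> g, snd (n (x, i)))"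
    by metis
  define \<sigma> where "\<sigma> i = snd (n (\<one>, i))" for i
  define g where "g i = fst (n (\<one>, i))" for i
  have g: "g i \<in> carrier G" and \<sigma>: "\<sigma> i \<in> {1..m}" if "i \<in> {1..m}" for i
  proof -
    have "n (\<one>, i) \<in> copies G m" using that by (intro mem) (simp add: in_copies)
    then have "(g i, \<sigma> i) \<in> copies G m" by (simp add: g_def \<sigma>_def)
    then show "g i \<in> carrier G" "\<sigma> i \<in> {1..m}" by (simp_all add: in_copies)
  qed
  have form: "n (x, i) = (g i \<otimes> \<alpha> x, \<sigma> i)" if "x \<in> carrier G" "i \<in> {1..m}" for x i
    using \<alpha>n[OF that(1) one_closed that(2)] that by (simp add: g_def \<sigma>_def)
  have 1: "1 \<in> {1..m}" using m by simp
  have hom: "\<alpha> (x \<otimes> y) = \<alpha> x \<otimes> \<alpha> y" if x: "x \<in> carrier G" and y: "y \<in> carrier G" for x y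
  proof -
    have "n (x \<otimes> y, 1) = (g 1 \<otimes> \<alpha> x \<otimes> \<alpha> y, \<sigma> 1)"
      using \<alpha>n[OF y x 1] form[OF x 1] by simp
    moreover have "n (x \<otimes> y, 1) = (g 1 \<otimes> \<alpha> (x \<otimes> y), \<sigma> 1)"
      using form[OF _ 1] x y by simp
    ultimately have "g 1 \<otimes> \<alpha> (x \<otimes> y) = g 1 \<otimes> (\<alpha> x \<otimes> \<alpha> y)"
      using g[OF 1] \<alpha> x y by (simp add: m_assoc)
    then show ?thesis using g[OF 1] \<alpha> x y by simp
  qed
  have "inj_on \<alpha> (carrier G)"
  proof (rule inj_onI)
    fix x y assume *: "x \<in> carrier G" "y \<in> carrier G" "\<alpha> x = \<alpha> y"
    then have "n (x, 1) = n (y, 1)" using form[OF _ 1] by simp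
    from inj_onD[OF inj this] have "(x, 1::nat) = (y, 1)"
      using * 1 by (simp add: in_copies)
    then show "x = y" by simp
  qed
  moreover from this have surj: "\<alpha> ` carrier G = carrier G"
    using fin \<alpha> by (intro endo_inj_surj) auto
  ultimately have iso: "\<alpha> \<in> iso G G"
    unfolding iso_def hom_def bij_betw_def using \<alpha> hom by blast
  \<comment> \<open>If two copies had the same image, \<open>n\<close> would map some \<open>x\<^sub>i\<close> to the image of \<open>\<one>\<^sub>j\<close>, as \<open>\<alpha>\<close> is
    onto.\<close>
  have "inj_on \<sigma> {1..m}"
  proof (rule inj_onI)
    fix i j assume ij: "i \<in> {1..m}" "j \<in> {1..m}" "\<sigma> i = \<sigma> j"
    have "inv (g i) \<otimes> g j \<in> \<alpha> ` carrier G" unfolding surj using g ij by simp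
    then obtain x where x: "x \<in> carrier G" "\<alpha> x = inv (g i) \<otimes> g j" by (metis imageE)
    have "\<alpha> \<one> = \<one>" using iso hom_one[OF _ is_group is_group] by (simp add: iso_def)
    then have "n (\<one>, j) = (g j, \<sigma> j)" using form[OF one_closed ij(2)] g[OF ij(2)] by simp
    moreover have "n (x, i) = (g j, \<sigma> j)"
      using form[OF x(1) ij(1)] x(2) g ij by (simp add: m_assoc[symmetric])
    ultimately have "n (x, i) = n (\<one>, j)" by simp
    from inj_onD[OF inj this] have "(x, i) = (\<one>, j)"
      using x ij by (simp add: in_copies)
    then show "i = j" by simp
  qed
  moreover from this have "\<sigma> ` {1..m} = {1..m}"
    by (intro endo_inj_surj finite_atLeastAtMost image_subsetI \<sigma>)
  ultimately have "bij_betw \<sigma> {1..m} {1..m}" by (simp add: bij_betw_def)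
  then show thesis using that iso g form by blast
qed

lemma affine_normalizer_R:
  assumes fin: "finite (carrier G)" and \<sigma>: "bij_betw \<sigma> {1..m} {1..m}" and \<alpha>: "\<alpha> \<in> iso G G"
    and g: "g \<in> {1..m} \<rightarrow> carrier G"
  shows "(\<lambda>(x, i)\<in>copies G m. (g i \<otimes> \<alpha> x, \<sigma> i)) \<in> normalizer_R G m" (is "?n \<in> _")
proof (rule normalizer_RI)
  have \<alpha>c: "\<alpha> x \<in> carrier G" if "x \<in> carrier G" for x
    using \<alpha> that by (auto simp: iso_def hom_def)
  have gc: "g i \<in> carrier G" if "i \<in> {1..m}" for i using g that by blast
  have \<sigma>c: "\<sigma> i \<in> {1..m}" if "i \<in> {1..m}" for i using \<sigma> that by (rule bij_betwE[THEN bspec])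
  have app: "?n (x, i) = (g i \<otimes> \<alpha> x, \<sigma> i)" if "x \<in> carrier G" "i \<in> {1..m}" for x i
    using that by (simp add: in_copies)
  show surj: "\<alpha> ` carrier G = carrier G" using \<alpha> by (simp add: iso_def bij_betw_def)
  have inj: "inj_on ?n (copies G m)"
  proof (rule inj_onI)
    fix u v assume uv: "u \<in> copies G m" "v \<in> copies G m" "?n u = ?n v"
    obtain x i y j where [simp]: "u = (x, i)" "v = (y, j)" by (metis surj_pair)
    have c: "x \<in> carrier G" "y \<in> carrier G" "i \<in> {1..m}" "j \<in> {1..m}" using uv by (auto simp: in_copies)
    have eqs: "g i \<otimes> \<alpha> x = g j \<otimes> \<alpha> y" "\<sigma> i = \<sigma> j" using uv(3) c app by auto
    then have "i = j" using c \<sigma> by (auto simp: bij_betw_def dest: inj_onD)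
    then have "\<alpha> x = \<alpha> y" using eqs(1) c gc \<alpha>c by simp
    then have "x = y" using \<alpha> c by (auto simp: iso_def bij_betw_def dest: inj_onD)
    then show "u = v" using \<open>i = j\<close> by simp
  qed
  have sub: "?n ` copies G m \<subseteq> copies G m"
  proof
    fix w assume "w \<in> ?n ` copies G m"
    then obtain u where u: "u \<in> copies G m" "w = ?n u" by (rule imageE)
    obtain x i where [simp]: "u = (x, i)" by (cases u)
    have c: "x \<in> carrier G" "i \<in> {1..m}" using u by (auto simp: in_copies)
    then show "w \<in> copies G m" unfolding u(2) using app gc \<sigma>c \<alpha>c by (simp add: in_copies)
  qed
  have "finite (copies G m)" using fin by (auto simp: copies_def copy_def)
  then have "?n ` copies G m = copies G m" using sub inj by (rule endo_inj_surj)
  then show "?n \<in> Bij (copies G m)" using inj by (simp add: Bij_def bij_betw_def)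
  fix h x i assume "h \<in> carrier G" "x \<in> carrier G" "i \<in> {1..m}"
  moreover from this have "\<alpha> (x \<otimes> h) = \<alpha> x \<otimes> \<alpha> h" using \<alpha> by (auto simp: iso_def hom_def)
  ultimately show "?n (x \<otimes> h, i) = (fst (?n (x, i)) \<otimes> \<alpha> h, snd (?n (x, i)))"
    using gc \<alpha>c by (simp add: in_copies m_assoc)
qed

text \<open>
  Because \<open>n\<close> commutes with \<open>R(G)\<close> up to \<open>\<alpha>\<close>, it is enough to look at the arcs that start at the
  vertices \<open>\<one>\<^sub>i\<close>, and these are the connection sets.
\<close>

lemma normalizer_image_iff_affinely_equivalent:
  assumes fin: "finite (carrier G)" and m: "m > 0"
    and S: "PCayley_family G m S" and T: "PCayley_family G m T"
  shows "(\<exists>n\<in>normalizer_R G m. perm_digraph n (Cay G m S) = Cay G m T) \<longleftrightarrow>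
           affinely_equivalent m S T"
proof
  assume "\<exists>n\<in>normalizer_R G m. perm_digraph n (Cay G m S) = Cay G m T"
  then obtain n where n: "n \<in> normalizer_R G m" and eq: "perm_digraph n (Cay G m S) = Cay G m T"
    by blast
  have "bij_betw n (copies G m) (copies G m)"
    using n by (simp add: normalizer_R_iff Bij_def)
  then have adj: "\<forall>u\<in>copies G m. \<forall>v\<in>copies G m. adjacent T (n u) (n v) \<longleftrightarrow> adjacent S u v"
    using perm_digraph_Cay_iff[OF S T] eq by blast
  obtain \<sigma> \<alpha> g where \<sigma>: "bij_betw \<sigma> {1..m} {1..m}" and \<alpha>: "\<alpha> \<in> iso G G"
    and g: "g \<in> {1..m} \<rightarrow> carrier G"
    and form: "\<And>x i. x \<in> carrier G \<Longrightarrow> i \<in> {1..m} \<Longrightarrow> n (x, i) = (g i \<otimes> \<alpha> x, \<sigma> i)"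
    by (rule normalizer_R_affine[OF fin m n]) blast
  have one: "\<alpha> \<one> = \<one>" using \<alpha> hom_one[OF _ is_group is_group] by (simp add: iso_def)
  have "g j \<otimes> \<alpha> z \<otimes> inv (g i) \<in> T (\<sigma> i) (\<sigma> j) \<longleftrightarrow> z \<in> S i j"
    if ij: "i \<in> {1..m}" "j \<in> {1..m}" and z: "z \<in> carrier G" for i j z
  proof -
    have "g i \<in> carrier G" using g ij by blast
    moreover have "adjacent T (n (\<one>, i)) (n (z, j)) \<longleftrightarrow> adjacent S (\<one>, i) (z, j)"
      using adj ij z by (simp add: in_copies)
    ultimately show ?thesis using ij z by (simp add: form one adjacent_def)
  qed
  then show "affinely_equivalent m S T"
    unfolding affinely_equivalent_def using \<sigma> \<alpha> g by blast
next
  assume "affinely_equivalent m S T"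
  then obtain \<sigma> \<alpha> g where \<sigma>: "bij_betw \<sigma> {1..m} {1..m}" and \<alpha>: "\<alpha> \<in> iso G G"
    and g: "g \<in> {1..m} \<rightarrow> carrier G"
    and eq: "\<And>i j z. i \<in> {1..m} \<Longrightarrow> j \<in> {1..m} \<Longrightarrow> z \<in> carrier G \<Longrightarrow>
      g j \<otimes> \<alpha> z \<otimes> inv (g i) \<in> T (\<sigma> i) (\<sigma> j) \<longleftrightarrow> z \<in> S i j"
    unfolding affinely_equivalent_def by blast
  define n where "n = (\<lambda>(x, i)\<in>copies G m. (g i \<otimes> \<alpha> x, \<sigma> i))"
  have n: "n \<in> normalizer_R G m"
    unfolding n_def by (rule affine_normalizer_R[OF fin \<sigma> \<alpha> g])
  then have bij: "bij_betw n (copies G m) (copies G m)"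
    by (simp add: normalizer_R_iff Bij_def)
  interpret \<alpha>: group_hom G G \<alpha> using \<alpha> by unfold_locales (simp add: iso_def)
  have "adjacent T (n u) (n v) \<longleftrightarrow> adjacent S u v"
    if uv: "u \<in> copies G m" "v \<in> copies G m" for u v
  proof -
    obtain x i y j where [simp]: "u = (x, i)" "v = (y, j)" by (metis surj_pair)
    have c: "x \<in> carrier G" "y \<in> carrier G" "i \<in> {1..m}" "j \<in> {1..m}" using uv by (auto simp: in_copies)
    then have "g i \<in> carrier G" "g j \<in> carrier G" using g by auto
    then have "g j \<otimes> \<alpha> y \<otimes> inv (g i \<otimes> \<alpha> x) = g j \<otimes> \<alpha> (y \<otimes> inv x) \<otimes> inv (g i)"
      using c by (simp add: inv_mult_group m_assoc)
    then show ?thesis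
      using eq[of i j "y \<otimes> inv x"] c uv by (simp add: adjacent_def n_def)
  qed
  then have "perm_digraph n (Cay G m S) = Cay G m T"
    using perm_digraph_Cay_iff[OF S T bij] by blast
  then show "\<exists>n\<in>normalizer_R G m. perm_digraph n (Cay G m S) = Cay G m T" using n by blast
qed

lemma mPDCI_group_iff:
  assumes "finite (carrier G)" "m > 0"
  shows "mPDCI_group G m \<longleftrightarrow>
    (\<forall>S T. PCayley_family G m S \<and> PCayley_family G m T \<and> copy_isomorphic m S T \<longrightarrow>
       affinely_equivalent m S T)"
  unfolding mPDCI_group_def mPCI_digraph_def PCayley_digraph_def
  using copy_preserving_iso_iff_copy_isomorphic normalizer_image_iff_affinely_equivalent[OF assms]
  by metis

lemma mPCI_group_iff:
  assumes "finite (carrier G)" "m > 0"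
  shows "mPCI_group G m \<longleftrightarrow>
    (\<forall>S T. PCayley_family G m S \<and> PCayley_family G m T \<and>
       inverse_symmetric m S \<and> inverse_symmetric m T \<and> copy_isomorphic m S T \<longrightarrow>
       affinely_equivalent m S T)"
proof -
  have graph: "PCayley_graph G m \<Gamma> \<longleftrightarrow>
      (\<exists>S. PCayley_family G m S \<and> inverse_symmetric m S \<and> \<Gamma> = Cay G m S)" for \<Gamma>
    unfolding PCayley_graph_def PCayley_digraph_def inverse_symmetric_def
    using symmetric_Cay_iff by metis
  show ?thesis
    unfolding mPCI_group_def mPCI_graph_def graph
    using copy_preserving_iso_iff_copy_isomorphic normalizer_image_iff_affinely_equivalent[OF assms]
    by metis
qed

end

section \<open>Copy-preserving isomorphisms as families of permutations\<close>

context group begin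

lemma copy_isomorphic_iff:
  "copy_isomorphic m S T \<longleftrightarrow>
    (\<exists>\<sigma> f. bij_betw \<sigma> {1..m} {1..m} \<and> (\<forall>i\<in>{1..m}. bij_betw (f i) (carrier G) (carrier G)) \<and>
      (\<forall>i\<in>{1..m}. \<forall>j\<in>{1..m}. \<forall>x\<in>carrier G. \<forall>y\<in>carrier G.
         f j y \<otimes> inv (f i x) \<in> T (\<sigma> i) (\<sigma> j) \<longleftrightarrow> y \<otimes> inv x \<in> S i j))" (is "_ \<longleftrightarrow> ?R")
proof
  assume "copy_isomorphic m S T"
  then obtain \<phi> where bij: "bij_betw \<phi> (copies G m) (copies G m)"
    and cop: "\<forall>i\<in>{1..m}. \<exists>j\<in>{1..m}. \<phi> ` copy G i = copy G j"
    and adj: "\<forall>u\<in>copies G m. \<forall>v\<in>copies G m. adjacent T (\<phi> u) (\<phi> v) \<longleftrightarrow> adjacent S u v"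
    unfolding copy_isomorphic_def by blast
  have inj: "inj_on \<phi> (copies G m)" using bij by (simp add: bij_betw_def)
  from cop obtain \<sigma> where \<sigma>: "\<And>i. i \<in> {1..m} \<Longrightarrow> \<sigma> i \<in> {1..m}"
    and \<phi>\<sigma>: "\<And>i. i \<in> {1..m} \<Longrightarrow> \<phi> ` copy G i = copy G (\<sigma> i)"
    by metis
  have sub: "copy G i \<subseteq> copies G m" if "i \<in> {1..m}" for i
    unfolding copies_def using that by blast
  define f where "f i x = fst (\<phi> (x, i))" for i x
  have form: "\<phi> (x, i) = (f i x, \<sigma> i)" and fG: "f i x \<in> carrier G"
    if "x \<in> carrier G" "i \<in> {1..m}" for x i
  proof -
    have "\<phi> (x, i) \<in> copy G (\<sigma> i)"
      unfolding \<phi>\<sigma>[OF that(2), symmetric] using that(1) by (simp add: copy_def)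
    then show "\<phi> (x, i) = (f i x, \<sigma> i)" "f i x \<in> carrier G" by (auto simp: f_def copy_def)
  qed
  have "inj_on \<sigma> {1..m}"
  proof (rule inj_onI)
    fix i j assume ij: "i \<in> {1..m}" "j \<in> {1..m}" "\<sigma> i = \<sigma> j"
    then have "\<phi> ` copy G i = \<phi> ` copy G j" by (simp add: \<phi>\<sigma>)
    then have "copy G i = copy G j"
      using inj_on_image_eq_iff[OF inj sub sub] ij by simp
    moreover have "(\<one>, i) \<in> copy G i" by (simp add: copy_def)
    ultimately show "i = j" by (auto simp: copy_def)
  qed
  moreover from this have "\<sigma> ` {1..m} = {1..m}"
    by (intro endo_inj_surj finite_atLeastAtMost image_subsetI \<sigma>)
  ultimately have "bij_betw \<sigma> {1..m} {1..m}" by (simp add: bij_betw_def)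
  moreover have "bij_betw (f i) (carrier G) (carrier G)" if i: "i \<in> {1..m}" for i
  proof (rule bij_betw_imageI)
    show "inj_on (f i) (carrier G)"
    proof (rule inj_onI)
      fix x y assume *: "x \<in> carrier G" "y \<in> carrier G" "f i x = f i y"
      then have "\<phi> (x, i) = \<phi> (y, i)" using form i by simp
      from inj_onD[OF inj this] show "x = y" using * i by (simp add: in_copies)
    qed
    show "f i ` carrier G = carrier G"
    proof (intro equalityI subsetI)
      fix y assume y: "y \<in> carrier G"
      then have "(y, \<sigma> i) \<in> \<phi> ` copy G i" unfolding \<phi>\<sigma>[OF i] by (simp add: copy_def)
      then obtain x where "x \<in> carrier G" "(y, \<sigma> i) = \<phi> (x, i)" by (auto simp: copy_def)
      then show "y \<in> f i ` carrier G" using form i by auto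
    qed (use fG i in blast)
  qed
  moreover have "f j y \<otimes> inv (f i x) \<in> T (\<sigma> i) (\<sigma> j) \<longleftrightarrow> y \<otimes> inv x \<in> S i j"
    if "i \<in> {1..m}" "j \<in> {1..m}" "x \<in> carrier G" "y \<in> carrier G" for i j x y
  proof -
    have "adjacent T (\<phi> (x, i)) (\<phi> (y, j)) \<longleftrightarrow> adjacent S (x, i) (y, j)"
      using adj that by (simp add: in_copies)
    then show ?thesis using that by (simp add: form adjacent_def)
  qed
  ultimately show ?R by blast
next
  assume ?R
  then obtain \<sigma> f where \<sigma>: "bij_betw \<sigma> {1..m} {1..m}"
    and f: "\<And>i. i \<in> {1..m} \<Longrightarrow> bij_betw (f i) (carrier G) (carrier G)"
    and adj: "\<And>i j x y. \<lbrakk>i \<in> {1..m}; j \<in> {1..m}; x \<in> carrier G; y \<in> carrier G\<rbrakk> \<Longrightarrow>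
         f j y \<otimes> inv (f i x) \<in> T (\<sigma> i) (\<sigma> j) \<longleftrightarrow> y \<otimes> inv x \<in> S i j"
    by metis
  define \<phi> where "\<phi> = (\<lambda>(x, i). (f i x, \<sigma> i))"
  have fG: "f i x \<in> carrier G" if "x \<in> carrier G" "i \<in> {1..m}" for x i
    using f[OF that(2)] that(1) by (rule bij_betwE[THEN bspec])
  have \<sigma>m: "\<sigma> i \<in> {1..m}" if "i \<in> {1..m}" for i using \<sigma> that by (rule bij_betwE[THEN bspec])
  have img: "\<phi> ` copy G i = copy G (\<sigma> i)" if i: "i \<in> {1..m}" for i
  proof -
    have "\<phi> ` copy G i = (\<lambda>x. (x, \<sigma> i)) ` (f i ` carrier G)"
      unfolding copy_def image_image by (simp add: \<phi>_def)
    then show ?thesis using f[OF i] by (simp add: copy_def bij_betw_def)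
  qed
  have "bij_betw \<phi> (copies G m) (copies G m)"
  proof (rule bij_betw_imageI)
    show "inj_on \<phi> (copies G m)"
    proof (rule inj_onI)
      fix u v assume uv: "u \<in> copies G m" "v \<in> copies G m" "\<phi> u = \<phi> v"
      obtain x i y j where [simp]: "u = (x, i)" "v = (y, j)" by (metis surj_pair)
      have c: "x \<in> carrier G" "y \<in> carrier G" "i \<in> {1..m}" "j \<in> {1..m}" using uv by (auto simp: in_copies)
      have eqs: "f i x = f j y" "\<sigma> i = \<sigma> j" using uv(3) by (auto simp: \<phi>_def)
      have ij: "i = j" using inj_onD[OF bij_betw_imp_inj_on[OF \<sigma>] eqs(2) c(3,4)] .
      have "x = y" using inj_onD[OF bij_betw_imp_inj_on[OF f[OF c(3)]] _ c(1,2)] eqs(1) ij by simp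
      then show "u = v" using ij by simp
    qed
    have "\<phi> ` copies G m = (\<Union>i\<in>{1..m}. copy G (\<sigma> i))"
      unfolding copies_def image_UN using img by (intro SUP_cong refl)
    also have "\<dots> = (\<Union>i\<in>\<sigma> ` {1..m}. copy G i)" by simp
    also have "\<dots> = copies G m" using \<sigma> by (simp add: copies_def bij_betw_def)
    finally show "\<phi> ` copies G m = copies G m" .
  qed
  moreover have "\<forall>i\<in>{1..m}. \<exists>j\<in>{1..m}. \<phi> ` copy G i = copy G j" using img \<sigma>m by blast
  moreover have "adjacent T (\<phi> u) (\<phi> v) \<longleftrightarrow> adjacent S u v"
    if "u \<in> copies G m" "v \<in> copies G m" for u v
    using that adj by (cases u; cases v) (simp add: in_copies adjacent_def \<phi>_def)
  ultimately show "copy_isomorphic m S T" unfolding copy_isomorphic_def by blast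
qed

lemma affinely_equivalent_if_affine:
  assumes \<sigma>: "bij_betw \<sigma> {1..m} {1..m}" and \<alpha>: "\<alpha> \<in> iso G G" and g: "g \<in> {1..m} \<rightarrow> carrier G"
    and adj: "\<And>i j x y. \<lbrakk>i \<in> {1..m}; j \<in> {1..m}; x \<in> carrier G; y \<in> carrier G\<rbrakk> \<Longrightarrow>
         (g j \<otimes> \<alpha> y) \<otimes> inv (g i \<otimes> \<alpha> x) \<in> T (\<sigma> i) (\<sigma> j) \<longleftrightarrow> y \<otimes> inv x \<in> S i j"
  shows "affinely_equivalent m S T"
proof -
  have one: "\<alpha> \<one> = \<one>" using \<alpha> hom_one[OF _ is_group is_group] by (simp add: iso_def)
  have "g j \<otimes> \<alpha> z \<otimes> inv (g i) \<in> T (\<sigma> i) (\<sigma> j) \<longleftrightarrow> z \<in> S i j"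
    if "i \<in> {1..m}" "j \<in> {1..m}" "z \<in> carrier G" for i j z
  proof -
    have "g i \<in> carrier G" using g that by blast
    then show ?thesis using adj[of i j \<one> z] that by (simp add: one)
  qed
  then show ?thesis unfolding affinely_equivalent_def using \<sigma> \<alpha> g by blast
qed

text \<open>
  A permutation of a group with at most two elements is the translation by its value at the
  identity, so every isomorphism that permutes the copies is affine already, with \<open>\<alpha>\<close> the
  identity.
\<close>

lemma affinely_equivalent_if_order_le_2:
  assumes "order G \<le> 2" and fin: "finite (carrier G)" and iso: "copy_isomorphic m S T"
  shows "affinely_equivalent m S T"
proof -
  obtain \<sigma> f where \<sigma>: "bij_betw \<sigma> {1..m} {1..m}"
    and f: "\<And>i. i \<in> {1..m} \<Longrightarrow> bij_betw (f i) (carrier G) (carrier G)"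
    and adj: "\<And>i j x y. \<lbrakk>i \<in> {1..m}; j \<in> {1..m}; x \<in> carrier G; y \<in> carrier G\<rbrakk> \<Longrightarrow>
         f j y \<otimes> inv (f i x) \<in> T (\<sigma> i) (\<sigma> j) \<longleftrightarrow> y \<otimes> inv x \<in> S i j"
    using iso unfolding copy_isomorphic_iff by metis
  have le2: "z = x \<or> z = y"
    if "x \<in> carrier G" "y \<in> carrier G" "z \<in> carrier G" "x \<noteq> y" for x y z
  proof (rule ccontr)
    assume "\<not> (z = x \<or> z = y)"
    then have "card {x, y, z} = 3" using that(4) by auto
    moreover have "card {x, y, z} \<le> order G"
      unfolding order_def using fin that by (intro card_mono) auto
    ultimately show False using assms(1) by simp
  qed
  have fG: "f i x \<in> carrier G" if "x \<in> carrier G" "i \<in> {1..m}" for x i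
    using f[OF that(2)] that(1) by (rule bij_betwE[THEN bspec])
  have form: "f i x = f i \<one> \<otimes> x" if x: "x \<in> carrier G" and i: "i \<in> {1..m}" for x i
  proof (cases "x = \<one>")
    case False
    then have "f i x \<noteq> f i \<one>"
      using inj_onD[OF bij_betw_imp_inj_on[OF f[OF i]], of x \<one>] x by auto
    moreover have "f i \<one> \<otimes> x \<noteq> f i \<one>" using False fG[OF one_closed i] x by simp
    ultimately show ?thesis
      using le2[of "f i \<one>" "f i \<one> \<otimes> x" "f i x"] fG[OF _ i] x by auto
  qed (use fG[OF _ i] in simp)
  show ?thesis
  proof (rule affinely_equivalent_if_affine[OF \<sigma>])
    show "(\<lambda>x. x) \<in> iso G G" by (simp add: iso_def hom_def bij_betw_def)
    show "(\<lambda>i. f i \<one>) \<in> {1..m} \<rightarrow> carrier G" using fG by blast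
  qed (simp add: adj flip: form)
qed

section \<open>Twisting along a subgroup\<close>

lemma inv_cancel:
  assumes "x \<in> carrier G" "y \<in> carrier G"
  shows "inv x \<otimes> (x \<otimes> y) = y" "x \<otimes> (inv x \<otimes> y) = y"
  using assms by (simp_all flip: m_assoc)

definition twisted ::
  "('a \<Rightarrow> 'a) \<Rightarrow> nat set \<Rightarrow> (nat \<Rightarrow> nat \<Rightarrow> 'a set) \<Rightarrow> nat \<Rightarrow> nat \<Rightarrow> 'a set" where
  "twisted \<theta> F S i j = (if i \<in> F \<and> j \<in> F then \<theta> ` S i j else S i j)"

end

text \<open>
  That \<open>\<theta>\<close> is trivial modulo \<open>K\<close> lets the twist on some copies coexist with the identity on the
  other copies: connection sets equal to \<open>K\<close> do not see the difference.
\<close>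

locale coset_twist = group +
  fixes H K \<theta>
  assumes H: "subgroup H G" and K: "subgroup K G" and KH: "K \<subseteq> H"
    and comm: "\<And>x y. x \<in> H \<Longrightarrow> y \<in> H \<Longrightarrow> x \<otimes> y = y \<otimes> x"
    and \<theta>_bij: "bij_betw \<theta> H H"
    and \<theta>_mult: "\<And>x y. x \<in> H \<Longrightarrow> y \<in> H \<Longrightarrow> \<theta> (x \<otimes> y) = \<theta> x \<otimes> \<theta> y"
    and \<theta>_mod: "\<And>x. x \<in> H \<Longrightarrow> \<theta> x \<otimes> inv x \<in> K"
begin

lemma HG: "x \<in> H \<Longrightarrow> x \<in> carrier G" using subgroup.subset[OF H] by blast

lemma \<theta>H: "x \<in> H \<Longrightarrow> \<theta> x \<in> H" using \<theta>_bij by (rule bij_betwE[THEN bspec])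

lemma \<theta>_one: "\<theta> \<one> = \<one>"
proof -
  have 1: "\<one> \<in> H" using H by (rule subgroup.one_closed)
  have "\<theta> \<one> \<otimes> \<theta> \<one> = \<theta> \<one>" using \<theta>_mult[OF 1 1] by simp
  then show ?thesis using \<theta>H[OF 1] HG by simp
qed

lemma \<theta>_inv: "x \<in> H \<Longrightarrow> \<theta> (inv x) = inv (\<theta> x)"
proof -
  assume x: "x \<in> H"
  then have ix: "inv x \<in> H" using H by (simp add: subgroup.m_inv_closed)
  have "\<theta> (inv x) \<otimes> \<theta> x = \<one>" using \<theta>_mult[OF ix x] \<theta>_one HG[OF x] by simp
  then show ?thesis using \<theta>H x ix HG by (simp add: inv_equality)
qed

text \<open>
  Choose a representative \<open>r\<close> in each coset \<open>H r\<close> and put \<open>\<phi>(h r) = \<theta>(h) r\<close>.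
\<close>

lemma ex_twist:
  assumes fin: "finite (carrier G)"
  obtains \<phi> where "bij_betw \<phi> (carrier G) (carrier G)"
    "\<And>h x. h \<in> H \<Longrightarrow> x \<in> carrier G \<Longrightarrow> \<phi> (h \<otimes> x) = \<theta> h \<otimes> \<phi> x"
    "\<And>x. x \<in> carrier G \<Longrightarrow> \<phi> x \<otimes> inv x \<in> K"
proof -
  define r where "r x = (SOME y. y \<in> H #> x)" for x
  define \<phi> where "\<phi> x = \<theta> (x \<otimes> inv (r x)) \<otimes> r x" for x
  have HGs: "H \<subseteq> carrier G" using H by (rule subgroup.subset)
  have r: "r x \<in> H #> x" if "x \<in> carrier G" for x
    unfolding r_def using rcos_self[OF that H] by (rule someI)
  have rG: "r x \<in> carrier G" if "x \<in> carrier G" for x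
    using r[OF that] r_coset_subset_G[OF HGs that] by blast
  have xr: "x \<otimes> inv (r x) \<in> H" if x: "x \<in> carrier G" for x
  proof -
    obtain h where h: "h \<in> H" "r x = h \<otimes> x" using r[OF x] unfolding r_coset_def by blast
    then have "x \<otimes> inv (r x) = inv h" using x HG by (simp add: inv_mult_group m_assoc[symmetric])
    then show ?thesis using h H by (simp add: subgroup.m_inv_closed)
  qed
  have \<phi>G: "\<phi> x \<in> carrier G" if "x \<in> carrier G" for x
    unfolding \<phi>_def using \<theta>H[OF xr[OF that]] HG rG[OF that] by simp
  have hom: "\<phi> (h \<otimes> x) = \<theta> h \<otimes> \<phi> x" if h: "h \<in> H" and x: "x \<in> carrier G" for h x
  proof -
    have "H #> (h \<otimes> x) = H #> x"
      using coset_mult_assoc[OF HGs HG[OF h] x] coset_join2[OF HG[OF h] H h] by simp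
    then have "r (h \<otimes> x) = r x" by (simp add: r_def)
    then show ?thesis unfolding \<phi>_def
      using \<theta>_mult[OF h xr[OF x]] \<theta>H[OF h] \<theta>H[OF xr[OF x]] rG[OF x] x h HG by (simp add: m_assoc)
  qed
  have mod: "\<phi> x \<otimes> inv x \<in> K" if x: "x \<in> carrier G" for x
  proof -
    have "\<phi> x \<otimes> inv x = \<theta> (x \<otimes> inv (r x)) \<otimes> inv (x \<otimes> inv (r x))"
      unfolding \<phi>_def using x rG[OF x] \<theta>H[OF xr[OF x]] HG by (simp add: inv_mult_group m_assoc)
    then show ?thesis using \<theta>_mod[OF xr[OF x]] by simp
  qed
  \<comment> \<open>Equal values force \<open>x\<close> and \<open>y\<close> into the same coset of \<open>K \<le> H\<close>, where \<open>\<phi>\<close> is as injective as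
    \<open>\<theta>\<close>.\<close>
  have "inj_on \<phi> (carrier G)"
  proof (rule inj_onI)
    fix x y assume x: "x \<in> carrier G" and y: "y \<in> carrier G" and eq: "\<phi> x = \<phi> y"
    have "inv (\<phi> y \<otimes> inv y) \<otimes> (\<phi> x \<otimes> inv x) \<in> K"
      using mod x y K by (simp add: subgroup.m_closed subgroup.m_inv_closed)
    moreover have "inv (\<phi> y \<otimes> inv y) \<otimes> (\<phi> x \<otimes> inv x) = y \<otimes> inv x"
      using \<phi>G[OF y] x y unfolding eq by (simp add: inv_mult_group m_assoc inv_cancel)
    ultimately have h: "y \<otimes> inv x \<in> H" using KH by auto
    have "\<phi> y = \<theta> (y \<otimes> inv x) \<otimes> \<phi> x" using hom[OF h x] x y by (simp add: m_assoc)
    then have "\<theta> (y \<otimes> inv x) = \<one>" using eq \<phi>G[OF x] \<theta>H[OF h] HG by simp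
    then have "y \<otimes> inv x = \<one>"
      using inj_onD[OF bij_betw_imp_inj_on[OF \<theta>_bij] _ h subgroup.one_closed[OF H]] by (simp add: \<theta>_one)
    then show "x = y" using x y by (metis inv_closed inv_equality inv_inv)
  qed
  moreover from this have "\<phi> ` carrier G = carrier G"
    by (intro endo_inj_surj fin image_subsetI \<phi>G)
  ultimately have "bij_betw \<phi> (carrier G) (carrier G)" by (simp add: bij_betw_def)
  then show thesis using that hom mod by blast
qed

text \<open>
  The isomorphism is the map \<open>\<phi>\<close> of the previous lemma on the copies in \<open>F\<close> and the identity
  elsewhere. For two copies in \<open>F\<close>, differences in \<open>H\<close> are mapped by \<open>\<theta>\<close>; for one copy in \<open>F\<close> and
  one outside, \<open>\<phi>(x) \<in> K x\<close> shows that membership in \<open>K\<close> is preserved.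
\<close>

lemma copy_isomorphic_twisted:
  assumes fin: "finite (carrier G)"
    and SH: "\<And>i j. i \<in> {1..m} \<Longrightarrow> j \<in> {1..m} \<Longrightarrow> S i j \<subseteq> H"
    and SK: "\<And>i j. i \<in> {1..m} \<Longrightarrow> j \<in> {1..m} \<Longrightarrow> i \<in> F \<longleftrightarrow> j \<notin> F \<Longrightarrow> S i j = {} \<or> S i j = K"
  shows "copy_isomorphic m S (twisted \<theta> F S)"
proof -
  obtain \<phi> where \<phi>: "bij_betw \<phi> (carrier G) (carrier G)"
    and hom: "\<And>h x. h \<in> H \<Longrightarrow> x \<in> carrier G \<Longrightarrow> \<phi> (h \<otimes> x) = \<theta> h \<otimes> \<phi> x"
    and mod: "\<And>x. x \<in> carrier G \<Longrightarrow> \<phi> x \<otimes> inv x \<in> K"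
    using ex_twist[OF fin] by metis
  have \<phi>G: "\<phi> x \<in> carrier G" if "x \<in> carrier G" for x using \<phi> that by (rule bij_betwE[THEN bspec])
  have K_cancel: "k \<otimes> z \<in> K \<longleftrightarrow> z \<in> K" "z \<otimes> inv k \<in> K \<longleftrightarrow> z \<in> K"
    if k: "k \<in> K" and z: "z \<in> carrier G" for k z
  proof -
    have kG: "k \<in> carrier G" using k KH HG by blast
    have "z = inv k \<otimes> (k \<otimes> z)" "z = (z \<otimes> inv k) \<otimes> k" using kG z by (simp_all add: m_assoc[symmetric], simp add: m_assoc)
    then show "k \<otimes> z \<in> K \<longleftrightarrow> z \<in> K" "z \<otimes> inv k \<in> K \<longleftrightarrow> z \<in> K"
      using k K by (metis subgroup.m_closed subgroup.m_inv_closed)+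
  qed
  define f where "f i = (if i \<in> F then \<phi> else (\<lambda>x. x))" for i
  have adj: "f j y \<otimes> inv (f i x) \<in> twisted \<theta> F S i j \<longleftrightarrow> y \<otimes> inv x \<in> S i j"
    if i: "i \<in> {1..m}" and j: "j \<in> {1..m}" and x: "x \<in> carrier G" and y: "y \<in> carrier G" for i j x y
  proof -
    let ?z = "y \<otimes> inv x"
    have zG: "?z \<in> carrier G" using x y by simp
    consider "i \<in> F" "j \<in> F" | "i \<in> F" "j \<notin> F" | "i \<notin> F" "j \<in> F" | "i \<notin> F" "j \<notin> F" by blast
    then show ?thesis
    proof cases
      case 1
      have mem: "?z \<in> H \<longleftrightarrow> \<phi> y \<otimes> inv (\<phi> x) \<in> H"
      proof -
        have "\<phi> y \<otimes> inv (\<phi> x) = (\<phi> y \<otimes> inv y) \<otimes> ?z \<otimes> inv (\<phi> x \<otimes> inv x)"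
          using x y \<phi>G[OF x] \<phi>G[OF y] by (simp add: inv_mult_group m_assoc inv_cancel)
        moreover have "?z = inv (\<phi> y \<otimes> inv y) \<otimes> (\<phi> y \<otimes> inv (\<phi> x)) \<otimes> (\<phi> x \<otimes> inv x)"
          using x y \<phi>G[OF x] \<phi>G[OF y] by (simp add: inv_mult_group m_assoc inv_cancel)
        moreover have "\<phi> y \<otimes> inv y \<in> H" "\<phi> x \<otimes> inv x \<in> H" using mod x y KH by auto
        ultimately show ?thesis
          using H by (metis subgroup.m_closed subgroup.m_inv_closed)
      qed
      have val: "\<phi> y \<otimes> inv (\<phi> x) = \<theta> ?z" if "?z \<in> H"
        using hom[OF that x] x y \<phi>G[OF x] \<theta>H[OF that] HG by (simp add: m_assoc)
      have "\<phi> y \<otimes> inv (\<phi> x) \<in> \<theta> ` S i j \<longleftrightarrow> ?z \<in> S i j"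
      proof
        assume "?z \<in> S i j"
        moreover from this have "?z \<in> H" using SH[OF i j] by blast
        ultimately show "\<phi> y \<otimes> inv (\<phi> x) \<in> \<theta> ` S i j" using val by auto
      next
        assume "\<phi> y \<otimes> inv (\<phi> x) \<in> \<theta> ` S i j"
        then obtain s where s: "s \<in> S i j" "\<phi> y \<otimes> inv (\<phi> x) = \<theta> s" by blast
        then have sH: "s \<in> H" using SH[OF i j] by blast
        then have zH: "?z \<in> H" using mem s(2) \<theta>H by simp
        then have "\<theta> ?z = \<theta> s" using val s(2) by simp
        then have "?z = s" by (rule inj_onD[OF bij_betw_imp_inj_on[OF \<theta>_bij] _ zH sH])
        then show "?z \<in> S i j" using s(1) by simp
      qed
      then show ?thesis using 1 by (simp add: f_def twisted_def)
    next
      case 2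
      have "y \<otimes> inv (\<phi> x) = ?z \<otimes> inv (\<phi> x \<otimes> inv x)"
        using x y \<phi>G[OF x] by (simp add: inv_mult_group m_assoc inv_cancel)
      then have "y \<otimes> inv (\<phi> x) \<in> K \<longleftrightarrow> ?z \<in> K" using K_cancel(2)[OF mod[OF x] zG] by simp
      then show ?thesis using SK[OF i j] 2 by (auto simp: f_def twisted_def)
    next
      case 3
      have "\<phi> y \<otimes> inv x = (\<phi> y \<otimes> inv y) \<otimes> ?z"
        using x y \<phi>G[OF y] by (simp add: m_assoc inv_cancel)
      then have "\<phi> y \<otimes> inv x \<in> K \<longleftrightarrow> ?z \<in> K" using K_cancel(1)[OF mod[OF y] zG] by simp
      then show ?thesis using SK[OF i j] 3 by (auto simp: f_def twisted_def)
    next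
      case 4
      then show ?thesis by (simp add: f_def twisted_def)
    qed
  qed
  show ?thesis
    unfolding copy_isomorphic_iff
  proof (intro exI conjI ballI)
    show "bij_betw (\<lambda>i. i) {1..m} {1..m}" by (simp add: bij_betw_def)
    show "bij_betw (f i) (carrier G) (carrier G)" if "i \<in> {1..m}" for i
      using \<phi> by (simp add: f_def bij_betw_def)
  qed (use adj in blast)
qed

end

section \<open>Detecting a twist\<close>

context group begin

text \<open>
  With \<open>p\<^sub>i\<^sub>j = g\<^sub>j g\<^sub>i\<^sup>-\<^sup>1\<close> and \<open>\<gamma>\<^sub>i(z) = g\<^sub>i \<alpha>(z) g\<^sub>i\<^sup>-\<^sup>1\<close> the sets become \<open>T\<^bsub>\<sigma>(i),\<sigma>(j)\<^esub> = p\<^sub>i\<^sub>j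
  \<gamma>\<^sub>i(S\<^sub>i\<^sub>j)\<close>. In this form \<open>\<one> \<in> S\<^sub>i\<^sub>j\<close> puts \<open>p\<^sub>i\<^sub>j\<close> itself into the image, and \<open>\<gamma>\<^sub>i\<close> and \<open>\<gamma>\<^sub>j\<close>
  agree on elements whose image commutes with \<open>p\<^sub>i\<^sub>j\<close>; both facts drive the counterexamples below.
\<close>

lemma affinely_equivalentE:
  assumes S: "PCayley_family G m S" and T: "PCayley_family G m T"
    and eq: "affinely_equivalent m S T"
  shows "\<exists>\<sigma> p \<gamma>. bij_betw \<sigma> {1..m} {1..m} \<and>
    (\<forall>i\<in>{1..m}. \<gamma> i \<in> iso G G) \<and>
    (\<forall>i\<in>{1..m}. \<forall>j\<in>{1..m}. p i j \<in> carrier G) \<and>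
    (\<forall>i\<in>{1..m}. \<forall>j\<in>{1..m}. \<forall>k\<in>{1..m}. p j k \<otimes> p i j = p i k) \<and>
    (\<forall>i\<in>{1..m}. \<forall>j\<in>{1..m}. \<forall>z\<in>carrier G. p i j \<otimes> \<gamma> i z = \<gamma> j z \<otimes> p i j) \<and>
    (\<forall>i\<in>{1..m}. \<forall>j\<in>{1..m}. T (\<sigma> i) (\<sigma> j) = (\<lambda>z. p i j \<otimes> \<gamma> i z) ` S i j)"
proof -
  obtain \<sigma> \<alpha> g where \<sigma>: "bij_betw \<sigma> {1..m} {1..m}" and \<alpha>: "\<alpha> \<in> iso G G"
    and g: "g \<in> {1..m} \<rightarrow> carrier G"
    and mem: "\<And>i j z. i \<in> {1..m} \<Longrightarrow> j \<in> {1..m} \<Longrightarrow> z \<in> carrier G \<Longrightarrow>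
      g j \<otimes> \<alpha> z \<otimes> inv (g i) \<in> T (\<sigma> i) (\<sigma> j) \<longleftrightarrow> z \<in> S i j"
    using eq unfolding affinely_equivalent_def by blast
  interpret \<alpha>: group_hom G G \<alpha> using \<alpha> by unfold_locales (simp add: iso_def)
  have gG: "g i \<in> carrier G" if "i \<in> {1..m}" for i using g that by blast
  have \<sigma>m: "\<sigma> i \<in> {1..m}" if "i \<in> {1..m}" for i using \<sigma> that by (rule bij_betwE[THEN bspec])
  define p where "p i j = g j \<otimes> inv (g i)" for i j
  define \<gamma> where "\<gamma> i z = g i \<otimes> \<alpha> z \<otimes> inv (g i)" for i z
  have p\<gamma>: "p i j \<otimes> \<gamma> i z = g j \<otimes> \<alpha> z \<otimes> inv (g i)"
    if "i \<in> {1..m}" "j \<in> {1..m}" "z \<in> carrier G" for i j z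
    using that gG unfolding p_def \<gamma>_def by (simp add: m_assoc inv_cancel)
  show ?thesis
  proof (intro exI[of _ \<sigma>] exI[of _ p] exI[of _ \<gamma>] conjI ballI)
    show "bij_betw \<sigma> {1..m} {1..m}" by (rule \<sigma>)
    show "\<gamma> i \<in> iso G G" if i: "i \<in> {1..m}" for i
    proof (rule isoI)
      show "\<gamma> i \<in> hom G G"
        using gG[OF i] by (intro homI) (simp_all add: \<gamma>_def m_assoc inv_cancel)
      show "bij_betw (\<gamma> i) (carrier G) (carrier G)"
      proof (rule bij_betw_imageI)
        show "inj_on (\<gamma> i) (carrier G)"
        proof (rule inj_onI)
          fix x y assume *: "x \<in> carrier G" "y \<in> carrier G" "\<gamma> i x = \<gamma> i y"
          then have "\<alpha> x = \<alpha> y" using gG[OF i] by (simp add: \<gamma>_def m_assoc)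
          then show "x = y" using \<alpha> * by (auto simp: iso_def bij_betw_def dest: inj_onD)
        qed
        show "\<gamma> i ` carrier G = carrier G"
        proof (intro equalityI subsetI)
          fix y assume y: "y \<in> carrier G"
          have "inv (g i) \<otimes> y \<otimes> g i \<in> \<alpha> ` carrier G"
            using \<alpha> y gG[OF i] by (simp add: iso_def bij_betw_def)
          then obtain x where "x \<in> carrier G" "\<alpha> x = inv (g i) \<otimes> y \<otimes> g i" by (metis imageE)
          then have "x \<in> carrier G" "\<gamma> i x = y"
            using y gG[OF i] by (simp_all add: \<gamma>_def m_assoc inv_cancel)
          then show "y \<in> \<gamma> i ` carrier G" by blast
        qed (use gG[OF i] in \<open>auto simp: \<gamma>_def\<close>)
      qed
    qed
    show "p i j \<in> carrier G" if "i \<in> {1..m}" "j \<in> {1..m}" for i j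
      using that gG by (simp add: p_def)
    show "p j k \<otimes> p i j = p i k" if "i \<in> {1..m}" "j \<in> {1..m}" "k \<in> {1..m}" for i j k
      using that gG by (simp add: p_def m_assoc inv_cancel)
    show "p i j \<otimes> \<gamma> i z = \<gamma> j z \<otimes> p i j" if "i \<in> {1..m}" "j \<in> {1..m}" "z \<in> carrier G" for i j z
      using that gG by (simp add: p_def \<gamma>_def m_assoc inv_cancel)
    show "T (\<sigma> i) (\<sigma> j) = (\<lambda>z. p i j \<otimes> \<gamma> i z) ` S i j" if ij: "i \<in> {1..m}" "j \<in> {1..m}" for i j
    proof (intro equalityI subsetI)
      fix w assume w: "w \<in> T (\<sigma> i) (\<sigma> j)"
      then have wG: "w \<in> carrier G" using T \<sigma>m ij unfolding PCayley_family_def by blast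
      have "inv (g j) \<otimes> w \<otimes> g i \<in> \<alpha> ` carrier G"
        using \<alpha> wG gG ij by (simp add: iso_def bij_betw_def)
      then obtain z where z: "z \<in> carrier G" "\<alpha> z = inv (g j) \<otimes> w \<otimes> g i" by (metis imageE)
      then have "g j \<otimes> \<alpha> z \<otimes> inv (g i) = w"
        using wG gG ij by (simp add: m_assoc inv_cancel)
      then show "w \<in> (\<lambda>z. p i j \<otimes> \<gamma> i z) ` S i j"
        using mem[OF ij z(1)] w p\<gamma>[OF ij z(1)] by (metis imageI)
    next
      fix w assume "w \<in> (\<lambda>z. p i j \<otimes> \<gamma> i z) ` S i j"
      then obtain z where z: "z \<in> S i j" "w = p i j \<otimes> \<gamma> i z" by (rule imageE)
      then have "z \<in> carrier G" using S ij unfolding PCayley_family_def by blast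
      then show "w \<in> T (\<sigma> i) (\<sigma> j)" using mem[OF ij] p\<gamma>[OF ij] z by metis
    qed
  qed
qed

lemma card_affine_image:
  assumes "p \<in> carrier G" "\<gamma> \<in> iso G G" "A \<subseteq> carrier G"
  shows "card ((\<lambda>z. p \<otimes> \<gamma> z) ` A) = card A"
proof (rule card_image, rule inj_onI)
  fix x y assume *: "x \<in> A" "y \<in> A" "p \<otimes> \<gamma> x = p \<otimes> \<gamma> y"
  then have xy: "x \<in> carrier G" "y \<in> carrier G" using assms by auto
  then have "\<gamma> x \<in> carrier G" "\<gamma> y \<in> carrier G" using assms(2) by (auto simp: iso_def hom_def)
  then have "\<gamma> x = \<gamma> y" using * assms(1) by simp
  then show "x = y" using assms(2) xy by (auto simp: iso_def bij_betw_def dest: inj_onD)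
qed

lemma affine_image_pair:
  assumes p: "p \<in> carrier G" and \<gamma>: "\<gamma> \<in> iso G G" and k: "k \<in> carrier G" and c: "c \<in> carrier G"
    and eq: "(\<lambda>z. p \<otimes> \<gamma> z) ` {\<one>, k} = {\<one>, c}"
  shows "\<gamma> k = c \<or> p = c \<and> \<gamma> k = inv c"
proof -
  have 1: "\<gamma> \<one> = \<one>" using \<gamma> hom_one[OF _ is_group is_group] by (simp add: iso_def)
  have \<gamma>k: "\<gamma> k \<in> carrier G" using \<gamma> k by (auto simp: iso_def hom_def)
  have eq': "{p, p \<otimes> \<gamma> k} = {\<one>, c}" using eq p 1 by simp
  then consider "p = \<one>" "p \<otimes> \<gamma> k = c" | "p = c" "p \<otimes> \<gamma> k = \<one>" by (auto simp: doubleton_eq_iff)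
  then show ?thesis
  proof cases
    case 1 then show ?thesis using \<gamma>k by simp
  next
    case 2 then show ?thesis using \<gamma>k c by (metis inv_equality inv_inv inv_closed)
  qed
qed

end

context coset_twist begin

lemma KG: "x \<in> K \<Longrightarrow> x \<in> carrier G" using KH HG by blast

lemma twisted_family:
  assumes "PCayley_family G m S" "\<And>i j. i \<in> {1..m} \<Longrightarrow> j \<in> {1..m} \<Longrightarrow> S i j \<subseteq> H"
  shows "PCayley_family G m (twisted \<theta> F S)"
proof -
  have "\<theta> ` S i j \<subseteq> carrier G" if "i \<in> {1..m}" "j \<in> {1..m}" for i j
    using assms(2)[OF that] \<theta>H HG by blast
  then show ?thesis
    using assms(1) unfolding PCayley_family_def twisted_def by simp
qed

lemma twisted_inverse_symmetric:
  assumes sym: "inverse_symmetric m S" and SH: "\<And>i j. i \<in> {1..m} \<Longrightarrow> j \<in> {1..m} \<Longrightarrow> S i j \<subseteq> H"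
  shows "inverse_symmetric m (twisted \<theta> F S)"
proof -
  have "twisted \<theta> F S i j = m_inv G ` twisted \<theta> F S j i" if ij: "i \<in> {1..m}" "j \<in> {1..m}" for i j
  proof -
    have Sij: "S i j = m_inv G ` S j i"
      using sym ij unfolding inverse_symmetric_def by blast
    have "\<theta> ` S i j = (\<lambda>x. \<theta> (inv x)) ` S j i"
      by (subst Sij) (rule image_image)
    also have "\<dots> = (\<lambda>x. inv (\<theta> x)) ` S j i"
      by (rule image_cong[OF refl]) (rule \<theta>_inv[OF subsetD[OF SH[OF ij(2,1)]]])
    also have "\<dots> = m_inv G ` \<theta> ` S j i"
      by (rule image_image[symmetric])
    finally have \<theta>ij: "\<theta> ` S i j = m_inv G ` \<theta> ` S j i" .
    show ?thesis
    proof (cases "i \<in> F \<and> j \<in> F")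
      case True
      then show ?thesis using \<theta>ij by (simp only: twisted_def if_True simp_thms)
    next
      case False
      then have "\<not> (j \<in> F \<and> i \<in> F)" by blast
      then show ?thesis using False Sij by (simp only: twisted_def if_False)
    qed
  qed
  then show ?thesis unfolding inverse_symmetric_def by blast
qed

lemma card_twisted:
  assumes "\<And>i j. S i j \<subseteq> H"
  shows "card (twisted \<theta> F S i j) = card (S i j)"
  using inj_on_subset[OF bij_betw_imp_inj_on[OF \<theta>_bij] assms]
  by (simp add: twisted_def card_image)

lemma affinely_equivalent_twisted_if_mPCI:
  assumes fin: "finite (carrier G)" and m: "m > 0" and S: "PCayley_family G m S"
    and SH: "\<And>i j. i \<in> {1..m} \<Longrightarrow> j \<in> {1..m} \<Longrightarrow> S i j \<subseteq> H"
    and SK: "\<And>i j. i \<in> {1..m} \<Longrightarrow> j \<in> {1..m} \<Longrightarrow> i \<in> F \<longleftrightarrow> j \<notin> F \<Longrightarrow> S i j = {} \<or> S i j = K"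
    and sym: "inverse_symmetric m S" and "mPCI_group G m"
  shows "affinely_equivalent m S (twisted \<theta> F S)"
proof (rule iffD1[OF mPCI_group_iff[OF fin m] assms(7), rule_format], intro conjI)
  show "PCayley_family G m (twisted \<theta> F S)" using S SH by (rule twisted_family)
  show "inverse_symmetric m (twisted \<theta> F S)" using sym SH by (rule twisted_inverse_symmetric)
  show "copy_isomorphic m S (twisted \<theta> F S)" using fin SH SK by (rule copy_isomorphic_twisted)
qed (rule S sym)+

text \<open>
  The graph joins copies \<open>1, 2\<close> and copies \<open>3, 4\<close> by \<open>{\<one>, a}\<close> and has \<open>K\<close> on the three edges of
  the path \<open>3 - 1 - 4 - 2\<close>; the twist acts on copies \<open>3\<close> and \<open>4\<close> and turns the second \<open>{\<one>, a}\<close>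
  into \<open>{\<one>, \<theta>(a)}\<close>. An affine equivalence of the two graphs must preserve the path, which leaves
  the identity and the reversal for \<open>\<sigma>\<close> on these four copies, and puts all \<open>g\<^sub>i\<close> into one coset of
  \<open>K\<close>. As \<open>H\<close> is commutative, the conjugated automorphisms \<open>\<gamma>\<^sub>1\<close> and \<open>\<gamma>\<^sub>3\<close> agree at \<open>a\<close>. But one
  of the two edges \<open>{\<one>, a}\<close> goes to an edge given by \<open>a\<close>, the other to an edge given by \<open>\<theta>(a)\<close>,
  and these prescribe different values at \<open>a\<close>. The last assumption keeps edges with connection set
  \<open>K\<close> apart from edges with connection set \<open>{\<one>, a}\<close>: if \<open>K\<close> has two elements, then its nontrivial
  element is an involution and \<open>a\<close> is not.
\<close>

lemma not_mPCI_group_if_twist: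
  assumes fin: "finite (carrier G)" and m: "m \<ge> 4" and a: "a \<in> H"
    and ne: "\<theta> a \<noteq> a" and ne_inv: "a \<in> K \<Longrightarrow> \<theta> a \<noteq> inv a"
    and K2: "card K \<noteq> 2 \<or> a \<otimes> a \<noteq> \<one>"
  shows "\<not> mPCI_group G m"
proof
  assume mPCI: "mPCI_group G m"
  define b where "b = \<theta> a"
  define E :: "(nat \<times> nat) set" where "E = {(1, 2), (3, 4)}"
  define E' :: "(nat \<times> nat) set" where "E' = {(1, 3), (3, 1), (1, 4), (4, 1), (2, 4), (4, 2)}"
  define S :: "nat \<Rightarrow> nat \<Rightarrow> 'a set" where
    "S i j = (if (i, j) \<in> E then {\<one>, a} else if (j, i) \<in> E then {\<one>, inv a}
              else if (i, j) \<in> E' then K else {})" for i j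
  define T where "T = twisted \<theta> {3, 4} S"
  have bH: "b \<in> H" unfolding b_def using a by (rule \<theta>H)
  have aG: "a \<in> carrier G" and bG: "b \<in> carrier G" using a bH HG by auto
  have iH: "inv a \<in> H" "inv b \<in> H" "\<one> \<in> H"
    using a bH H by (auto simp: subgroup.m_inv_closed subgroup.one_closed)
  have oneK: "\<one> \<in> K" using K by (rule subgroup.one_closed)
  have SH: "S i j \<subseteq> H" for i j using a iH KH by (auto simp: S_def E_def E'_def)
  have S: "PCayley_family G m S"
    unfolding PCayley_family_def
  proof (intro conjI ballI)
    show "S i j \<subseteq> carrier G" for i j using SH HG by blast
    show "S i i = {}" for i by (auto simp: S_def E_def E'_def)
  qed
  have invK: "m_inv G ` K = K"
  proof (intro equalityI subsetI)
    fix x assume "x \<in> K"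
    then have "inv x \<in> K" "x = inv (inv x)" using K KG by (auto simp: subgroup.m_inv_closed)
    then show "x \<in> m_inv G ` K" by blast
  qed (use K in \<open>auto simp: subgroup.m_inv_closed\<close>)
  have sym: "inverse_symmetric m S"
    unfolding inverse_symmetric_def
  proof (intro ballI)
    fix i j :: nat
    have pair: "m_inv G ` {\<one>, a} = {\<one>, inv a}" "m_inv G ` {\<one>, inv a} = {\<one>, a}"
      using aG by auto
    have E': "(j, i) \<in> E' \<longleftrightarrow> (i, j) \<in> E'"
      unfolding E'_def by (rule iffI; elim insertE emptyE; simp)
    have "\<not> ((i, j) \<in> E \<and> (j, i) \<in> E)"
      unfolding E_def by (rule notI, elim conjE insertE emptyE; simp)
    then consider "(i, j) \<in> E" "(j, i) \<notin> E" | "(i, j) \<notin> E" "(j, i) \<in> E"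
      | "(i, j) \<notin> E" "(j, i) \<notin> E"
      by blast
    then show "S i j = m_inv G ` S j i"
    proof cases
      case 1
      then have "S i j = {\<one>, a}" "S j i = {\<one>, inv a}" by (simp_all only: S_def if_True if_False)
      then show ?thesis by (simp only: pair)
    next
      case 2
      then have "S i j = {\<one>, inv a}" "S j i = {\<one>, a}" by (simp_all only: S_def if_True if_False)
      then show ?thesis by (simp only: pair)
    next
      case 3
      then show ?thesis by (simp add: S_def E' invK)
    qed
  qed
  have SK: "S i j = {} \<or> S i j = K" if "i \<in> {3, 4} \<longleftrightarrow> j \<notin> {3, 4}" for i j
  proof -
    have "(i, j) \<notin> E" "(j, i) \<notin> E" using that by (auto simp: E_def)
    then show ?thesis by (simp add: S_def)
  qed
  have m0: "m > 0" using m by simp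
  have equiv: "affinely_equivalent m S T"
    unfolding T_def by (rule affinely_equivalent_twisted_if_mPCI[OF fin m0 S SH SK sym mPCI])
  have T: "PCayley_family G m T"
    unfolding T_def by (rule twisted_family[OF S SH])
  from affinely_equivalentE[OF S T equiv] obtain \<sigma> p \<gamma> where \<sigma>: "bij_betw \<sigma> {1..m} {1..m}"
    and \<gamma>: "\<forall>i\<in>{1..m}. \<gamma> i \<in> iso G G"
    and p: "\<forall>i\<in>{1..m}. \<forall>j\<in>{1..m}. p i j \<in> carrier G"
    and pp: "\<forall>i\<in>{1..m}. \<forall>j\<in>{1..m}. \<forall>k\<in>{1..m}. p j k \<otimes> p i j = p i k"
    and p\<gamma>: "\<forall>i\<in>{1..m}. \<forall>j\<in>{1..m}. \<forall>z\<in>carrier G. p i j \<otimes> \<gamma> i z = \<gamma> j z \<otimes> p i j"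
    and img: "\<forall>i\<in>{1..m}. \<forall>j\<in>{1..m}. T (\<sigma> i) (\<sigma> j) = (\<lambda>z. p i j \<otimes> \<gamma> i z) ` S i j"
    by (elim exE conjE)
  note \<gamma> = bspec[OF \<gamma>] and p = bspec[OF bspec[OF p]] and pp = bspec[OF bspec[OF bspec[OF pp]]]
    and p\<gamma> = bspec[OF bspec[OF bspec[OF p\<gamma>]]] and img = bspec[OF bspec[OF img]]
  have idx: "(1::nat) \<in> {1..m}" "(2::nat) \<in> {1..m}" "(3::nat) \<in> {1..m}" "(4::nat) \<in> {1..m}"
    using m by auto
  have a1: "a \<noteq> \<one>" using ne \<theta>_one by auto
  have b1: "b \<noteq> \<one>"
  proof
    assume "b = \<one>"
    then have "\<theta> a = \<theta> \<one>" by (simp add: b_def \<theta>_one)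
    then show False using inj_onD[OF bij_betw_imp_inj_on[OF \<theta>_bij] _ a iH(3)] a1 by blast
  qed
  \<comment> \<open>The nontrivial elements of the two-element connection sets of the twisted graph.\<close>
  define C where "C = {a, inv a, b, inv b}"
  have CG: "c \<in> carrier G" if "c \<in> C" for c
    using that aG bG by (auto simp: C_def)
  have "inv a \<noteq> \<one>" "inv b \<noteq> \<one>" using aG bG a1 b1 by simp_all
  then have c1: "c \<noteq> \<one>" if "c \<in> C" for c
    using that a1 b1 unfolding C_def by (metis insert_iff empty_iff)
  have sq: "a \<otimes> a = \<one>" if c: "c \<in> C" "c \<otimes> c = \<one>" for c
  proof -
    have inv_sq: "x \<otimes> x = \<one>" if "x \<in> carrier G" "inv x \<otimes> inv x = \<one>" for x
      using that by (metis inv_mult_group inv_one inv_inv m_closed)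
    have "b \<otimes> b = \<one> \<Longrightarrow> a \<otimes> a = \<one>"
    proof -
      assume "b \<otimes> b = \<one>"
      then have "\<theta> (a \<otimes> a) = \<theta> \<one>" using \<theta>_mult[OF a a] by (simp add: b_def \<theta>_one)
      moreover have "a \<otimes> a \<in> H" using a H by (simp add: subgroup.m_closed)
      ultimately show ?thesis using inj_onD[OF bij_betw_imp_inj_on[OF \<theta>_bij] _ _ iH(3)] by blast
    qed
    then show ?thesis using c inv_sq aG bG by (auto simp: C_def)
  qed
  have not_pair: "(\<lambda>z. q \<otimes> \<delta> z) ` K \<noteq> {\<one>, c}"
    if q: "q \<in> carrier G" and \<delta>: "\<delta> \<in> iso G G" and c: "c \<in> C" for q \<delta> c
  proof
    assume eq: "(\<lambda>z. q \<otimes> \<delta> z) ` K = {\<one>, c}"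
    have "card K = 2"
      using card_affine_image[OF q \<delta> subgroup.subset[OF K]] c1[OF c] unfolding eq by simp
    then have a2: "a \<otimes> a \<noteq> \<one>" using K2 by simp
    from \<open>card K = 2\<close> obtain k where k: "K = {\<one>, k}" "k \<noteq> \<one>"
      using oneK by (metis card_2_iff doubleton_eq_iff insertE singletonD)
    have "k \<in> {\<one>, k}" by (rule insertI2[OF singletonI])
    then have kK: "k \<in> K" unfolding k(1)[symmetric] .
    then have kG: "k \<in> carrier G" by (rule KG)
    have "k \<otimes> k \<in> K" using kK kK by (rule subgroup.m_closed[OF K])
    moreover have "k \<otimes> k \<noteq> k" using k(2) kG by simp
    ultimately have kk: "k \<otimes> k = \<one>" unfolding k(1) by blast
    then have "\<delta> k \<otimes> \<delta> k = \<delta> \<one>" using \<delta> kG by (metis hom_mult iso_imp_homomorphism)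
    then have \<delta>kk: "\<delta> k \<otimes> \<delta> k = \<one>"
      using \<delta> hom_one[OF _ is_group is_group] by (simp add: iso_def)
    have "\<delta> k = c \<or> \<delta> k = inv c"
      using affine_image_pair[OF q \<delta> kG CG[OF c]] eq k by auto
    then have "\<delta> k \<in> C" using c aG bG by (auto simp: C_def)
    then show False using sq \<delta>kk a2 by blast
  qed
  have T_val: "T 1 2 = {\<one>, a}" "T 2 1 = {\<one>, inv a}" "T 3 4 = {\<one>, b}" "T 4 3 = {\<one>, inv b}"
    by (simp_all add: T_def twisted_def S_def E_def b_def \<theta>_one \<theta>_inv[OF a])
  have T_eq_S: "T k l = S k l" if "(k, l) \<notin> E" "(l, k) \<notin> E" for k l
  proof (cases "k \<in> {3, 4} \<and> l \<in> {3, 4}")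
    case True
    then have "(k, l) \<notin> E'" using that by (auto simp: E_def E'_def)
    then have "S k l = {}" using that by (simp add: S_def)
    then show ?thesis by (simp add: T_def twisted_def)
  next
    case False
    then show ?thesis by (simp only: T_def twisted_def if_False)
  qed
  have T_cases: "(\<exists>c\<in>C. T k l = {\<one>, c}) \<or> (k, l) \<in> E' \<and> T k l = K" if ne: "T k l \<noteq> {}" for k l
  proof (cases "(k, l) \<in> E \<or> (l, k) \<in> E")
    case True
    then have "(k, l) \<in> {(1, 2), (2, 1), (3, 4), (4, 3)}" by (auto simp: E_def)
    then show ?thesis using T_val unfolding C_def by blast
  next
    case False
    then have "T k l = S k l" using T_eq_S by blast
    then show ?thesis using ne False by (simp add: S_def split: if_splits)
  qed
  have K_edge: "(\<sigma> i, \<sigma> j) \<in> E' \<and> p i j \<in> K"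
    if ij: "i \<in> {1..m}" "j \<in> {1..m}" and SK: "S i j = K" for i j
  proof -
    have "T (\<sigma> i) (\<sigma> j) \<noteq> {}" using img[OF ij] SK oneK by auto
    moreover have "T (\<sigma> i) (\<sigma> j) \<noteq> {\<one>, c}" if "c \<in> C" for c
      using img[OF ij] SK not_pair[OF p[OF ij] \<gamma>[OF ij(1)] that] by simp
    ultimately have *: "(\<sigma> i, \<sigma> j) \<in> E'"
      and TK: "T (\<sigma> i) (\<sigma> j) = K"
      using T_cases by blast+
    have "\<gamma> i \<one> = \<one>" using \<gamma>[OF ij(1)] hom_one[OF _ is_group is_group] by (simp add: iso_def)
    then have "p i j \<in> (\<lambda>z. p i j \<otimes> \<gamma> i z) ` K" using oneK p[OF ij] by (metis imageI r_one)
    then show ?thesis using * TK img[OF ij] SK by simp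
  qed
  have e13: "(\<sigma> 1, \<sigma> 3) \<in> E'" "p 1 3 \<in> K"
    using K_edge[OF idx(1,3)] by (auto simp: S_def E_def E'_def)
  have e14: "(\<sigma> 1, \<sigma> 4) \<in> E'" "p 1 4 \<in> K"
    using K_edge[OF idx(1,4)] by (auto simp: S_def E_def E'_def)
  have e24: "(\<sigma> 2, \<sigma> 4) \<in> E'" "p 2 4 \<in> K"
    using K_edge[OF idx(2,4)] by (auto simp: S_def E_def E'_def)
  have "\<sigma> 1 \<noteq> \<sigma> 2" "\<sigma> 3 \<noteq> \<sigma> 4"
    using inj_onD[OF bij_betw_imp_inj_on[OF \<sigma>] _ idx(1,2)]
      inj_onD[OF bij_betw_imp_inj_on[OF \<sigma>] _ idx(3,4)] by auto
  \<comment> \<open>The two automorphisms of the path \<open>3 - 1 - 4 - 2\<close>.\<close>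
  then consider (same) "\<sigma> 1 = 1" "\<sigma> 2 = 2" "\<sigma> 3 = 3" "\<sigma> 4 = 4"
    | (reversed) "\<sigma> 1 = 4" "\<sigma> 2 = 3" "\<sigma> 3 = 2" "\<sigma> 4 = 1"
  proof -
    have \<sigma>1: "\<sigma> 1 = 1 \<or> \<sigma> 1 = 4" using e13(1) e14(1) \<open>\<sigma> 3 \<noteq> \<sigma> 4\<close> by (auto simp: E'_def)
    have \<sigma>4: "\<sigma> 4 = 1 \<or> \<sigma> 4 = 4" using e24(1) e14(1) \<open>\<sigma> 1 \<noteq> \<sigma> 2\<close> by (auto simp: E'_def)
    show thesis
    proof (cases "\<sigma> 1 = 1")
      case True
      moreover from this have "\<sigma> 4 = 4" using \<sigma>4 e14(1) by (auto simp: E'_def)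
      ultimately show thesis using same e13(1) e24(1) \<open>\<sigma> 1 \<noteq> \<sigma> 2\<close> \<open>\<sigma> 3 \<noteq> \<sigma> 4\<close> by (auto simp: E'_def)
    next
      case False
      then have "\<sigma> 1 = 4" using \<sigma>1 by simp
      moreover from this have "\<sigma> 4 = 1" using \<sigma>4 e14(1) by (auto simp: E'_def)
      ultimately show thesis using reversed e13(1) e24(1) \<open>\<sigma> 1 \<noteq> \<sigma> 2\<close> \<open>\<sigma> 3 \<noteq> \<sigma> 4\<close> by (auto simp: E'_def)
    qed
  qed
  \<comment> \<open>The edges \<open>1 2\<close> and \<open>3 4\<close> are kept or exchanged; an exchange also reverses their direction,
    whence the inverses.\<close>
  then obtain c d where cd: "c \<in> C" "d \<in> C" "(c, d) \<in> {(a, b), (inv b, inv a)}"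
    and T12: "T (\<sigma> 1) (\<sigma> 2) = {\<one>, c}" and T34: "T (\<sigma> 3) (\<sigma> 4) = {\<one>, d}"
  proof cases
    case same
    then have "T (\<sigma> 1) (\<sigma> 2) = {\<one>, a}" "T (\<sigma> 3) (\<sigma> 4) = {\<one>, b}"
      using T_val by (simp_all only:)
    then show thesis by (intro that) (auto simp: C_def)
  next
    case reversed
    then have "T (\<sigma> 1) (\<sigma> 2) = {\<one>, inv b}" "T (\<sigma> 3) (\<sigma> 4) = {\<one>, inv a}"
      using T_val by (simp_all only:)
    then show thesis by (intro that) (auto simp: C_def)
  qed
  have p12: "p 1 2 \<in> K"
  proof -
    have "p 1 2 = inv (p 2 4) \<otimes> p 1 4"
      using pp[OF idx(1,2,4)] p[OF idx(1,2)] p[OF idx(2,4)] by (metis inv_cancel(1))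
    then show ?thesis using e14 e24 K by (simp add: subgroup.m_closed subgroup.m_inv_closed)
  qed
  have p34: "p 3 4 \<in> K"
  proof -
    have "p 3 4 = p 1 4 \<otimes> inv (p 1 3)"
      using pp[OF idx(1,3,4)] p[OF idx(1,3)] p[OF idx(3,4)] by (metis inv_solve_right m_closed)
    then show ?thesis using e14 e13 K by (simp add: subgroup.m_closed subgroup.m_inv_closed)
  qed
  have S12: "S 1 2 = {\<one>, a}" and S34: "S 3 4 = {\<one>, a}" by (simp_all add: S_def E_def E'_def)
  \<comment> \<open>The translation part is \<open>\<one>\<close> or \<open>c\<close>; the second value needs \<open>c \<in> K\<close> because \<open>p\<^sub>1\<^sub>2 \<in> K\<close>.\<close>
  have c: "\<gamma> 1 a = c \<or> c \<in> K \<and> \<gamma> 1 a = inv c"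
    using affine_image_pair[OF p[OF idx(1,2)] \<gamma>[OF idx(1)] aG CG[OF cd(1)]] img[OF idx(1,2)]
      S12 T12 p12 by auto
  have d: "\<gamma> 3 a = d \<or> d \<in> K \<and> \<gamma> 3 a = inv d"
    using affine_image_pair[OF p[OF idx(3,4)] \<gamma>[OF idx(3)] aG CG[OF cd(2)]] img[OF idx(3,4)]
      S34 T34 p34 by auto
  have "\<gamma> 1 a \<in> H" using c cd(3) a bH iH bG by auto
  then have "p 1 3 \<otimes> \<gamma> 1 a = \<gamma> 1 a \<otimes> p 1 3" using e13(2) KH comm by blast
  then have "\<gamma> 3 a \<otimes> p 1 3 = \<gamma> 1 a \<otimes> p 1 3" using p\<gamma>[OF idx(1,3) aG] by simp
  moreover have "\<gamma> 1 a \<in> carrier G" "\<gamma> 3 a \<in> carrier G"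
    using \<gamma>[OF idx(1)] \<gamma>[OF idx(3)] aG by (auto simp: iso_def hom_def)
  ultimately have same: "\<gamma> 3 a = \<gamma> 1 a" using p[OF idx(1,3)] by simp
  have mod: "b \<otimes> inv a \<in> K" unfolding b_def using a by (rule \<theta>_mod)
  have Kinv: "x \<in> K" if "inv x \<in> K" "x \<in> carrier G" for x
    using subgroup.m_inv_closed[OF K that(1)] that(2) by simp
  have bK: "a \<in> K" if "b \<in> K"
  proof -
    have "inv b \<otimes> (b \<otimes> inv a) \<in> K"
      by (rule subgroup.m_closed[OF K subgroup.m_inv_closed[OF K that] mod])
    then have "inv a \<in> K" using aG bG by (simp add: inv_cancel)
    then show ?thesis by (rule Kinv[OF _ aG])
  qed
  have ab: "a \<noteq> inv b" if "a \<in> K \<or> b \<in> K"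
  proof
    assume "a = inv b"
    then have "b = inv a" using bG by simp
    moreover have "a \<in> K" using that bK by blast
    ultimately show False using ne_inv unfolding b_def[symmetric] by blast
  qed
  \<comment> \<open>Elements of \<open>K\<close> are known only up to inversion, which is why \<open>\<theta>(a) = a\<^sup>-\<^sup>1\<close> is excluded just
    for \<open>a \<in> K\<close>.\<close>
  have "c \<noteq> d \<and> (c \<in> K \<or> d \<in> K \<longrightarrow> c \<noteq> inv d)"
  proof (cases "(c, d) = (a, b)")
    case True
    then show ?thesis using ne ab by (simp add: b_def)
  next
    case False
    then have [simp]: "c = inv b" "d = inv a" using cd(3) by auto
    have "inv b \<noteq> inv a" using ne aG bG by (metis b_def inv_inv)
    moreover have "inv b \<noteq> inv (inv a)" if "inv b \<in> K \<or> inv a \<in> K"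
    proof -
      have "a \<in> K \<or> b \<in> K" using that Kinv[OF _ aG] Kinv[OF _ bG] by blast
      from ab[OF this] show ?thesis using aG by (metis inv_inv)
    qed
    ultimately show ?thesis by simp
  qed
  moreover have "inv c = d \<longleftrightarrow> c = inv d" using CG cd by (metis inv_inv)
  moreover have "inv c = inv d \<longleftrightarrow> c = d" using CG cd by (metis inv_inv)
  ultimately show False using c d same by auto
qed

end

section \<open>Elements of order three\<close>

lemma mPCI_group_if_mPDCI_group: "mPDCI_group G m \<Longrightarrow> mPCI_group G m"
  unfolding mPDCI_group_def mPCI_group_def mPCI_digraph_def mPCI_graph_def PCayley_graph_def by blast

context group begin

lemma order3_square:
  assumes "a \<in> carrier G" "a \<otimes> a \<otimes> a = \<one>"
  shows "a \<otimes> a = inv a" "inv a \<otimes> inv a = a"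
proof -
  show *: "a \<otimes> a = inv a" using assms by (simp add: inv_equality)
  have "inv a \<otimes> inv a = inv (a \<otimes> a)" using assms by (simp add: inv_mult_group)
  then show "inv a \<otimes> inv a = a" using * assms by simp
qed

lemma order3_neq_inv:
  assumes "a \<in> carrier G" "a \<noteq> \<one>" "a \<otimes> a \<otimes> a = \<one>"
  shows "inv a \<noteq> a"
proof
  assume "inv a = a"
  then have "a \<otimes> a = a" using order3_square(1)[OF assms(1,3)] by simp
  then show False using assms by simp
qed

lemma order3_subgroup:
  assumes a: "a \<in> carrier G" and a3: "a \<otimes> a \<otimes> a = \<one>"
  shows "subgroup {\<one>, a, inv a} G"
proof (rule subgroupI)
  fix x y assume "x \<in> {\<one>, a, inv a}" "y \<in> {\<one>, a, inv a}"
  then show "x \<otimes> y \<in> {\<one>, a, inv a}"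
    using a order3_square[OF a a3] by auto
next
  fix x assume "x \<in> {\<one>, a, inv a}"
  then show "inv x \<in> {\<one>, a, inv a}" using a by auto
qed (use a in auto)

text \<open>
  With \<open>K = H\<close> triviality modulo \<open>K\<close> is automatic. The twist by inversion is the only one: \<open>\<int>\<^sub>3\<close>
  has no other nontrivial automorphism.
\<close>

lemma order3_coset_twist:
  assumes a: "a \<in> carrier G" and a3: "a \<otimes> a \<otimes> a = \<one>"
  shows "coset_twist G {\<one>, a, inv a} {\<one>, a, inv a} (m_inv G)"
proof -
  let ?H = "{\<one>, a, inv a}"
  have H: "subgroup ?H G" using a a3 by (rule order3_subgroup)
  have comm: "x \<otimes> y = y \<otimes> x" if "x \<in> ?H" "y \<in> ?H" for x y
    using that a by auto
  show ?thesis
  proof (intro coset_twist.intro[OF is_group] coset_twist_axioms.intro)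
    show "subgroup ?H G" by (rule H)
    show "subgroup ?H G" by (rule H)
    show "?H \<subseteq> ?H" by simp
    show "x \<otimes> y = y \<otimes> x" if "x \<in> ?H" "y \<in> ?H" for x y using that by (rule comm)
    show "bij_betw (m_inv G) ?H ?H"
      by (rule bij_betw_byWitness[where f' = "m_inv G"]) (use a in auto)
    show "inv (x \<otimes> y) = inv x \<otimes> inv y" if "x \<in> ?H" "y \<in> ?H" for x y
    proof -
      have "x \<in> carrier G" "y \<in> carrier G" using that a by auto
      then show ?thesis using comm[OF that] by (metis inv_mult_group)
    qed
    show "inv x \<otimes> inv x \<in> ?H" if "x \<in> ?H" for x
      using subgroup.m_closed[OF H subgroup.m_inv_closed[OF H that] subgroup.m_inv_closed[OF H that]] .
  qed
qed

lemma order3_card: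
  assumes "a \<in> carrier G" "a \<noteq> \<one>" "a \<otimes> a \<otimes> a = \<one>"
  shows "card {\<one>, a, inv a} = 3"
proof -
  have "inv a \<noteq> a" "inv a \<noteq> \<one>" using order3_neq_inv[OF assms] assms by simp_all
  then show ?thesis using assms(2) by (simp add: card_insert_if)
qed

text \<open>
  Elements of \<open>\<langle>a\<rangle>\<close> commute with \<open>a\<close>, so conjugation by them cannot invert \<open>a\<close>.
\<close>

lemma order3_no_inversion:
  assumes a: "a \<in> carrier G" "a \<noteq> \<one>" "a \<otimes> a \<otimes> a = \<one>" and p: "p \<in> {\<one>, a, inv a}"
    and cd: "(c, d) = (a, inv a) \<or> (c, d) = (inv a, a)"
  shows "d \<otimes> p \<noteq> p \<otimes> c"
proof
  assume eq: "d \<otimes> p = p \<otimes> c"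
  have "p \<otimes> c = c \<otimes> p" and pG: "p \<in> carrier G" using p cd a(1) by auto
  then have "d \<otimes> p = c \<otimes> p" using eq by simp
  then have "d = c" using pG cd a(1) by auto
  then show False using cd order3_neq_inv[OF a] by auto
qed

text \<open>
  On a single edge \<open>{\<one>, a}\<close> inversion can be undone by a translation, but not on a triangle:
  copies \<open>1, 2, 3\<close> and copies \<open>4, 5, 6\<close> each carry a triangle with connection sets \<open>{\<one>}, {\<one>}, {\<one>,
  a}\<close>, and the two edges \<open>{\<one>}\<close> leave no freedom for a translation between the ends of the third.
  The edge \<open>1 4\<close> carries \<open>\<langle>a\<rangle>\<close>; it distinguishes the ends of each edge \<open>{\<one>, a}\<close>, so that the
  triangles have an orientation, and it keeps \<open>g\<^sub>1\<close> and \<open>g\<^sub>4\<close> in one coset of \<open>\<langle>a\<rangle>\<close>. Inverting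
  only the second triangle therefore demands an automorphism that both inverts \<open>a\<close> and does not.
\<close>

lemma not_mPCI_group_if_order3:
  assumes fin: "finite (carrier G)" and m: "m \<ge> 6"
    and a: "a \<in> carrier G" "a \<noteq> \<one>" "a \<otimes> a \<otimes> a = \<one>"
  shows "\<not> mPCI_group G m"
proof
  assume mPCI: "mPCI_group G m"
  define H where "H = {\<one>, a, inv a}"
  interpret coset_twist G H H "m_inv G" unfolding H_def by (rule order3_coset_twist[OF a(1,3)])
  have HG': "H \<subseteq> carrier G" using H by (rule subgroup.subset)
  define E1 :: "(nat \<times> nat) set" where "E1 = {(1, 2), (2, 3), (4, 5), (5, 6)}"
  define E2 :: "(nat \<times> nat) set" where "E2 = {(1, 3), (4, 6)}"
  define E3 :: "(nat \<times> nat) set" where "E3 = {(1, 4)}"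
  define S :: "nat \<Rightarrow> nat \<Rightarrow> 'a set" where
    "S i j = (if (i, j) \<in> E1 \<or> (j, i) \<in> E1 then {\<one>} else if (i, j) \<in> E2 then {\<one>, a}
              else if (j, i) \<in> E2 then {\<one>, inv a}
              else if (i, j) \<in> E3 \<or> (j, i) \<in> E3 then H else {})" for i j
  define T where "T = twisted (m_inv G) {4, 5, 6} S"
  have SH: "S i j \<subseteq> H" for i j unfolding S_def H_def by (simp split: if_split)
  have S: "PCayley_family G m S"
    unfolding PCayley_family_def
  proof (intro conjI ballI)
    show "S i j \<subseteq> carrier G" for i j using SH HG' by (rule subset_trans)
    fix i
    have "(i, i) \<notin> E1" "(i, i) \<notin> E2" "(i, i) \<notin> E3" by (auto simp: E1_def E2_def E3_def)
    then show "S i i = {}" by (simp add: S_def)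
  qed
  have invH: "m_inv G ` H = H" unfolding H_def using a by auto
  have sym: "inverse_symmetric m S"
    unfolding inverse_symmetric_def
  proof (intro ballI)
    fix i j :: nat
    have pair: "m_inv G ` {\<one>, a} = {\<one>, inv a}" "m_inv G ` {\<one>, inv a} = {\<one>, a}"
        "m_inv G ` {\<one>} = {\<one>}"
      using a by auto
    have "\<not> ((i, j) \<in> E2 \<and> (j, i) \<in> E2)"
      unfolding E2_def by (rule notI, elim conjE insertE emptyE; simp)
    then consider "(i, j) \<in> E1 \<or> (j, i) \<in> E1"
      | "\<not> ((i, j) \<in> E1 \<or> (j, i) \<in> E1)" "(i, j) \<in> E2" "(j, i) \<notin> E2"
      | "\<not> ((i, j) \<in> E1 \<or> (j, i) \<in> E1)" "(i, j) \<notin> E2" "(j, i) \<in> E2"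
      | "\<not> ((i, j) \<in> E1 \<or> (j, i) \<in> E1)" "(i, j) \<notin> E2" "(j, i) \<notin> E2"
      by blast
    then show "S i j = m_inv G ` S j i"
    proof cases
      case 1
      then have "S i j = {\<one>}" "S j i = {\<one>}" by (auto simp: S_def)
      then show ?thesis by (simp only: pair)
    next
      case 2
      then have "S i j = {\<one>, a}" "S j i = {\<one>, inv a}" by (auto simp: S_def)
      then show ?thesis by (simp only: pair)
    next
      case 3
      then have "S i j = {\<one>, inv a}" "S j i = {\<one>, a}" by (auto simp: S_def)
      then show ?thesis by (simp only: pair)
    next
      case 4
      then have "S i j = S j i" "S j i = H \<or> S j i = {}" by (auto simp: S_def)
      then show ?thesis using invH by auto
    qed
  qed
  have SK: "S i j = {} \<or> S i j = H" if "i \<in> {4, 5, 6} \<longleftrightarrow> j \<notin> {4, 5, 6}" for i j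
  proof -
    have "(i, j) \<notin> E1" "(j, i) \<notin> E1" "(i, j) \<notin> E2" "(j, i) \<notin> E2"
      using that by (auto simp: E1_def E2_def)
    then show ?thesis by (simp add: S_def)
  qed
  have m0: "m > 0" using m by simp
  have equiv: "affinely_equivalent m S T"
    unfolding T_def by (rule affinely_equivalent_twisted_if_mPCI[OF fin m0 S SH SK sym mPCI])
  have T: "PCayley_family G m T"
    unfolding T_def by (rule twisted_family[OF S SH])
  from affinely_equivalentE[OF S T equiv] obtain \<sigma> p \<gamma> where \<sigma>: "bij_betw \<sigma> {1..m} {1..m}"
    and \<gamma>: "\<forall>i\<in>{1..m}. \<gamma> i \<in> iso G G"
    and p: "\<forall>i\<in>{1..m}. \<forall>j\<in>{1..m}. p i j \<in> carrier G"
    and pp: "\<forall>i\<in>{1..m}. \<forall>j\<in>{1..m}. \<forall>k\<in>{1..m}. p j k \<otimes> p i j = p i k"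
    and p\<gamma>: "\<forall>i\<in>{1..m}. \<forall>j\<in>{1..m}. \<forall>z\<in>carrier G. p i j \<otimes> \<gamma> i z = \<gamma> j z \<otimes> p i j"
    and img: "\<forall>i\<in>{1..m}. \<forall>j\<in>{1..m}. T (\<sigma> i) (\<sigma> j) = (\<lambda>z. p i j \<otimes> \<gamma> i z) ` S i j"
    by (elim exE conjE)
  note \<gamma> = bspec[OF \<gamma>] and p = bspec[OF bspec[OF p]] and pp = bspec[OF bspec[OF bspec[OF pp]]]
    and p\<gamma> = bspec[OF bspec[OF bspec[OF p\<gamma>]]] and img = bspec[OF bspec[OF img]]
  have idx: "(1::nat) \<in> {1..m}" "(2::nat) \<in> {1..m}" "(3::nat) \<in> {1..m}" "(4::nat) \<in> {1..m}"
    "(5::nat) \<in> {1..m}" "(6::nat) \<in> {1..m}" using m by auto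
  have \<gamma>1: "\<gamma> i \<one> = \<one>" if "i \<in> {1..m}" for i
    using \<gamma>[OF that] hom_one[OF _ is_group is_group] by (simp add: iso_def)
  have \<gamma>G: "\<gamma> i a \<in> carrier G" if "i \<in> {1..m}" for i
    using \<gamma>[OF that] a(1) by (auto simp: iso_def hom_def)
  have card_T: "card (T k l) = card (S k l)" for k l
    unfolding T_def using SH by (rule card_twisted)
  have card_S: "card (S (\<sigma> i) (\<sigma> j)) = card (S i j)" if ij: "i \<in> {1..m}" "j \<in> {1..m}" for i j
    using card_affine_image[OF p[OF ij] \<gamma>[OF ij(1)], of "S i j"] SH[of i j] HG' img[OF ij] card_T
    by (metis subset_trans)
  have cards: "card {\<one>, a} = 2" "card {\<one>, inv a} = 2" "card H = 3"
  proof -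
    have "\<one> \<noteq> inv a" using a by (metis inv_eq_1_iff)
    then show "card {\<one>, inv a} = 2" by simp
    show "card {\<one>, a} = 2" using a(2) by simp
    show "card H = 3" unfolding H_def by (rule order3_card[OF a])
  qed
  \<comment> \<open>The cardinalities \<open>1, 2, 3\<close> of the connection sets tell the three kinds of edges apart.\<close>
  have S_card3: "(k, l) \<in> E3 \<or> (l, k) \<in> E3" if "card (S k l) = 3" for k l
    using that cards by (simp add: S_def split: if_splits)
  have S_card2: "(k, l) \<in> E2 \<or> (l, k) \<in> E2" if "card (S k l) = 2" for k l
    using that cards by (simp add: S_def split: if_splits)
  have S_card1: "S k l = {\<one>}" if "card (S k l) = 1" for k l
  proof -
    have "S k l \<in> {{\<one>}, {\<one>, a}, {\<one>, inv a}, H, {}}" by (simp add: S_def)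
    then show ?thesis using that cards by (elim insertE emptyE) simp_all
  qed
  have p_one: "p i j = \<one>" if ij: "i \<in> {1..m}" "j \<in> {1..m}" and "(i, j) \<in> E1" for i j
  proof -
    have Sij: "S i j = {\<one>}" using that by (simp add: S_def)
    then have "S (\<sigma> i) (\<sigma> j) = {\<one>}" using S_card1 card_S[OF ij] by simp
    then have "T (\<sigma> i) (\<sigma> j) = {\<one>}" by (simp add: T_def twisted_def)
    then show ?thesis using img[OF ij] Sij \<gamma>1[OF ij(1)] p[OF ij] by simp
  qed
  have p13: "p 1 3 = \<one>"
    using pp[OF idx(1,2,3)] p_one[OF idx(1,2)] p_one[OF idx(2,3)] by (simp add: E1_def)
  have p46: "p 4 6 = \<one>"
    using pp[OF idx(4,5,6)] p_one[OF idx(4,5)] p_one[OF idx(5,6)] by (simp add: E1_def)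
  have S_val: "S 1 3 = {\<one>, a}" "S 4 6 = {\<one>, a}" "S 1 4 = H" "S 4 1 = H"
    unfolding S_def E1_def E2_def E3_def by simp_all
  have T_val: "T 1 3 = {\<one>, a}" "T 4 6 = {\<one>, inv a}" "T 1 4 = H" "T 4 1 = H"
    unfolding T_def twisted_def S_val by simp_all
  have "card (S (\<sigma> 1) (\<sigma> 4)) = 3" unfolding card_S[OF idx(1,4)] S_val by (rule cards)
  then have "(\<sigma> 1, \<sigma> 4) \<in> E3 \<or> (\<sigma> 4, \<sigma> 1) \<in> E3" by (rule S_card3)
  then have \<sigma>14: "\<sigma> 1 = 1 \<and> \<sigma> 4 = 4 \<or> \<sigma> 1 = 4 \<and> \<sigma> 4 = 1" unfolding E3_def by blast
  have "card (S (\<sigma> 1) (\<sigma> 3)) = 2" unfolding card_S[OF idx(1,3)] S_val by (rule cards)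
  then have \<sigma>13: "(\<sigma> 1, \<sigma> 3) \<in> E2 \<or> (\<sigma> 3, \<sigma> 1) \<in> E2" by (rule S_card2)
  have "card (S (\<sigma> 4) (\<sigma> 6)) = 2" unfolding card_S[OF idx(4,6)] S_val by (rule cards)
  then have \<sigma>46: "(\<sigma> 4, \<sigma> 6) \<in> E2 \<or> (\<sigma> 6, \<sigma> 4) \<in> E2" by (rule S_card2)
  have T13: "T (\<sigma> 1) (\<sigma> 3) = {\<one>, \<gamma> 1 a}"
    unfolding img[OF idx(1,3)] S_val p13 using \<gamma>1[OF idx(1)] \<gamma>G[OF idx(1)] by simp
  have T46: "T (\<sigma> 4) (\<sigma> 6) = {\<one>, \<gamma> 4 a}"
    unfolding img[OF idx(4,6)] S_val p46 using \<gamma>1[OF idx(4)] \<gamma>G[OF idx(4)] by simp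
  have "p 1 4 \<in> (\<lambda>z. p 1 4 \<otimes> \<gamma> 1 z) ` H"
    using \<gamma>1[OF idx(1)] p[OF idx(1,4)] subgroup.one_closed[OF H] by (metis imageI r_one)
  then have "p 1 4 \<in> T (\<sigma> 1) (\<sigma> 4)" using img[OF idx(1,4)] S_val by simp
  moreover have "T (\<sigma> 1) (\<sigma> 4) = H" using \<sigma>14 T_val by metis
  ultimately have p14: "p 1 4 \<in> {\<one>, a, inv a}" unfolding H_def by blast
  have "(\<gamma> 1 a, \<gamma> 4 a) = (a, inv a) \<or> (\<gamma> 1 a, \<gamma> 4 a) = (inv a, a)"
  proof (cases "\<sigma> 1 = 1")
    case True
    then have "\<sigma> 4 = 4" "\<sigma> 3 = 3" using \<sigma>14 \<sigma>13 by (auto simp: E2_def)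
    moreover from this have "\<sigma> 6 = 6" using \<sigma>46 by (simp add: E2_def)
    ultimately have "{\<one>, \<gamma> 1 a} = {\<one>, a}" "{\<one>, \<gamma> 4 a} = {\<one>, inv a}"
      using T13 T46 T_val True by simp_all
    then show ?thesis by (metis doubleton_eq_iff)
  next
    case False
    then have "\<sigma> 1 = 4" "\<sigma> 4 = 1" "\<sigma> 3 = 6" using \<sigma>14 \<sigma>13 by (auto simp: E2_def)
    moreover from this have "\<sigma> 6 = 3" using \<sigma>46 by (simp add: E2_def)
    ultimately have "{\<one>, \<gamma> 1 a} = {\<one>, inv a}" "{\<one>, \<gamma> 4 a} = {\<one>, a}"
      using T13 T46 T_val by simp_all
    then show ?thesis by (metis doubleton_eq_iff)
  qed
  from order3_no_inversion[OF a p14 this] show False using p\<gamma>[OF idx(1,4) a(1)] by simp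
qed

text \<open>
  The two opposite arcs \<open>1 \<rightarrow> 2\<close> and \<open>2 \<rightarrow> 1\<close>, with connection sets \<open>{\<one>}\<close> and \<open>{a}\<close>, compose to
  translation by \<open>a\<close>, so two copies already do what a triangle does in a graph. A second pair on
  copies \<open>3, 4\<close> is linked to the first by \<open>\<langle>a\<rangle>\<close> from copy \<open>2\<close> to copy \<open>3\<close>, and inversion acts on
  copies \<open>3\<close> and \<open>4\<close>.
\<close>

lemma not_mPDCI_group_if_order3:
  assumes fin: "finite (carrier G)" and m: "m \<ge> 4"
    and a: "a \<in> carrier G" "a \<noteq> \<one>" "a \<otimes> a \<otimes> a = \<one>"
  shows "\<not> mPDCI_group G m"
proof
  assume mPDCI: "mPDCI_group G m"
  define H where "H = {\<one>, a, inv a}"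
  interpret coset_twist G H H "m_inv G" unfolding H_def by (rule order3_coset_twist[OF a(1,3)])
  have HG': "H \<subseteq> carrier G" using H by (rule subgroup.subset)
  define E :: "(nat \<times> nat) set" where "E = {(1, 2), (3, 4)}"
  define S :: "nat \<Rightarrow> nat \<Rightarrow> 'a set" where
    "S i j = (if (i, j) \<in> E then {\<one>} else if (j, i) \<in> E then {a}
              else if (i, j) = (2, 3) then H else {})" for i j
  define T where "T = twisted (m_inv G) {3, 4} S"
  have SH: "S i j \<subseteq> H" for i j unfolding S_def H_def by (simp split: if_split)
  have S: "PCayley_family G m S"
    unfolding PCayley_family_def
  proof (intro conjI ballI)
    show "S i j \<subseteq> carrier G" for i j using SH HG' by (rule subset_trans)
    fix i
    have "(i, i) \<notin> E" by (auto simp: E_def)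
    then show "S i i = {}" by (auto simp: S_def)
  qed
  have SK: "S i j = {} \<or> S i j = H" if "i \<in> {3, 4} \<longleftrightarrow> j \<notin> {3, 4}" for i j
  proof -
    have "(i, j) \<notin> E" "(j, i) \<notin> E" using that by (auto simp: E_def)
    then show ?thesis by (simp add: S_def)
  qed
  have m0: "m > 0" using m by simp
  have T: "PCayley_family G m T"
    unfolding T_def by (rule twisted_family[OF S SH])
  have "copy_isomorphic m S T" unfolding T_def by (rule copy_isomorphic_twisted[OF fin SH SK])
  then have equiv: "affinely_equivalent m S T"
    using iffD1[OF mPDCI_group_iff[OF fin m0] mPDCI, rule_format, of S T] S T by blast
  from affinely_equivalentE[OF S T equiv] obtain \<sigma> p \<gamma> where \<sigma>: "bij_betw \<sigma> {1..m} {1..m}"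
    and \<gamma>: "\<forall>i\<in>{1..m}. \<gamma> i \<in> iso G G"
    and p: "\<forall>i\<in>{1..m}. \<forall>j\<in>{1..m}. p i j \<in> carrier G"
    and pp: "\<forall>i\<in>{1..m}. \<forall>j\<in>{1..m}. \<forall>k\<in>{1..m}. p j k \<otimes> p i j = p i k"
    and p\<gamma>: "\<forall>i\<in>{1..m}. \<forall>j\<in>{1..m}. \<forall>z\<in>carrier G. p i j \<otimes> \<gamma> i z = \<gamma> j z \<otimes> p i j"
    and img: "\<forall>i\<in>{1..m}. \<forall>j\<in>{1..m}. T (\<sigma> i) (\<sigma> j) = (\<lambda>z. p i j \<otimes> \<gamma> i z) ` S i j"
    by (elim exE conjE)
  note \<gamma> = bspec[OF \<gamma>] and p = bspec[OF bspec[OF p]] and pp = bspec[OF bspec[OF bspec[OF pp]]]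
    and p\<gamma> = bspec[OF bspec[OF bspec[OF p\<gamma>]]] and img = bspec[OF bspec[OF img]]
  have idx: "(1::nat) \<in> {1..m}" "(2::nat) \<in> {1..m}" "(3::nat) \<in> {1..m}" "(4::nat) \<in> {1..m}"
    using m by auto
  have \<gamma>1: "\<gamma> i \<one> = \<one>" if "i \<in> {1..m}" for i
    using \<gamma>[OF that] hom_one[OF _ is_group is_group] by (simp add: iso_def)
  have \<gamma>G: "\<gamma> i a \<in> carrier G" if "i \<in> {1..m}" for i
    using \<gamma>[OF that] a(1) by (auto simp: iso_def hom_def)
  have card_T: "card (T k l) = card (S k l)" for k l
    unfolding T_def using SH by (rule card_twisted)
  have card_S: "card (S (\<sigma> i) (\<sigma> j)) = card (S i j)" if ij: "i \<in> {1..m}" "j \<in> {1..m}" for i j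
    using card_affine_image[OF p[OF ij] \<gamma>[OF ij(1)], of "S i j"] SH[of i j] HG' img[OF ij] card_T
    by (metis subset_trans)
  have cardH: "card H = 3" using order3_card[OF a] unfolding H_def .
  have S_card3: "(k, l) = (2, 3)" if "card (S k l) = 3" for k l
    using that cardH by (simp add: S_def split: if_splits)
  have S_card1: "(k, l) \<in> E \<or> (l, k) \<in> E" if "card (S k l) = 1" for k l
    using that cardH by (simp add: S_def split: if_splits)
  have S_val: "S 1 2 = {\<one>}" "S 2 1 = {a}" "S 3 4 = {\<one>}" "S 4 3 = {a}" "S 2 3 = H"
    unfolding S_def E_def by simp_all
  have T_val: "T 1 2 = {\<one>}" "T 2 1 = {a}" "T 3 4 = {\<one>}" "T 4 3 = {inv a}" "T 2 3 = H"
    unfolding T_def twisted_def S_val by simp_all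
  have \<sigma>23: "\<sigma> 2 = 2" "\<sigma> 3 = 3"
    using S_card3[of "\<sigma> 2" "\<sigma> 3"] card_S[OF idx(2,3)] S_val cardH by simp_all
  have \<sigma>1: "\<sigma> 1 = 1"
    using S_card1[of "\<sigma> 1" "\<sigma> 2"] card_S[OF idx(1,2)] S_val \<sigma>23 by (simp add: E_def)
  have \<sigma>4: "\<sigma> 4 = 4"
    using S_card1[of "\<sigma> 3" "\<sigma> 4"] card_S[OF idx(3,4)] S_val \<sigma>23 by (simp add: E_def)
  have p_one: "p j i = \<one>" if ij: "i \<in> {1..m}" "j \<in> {1..m}" and "p i j = \<one>" for i j
  proof -
    have "p i i \<otimes> p i i = p i i" using pp[OF ij(1) ij(1) ij(1)] .
    then have "p i i = \<one>" using p[OF ij(1) ij(1)] by simp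
    then show ?thesis using pp[OF ij(1,2,1)] that(3) p[OF ij(2,1)] by simp
  qed
  have "p 1 2 = \<one>" using img[OF idx(1,2)] S_val T_val \<sigma>1 \<sigma>23 \<gamma>1[OF idx(1)] p[OF idx(1,2)] by simp
  then have "p 2 1 = \<one>" by (rule p_one[OF idx(1,2)])
  then have \<gamma>2: "\<gamma> 2 a = a" using img[OF idx(2,1)] S_val T_val \<sigma>1 \<sigma>23 \<gamma>G[OF idx(2)] by simp
  have "p 3 4 = \<one>" using img[OF idx(3,4)] S_val T_val \<sigma>4 \<sigma>23 \<gamma>1[OF idx(3)] p[OF idx(3,4)] by simp
  then have p43: "p 4 3 = \<one>" by (rule p_one[OF idx(3,4)])
  then have "\<gamma> 4 a = inv a" using img[OF idx(4,3)] S_val T_val \<sigma>4 \<sigma>23 \<gamma>G[OF idx(4)] by simp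
  then have \<gamma>3: "\<gamma> 3 a = inv a"
    using p\<gamma>[OF idx(4,3) a(1)] p43 \<gamma>G[OF idx(3)] \<gamma>G[OF idx(4)] by simp
  have "p 2 3 \<in> (\<lambda>z. p 2 3 \<otimes> \<gamma> 2 z) ` H"
    using \<gamma>1[OF idx(2)] p[OF idx(2,3)] subgroup.one_closed[OF H] by (metis imageI r_one)
  then have p23: "p 2 3 \<in> {\<one>, a, inv a}"
    using img[OF idx(2,3)] S_val T_val \<sigma>23 unfolding H_def by simp
  show False
    using order3_no_inversion[OF a p23, of a "inv a"] p\<gamma>[OF idx(2,3) a(1)] \<gamma>2 \<gamma>3 by simp
qed

end

section \<open>Larger cyclic groups and elementary abelian groups\<close>

lemma cases_3: "k = 0 \<or> k = 1 \<or> k = 2" for k :: 3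
proof -
  have "k \<in> {0, 1, 2}"
  proof -
    have "card {0, 1, 2 :: 3} = CARD(3)" by simp
    then have "{0, 1, 2 :: 3} = UNIV" by (intro card_subset_eq) auto
    then show ?thesis by blast
  qed
  then show ?thesis by blast
qed

lemma sums_3: "1 + 1 = (2::3)" "1 + 2 = (0::3)" "2 + 1 = (0::3)" "2 + 2 = (1::3)"
  by simp_all

context group begin

lemma int_pow_subgroup: "a \<in> carrier G \<Longrightarrow> subgroup (range (\<lambda>k::int. a [^] (n * k))) G"
proof (rule subgroupI)
  assume a: "a \<in> carrier G"
  show "range (\<lambda>k::int. a [^] (n * k)) \<subseteq> carrier G" using a by auto
  show "inv x \<in> range (\<lambda>k::int. a [^] (n * k))" if x: "x \<in> range (\<lambda>k::int. a [^] (n * k))" for x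
  proof -
    obtain k :: int where "x = a [^] (n * k)" using x by blast
    then have "inv x = a [^] (n * (- k))" using a by (simp add: int_pow_neg)
    then show ?thesis by (rule range_eqI)
  qed
  show "x \<otimes> y \<in> range (\<lambda>k::int. a [^] (n * k))"
    if xy: "x \<in> range (\<lambda>k::int. a [^] (n * k))" "y \<in> range (\<lambda>k::int. a [^] (n * k))" for x y
  proof -
    obtain k l :: int where "x = a [^] (n * k)" "y = a [^] (n * l)" using xy by blast
    then have "x \<otimes> y = a [^] (n * (k + l))" using a by (simp add: int_pow_mult distrib_left)
    then show ?thesis by (rule range_eqI)
  qed
qed auto

lemma int_pow_comm:
  "a \<in> carrier G \<Longrightarrow> a [^] (k::int) \<otimes> a [^] (l::int) = a [^] l \<otimes> a [^] k"
  using int_pow_mult[of a k l] int_pow_mult[of a l k] by (simp add: add.commute)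

lemma square_eq_int_pow: "a \<in> carrier G \<Longrightarrow> a \<otimes> a = a [^] (2::int)"
  using int_pow_mult[of a 1 1] by simp

text \<open>
  Squaring is an automorphism of a cyclic group of odd order; it neither fixes nor inverts a
  generator when the order is at least five.
\<close>

lemma not_mPCI_group_if_odd_ord:
  assumes fin: "finite (carrier G)" and m: "m \<ge> 4" and a: "a \<in> carrier G"
    and odd: "odd (ord a)" and ord: "ord a \<ge> 5"
  shows "\<not> mPCI_group G m"
proof -
  define H where "H = range (\<lambda>k::int. a [^] k)"
  have H: "subgroup H G" using int_pow_subgroup[OF a, of 1] by (simp add: H_def)
  have pow: "a [^] k \<in> H" for k :: int unfolding H_def by blast
  have HG: "H \<subseteq> carrier G" using H by (rule subgroup.subset)
  have sq: "a [^] k \<otimes> a [^] k = a [^] (2 * k)" for k :: int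
    using a by (simp add: int_pow_mult[symmetric])
  have ndvd: "a [^] (n::int) \<noteq> \<one>" if "0 < n" "n < 5" for n
  proof
    assume "a [^] n = \<one>"
    then have "int (ord a) dvd n" using int_pow_eq_id[OF a] by simp
    then have "int (ord a) \<le> n" using that(1) by (rule zdvd_imp_le)
    then show False using ord that(2) by simp
  qed
  interpret coset_twist G H H "\<lambda>x. x \<otimes> x"
  proof (intro coset_twist.intro[OF is_group] coset_twist_axioms.intro H order_refl)
    show comm: "x \<otimes> y = y \<otimes> x" if "x \<in> H" "y \<in> H" for x y
      using that int_pow_comm[OF a] unfolding H_def by blast
    have inj: "inj_on (\<lambda>x. x \<otimes> x) H"
    proof (rule inj_onI)
      fix x y assume "x \<in> H" "y \<in> H" and eq: "x \<otimes> x = y \<otimes> y"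
      then obtain k l :: int where kl: "x = a [^] k" "y = a [^] l" unfolding H_def by blast
      then have "a [^] (2 * k) = a [^] (2 * l)" using eq sq by simp
      then have "int (ord a) dvd 2 * l - 2 * k" using int_pow_eq[OF a] by simp
      then have *: "int (ord a) dvd 2 * (l - k)" by (simp only: right_diff_distrib)
      have "coprime (int (ord a)) 2" using odd by simp
      then have "int (ord a) dvd l - k" using * by (rule iffD1[OF coprime_dvd_mult_right_iff])
      then show "x = y" using int_pow_eq[OF a] kl by simp
    qed
    have into: "x \<otimes> x \<in> H" if "x \<in> H" for x
      using H that that by (rule subgroup.m_closed)
    have "(\<lambda>x. x \<otimes> x) ` H = H"
      using fin HG inj into by (intro endo_inj_surj image_subsetI finite_subset[OF HG fin])
    then show "bij_betw (\<lambda>x. x \<otimes> x) H H" using inj by (simp add: bij_betw_def)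
    show "x \<otimes> y \<otimes> (x \<otimes> y) = x \<otimes> x \<otimes> (y \<otimes> y)" if "x \<in> H" "y \<in> H" for x y
    proof -
      have "x \<in> carrier G" "y \<in> carrier G" using that HG by auto
      then show ?thesis using comm[OF that] by (metis m_assoc m_closed)
    qed
    show "x \<otimes> x \<otimes> inv x \<in> H" if "x \<in> H" for x
      by (rule subgroup.m_closed[OF H into[OF that] subgroup.m_inv_closed[OF H that]])
  qed
  have "a \<otimes> a \<noteq> a" using ndvd[of 1] a by simp
  moreover have "a \<otimes> a \<noteq> inv a"
  proof
    assume "a \<otimes> a = inv a"
    then have "a \<otimes> a \<otimes> a = \<one>" using a by simp
    moreover have "a [^] (3::int) = a [^] (2::int) \<otimes> a"
      using int_pow_mult[OF a, of 2 1] a by simp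
    ultimately show False using ndvd[of 3] square_eq_int_pow[OF a] by simp
  qed
  moreover have "a \<otimes> a \<noteq> \<one>" using ndvd[of 2] square_eq_int_pow[OF a] by simp
  moreover have "a \<in> H" using pow[of 1] a by simp
  ultimately show ?thesis using not_mPCI_group_if_twist[OF fin m] by blast
qed

text \<open>
  Inversion is trivial modulo the subgroup \<open>K\<close> of squares, and the generator \<open>a\<close> is no square as
  the order is even. That \<open>\<theta>(a) = a\<^sup>-\<^sup>1\<close> does no harm then, because \<open>a \<notin> K\<close>.
\<close>

lemma not_mPCI_group_if_even_ord:
  assumes fin: "finite (carrier G)" and m: "m \<ge> 4" and a: "a \<in> carrier G"
    and even: "even (ord a)" and ord: "ord a \<ge> 4"
  shows "\<not> mPCI_group G m"
proof -
  define H where "H = range (\<lambda>k::int. a [^] k)"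
  define K where "K = range (\<lambda>k::int. a [^] (2 * k))"
  have H: "subgroup H G" using int_pow_subgroup[OF a, of 1] by (simp add: H_def)
  have K: "subgroup K G" unfolding K_def using a by (rule int_pow_subgroup)
  have HG: "x \<in> carrier G" if "x \<in> H" for x using that subgroup.subset[OF H] by blast
  have a2: "a \<otimes> a \<noteq> \<one>"
  proof
    assume "a \<otimes> a = \<one>"
    then have "int (ord a) dvd 2" using int_pow_eq_id[OF a] square_eq_int_pow[OF a] by simp
    then have "int (ord a) \<le> 2" by (rule zdvd_imp_le) simp
    then show False using ord by simp
  qed
  interpret coset_twist G H K "m_inv G"
  proof (intro coset_twist.intro[OF is_group] coset_twist_axioms.intro H K)
    show "K \<subseteq> H" unfolding K_def H_def by blast
    show comm: "x \<otimes> y = y \<otimes> x" if "x \<in> H" "y \<in> H" for x y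
      using that int_pow_comm[OF a] unfolding H_def by blast
    show "bij_betw (m_inv G) H H"
      by (rule bij_betw_byWitness[where f' = "m_inv G"])
         (use HG subgroup.m_inv_closed[OF H] in auto)
    show "inv (x \<otimes> y) = inv x \<otimes> inv y" if "x \<in> H" "y \<in> H" for x y
      using comm[OF that] HG[OF that(1)] HG[OF that(2)] by (metis inv_mult_group)
    show "inv x \<otimes> inv x \<in> K" if "x \<in> H" for x
    proof -
      obtain k :: int where "x = a [^] k" using \<open>x \<in> H\<close> unfolding H_def by blast
      then have "inv x \<otimes> inv x = a [^] (2 * (- k))"
        using a by (simp add: int_pow_neg[symmetric] int_pow_mult[symmetric])
      then show ?thesis unfolding K_def by (rule range_eqI)
    qed
  qed
  have aK: "a \<notin> K"
  proof
    assume "a \<in> K"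
    then obtain k :: int where "a = a [^] (2 * k)" unfolding K_def by blast
    then have "a [^] (1::int) = a [^] (2 * k)" using a by simp
    then have "int (ord a) dvd 2 * k - 1" using int_pow_eq[OF a] by simp
    moreover have "2 dvd int (ord a)" using even by simp
    ultimately have "2 dvd 2 * k - 1" by (rule dvd_trans[rotated])
    then show False by simp
  qed
  have "inv a \<noteq> a"
  proof
    assume "inv a = a"
    then have "a \<otimes> a = \<one>" using a by (metis r_inv)
    then show False using a2 by simp
  qed
  moreover have "a \<in> H" unfolding H_def using a by (intro range_eqI[of _ _ 1]) simp
  ultimately show ?thesis using not_mPCI_group_if_twist[OF fin m] aK a2 by blast
qed

text \<open>
  The twist interchanges the involutions \<open>a\<close> and \<open>b\<close>.
\<close>

lemma not_mPCI_group_if_four_group: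
  assumes fin: "finite (carrier G)" and m: "m \<ge> 4"
    and a: "a \<in> carrier G" "a \<noteq> \<one>" "a \<otimes> a = \<one>" and b: "b \<in> carrier G" "b \<noteq> \<one>" "b \<otimes> b = \<one>"
    and ab: "a \<noteq> b" "a \<otimes> b = b \<otimes> a"
  shows "\<not> mPCI_group G m"
proof -
  define c where "c = a \<otimes> b"
  define H where "H = {\<one>, a, b, c}"
  define \<theta> where "\<theta> x = (if x = a then b else if x = b then a else x)" for x
  have inv: "inv a = a" "inv b = b" using a b by (simp_all add: inv_equality)
  have c: "c \<in> carrier G" "c \<noteq> \<one>" "c \<noteq> a" "c \<noteq> b"
    using a b ab inv unfolding c_def by (auto simp: inv_equality) (metis inv_equality)
  have mult: "a \<otimes> b = c" "b \<otimes> a = c" "a \<otimes> c = b" "c \<otimes> a = b" "b \<otimes> c = a" "c \<otimes> b = a" "c \<otimes> c = \<one>"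
  proof -
    show "a \<otimes> b = c" "b \<otimes> a = c" using ab by (simp_all add: c_def)
    show *: "a \<otimes> c = b" "c \<otimes> b = a" unfolding c_def using a b by (simp_all add: m_assoc flip: m_assoc[of a a b])
    show "c \<otimes> a = b" "b \<otimes> c = a" unfolding c_def using a b
      by (simp add: ab(2) m_assoc, simp add: ab(2) flip: m_assoc)
    show "c \<otimes> c = \<one>"
      using m_assoc[OF c(1) a(1) b(1)] \<open>c \<otimes> a = b\<close> b(3) by (simp add: c_def[symmetric])
  qed
  have H: "subgroup H G"
  proof (rule subgroupI)
    show "inv x \<in> H" if "x \<in> H" for x
      using that inv inv_equality[OF mult(7) c(1) c(1)] by (auto simp: H_def)
    show "x \<otimes> y \<in> H" if "x \<in> H" "y \<in> H" for x y
      using that mult a b c by (auto simp: H_def)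
  qed (use a b c in \<open>auto simp: H_def\<close>)
  have \<theta>_simps: "\<theta> a = b" "\<theta> b = a" "\<theta> c = c" "\<theta> \<one> = \<one>"
    using a b c ab by (auto simp: \<theta>_def)
  have comm: "x \<otimes> y = y \<otimes> x" if "x \<in> H" "y \<in> H" for x y
    using that mult a b c by (auto simp: H_def)
  have \<theta>H: "\<theta> x \<in> H" if "x \<in> H" for x using that \<theta>_simps by (auto simp: H_def)
  interpret coset_twist G H H \<theta>
  proof (intro coset_twist.intro[OF is_group] coset_twist_axioms.intro H order_refl comm)
    show "bij_betw \<theta> H H"
      by (rule bij_betw_byWitness[where f' = \<theta>]) (use \<theta>_simps in \<open>auto simp: H_def\<close>)
    show "\<theta> (x \<otimes> y) = \<theta> x \<otimes> \<theta> y" if "x \<in> H" "y \<in> H" for x y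
      using that unfolding H_def
      by (elim insertE emptyE) (simp_all add: \<theta>_simps mult a b c)
    show "\<theta> x \<otimes> inv x \<in> H" if "x \<in> H" for x
      by (rule subgroup.m_closed[OF H \<theta>H[OF that] subgroup.m_inv_closed[OF H that]])
  qed
  have "card H = 4" unfolding H_def using a b c ab by (auto simp: card_insert_if)
  moreover have "\<theta> a \<noteq> a" "\<theta> a \<noteq> inv a" using \<theta>_simps ab inv by auto
  moreover have "a \<in> H" by (simp add: H_def)
  ultimately show ?thesis using not_mPCI_group_if_twist[OF fin m] by simp
qed

text \<open>
  Exponents live in the ring \<open>\<int>\<^sub>3\<close>, so that for \<open>a\<^sup>3 = \<one>\<close> the map \<open>pow3 a\<close> is a homomorphism and
  coordinates with respect to elements of order three can be compared directly.
\<close>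

definition pow3 :: "'a \<Rightarrow> 3 \<Rightarrow> 'a" where
  "pow3 a k = (if k = 0 then \<one> else if k = 1 then a else inv a)"

lemma pow3_simps: "pow3 a 0 = \<one>" "pow3 a 1 = a" "pow3 a 2 = inv a"
  by (simp_all add: pow3_def)

lemma pow3_closed: "a \<in> carrier G \<Longrightarrow> pow3 a k \<in> carrier G"
  by (simp add: pow3_def)

lemma pow3_add:
  assumes "a \<in> carrier G" "a \<otimes> a \<otimes> a = \<one>"
  shows "pow3 a (k + l) = pow3 a k \<otimes> pow3 a l"
  using cases_3[of k] cases_3[of l] order3_square[OF assms] assms(1)
  by (elim disjE) (simp_all only: pow3_simps sums_3 add_0 add_0_right l_one r_one one_closed inv_closed l_inv r_inv)

lemma pow3_cases: "pow3 a k \<in> {\<one>, a, inv a}" by (simp add: pow3_def)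

lemma pow3_eq_one:
  assumes "a \<in> carrier G" "a \<noteq> \<one>" "pow3 a k = \<one>"
  shows "k = 0"
  using cases_3[of k] assms by (elim disjE) (simp_all add: pow3_simps)

lemma pow3_minus:
  assumes "a \<in> carrier G" "a \<otimes> a \<otimes> a = \<one>"
  shows "pow3 a (k - l) = pow3 a k \<otimes> inv (pow3 a l)"
proof -
  have "pow3 a (k - l) \<otimes> pow3 a l = pow3 a k" using pow3_add[OF assms, of "k - l" l] by simp
  then show ?thesis using assms(1) pow3_closed by (metis inv_solve_right)
qed

text \<open>
  The products \<open>a\<^sup>i b\<^sup>j\<close> are distinct even if \<open>a\<close> and \<open>b\<close> do not commute, because \<open>\<langle>a\<rangle>\<close> and \<open>\<langle>b\<rangle>\<close>
  meet only in the identity.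
\<close>

lemma inj_pow3_mult:
  assumes a: "a \<in> carrier G" "a \<noteq> \<one>" "a \<otimes> a \<otimes> a = \<one>"
    and b: "b \<in> carrier G" "b \<otimes> b \<otimes> b = \<one>" "b \<notin> {\<one>, a, inv a}"
  shows "inj (\<lambda>(i, j). pow3 a i \<otimes> pow3 b j)"
proof (rule injI, clarify)
  fix i j k l
  assume eq: "pow3 a i \<otimes> pow3 b j = pow3 a k \<otimes> pow3 b l"
  have c: "pow3 a i \<in> carrier G" "pow3 b j \<in> carrier G" "pow3 a k \<in> carrier G" "pow3 b l \<in> carrier G"
    using a b by (simp_all add: pow3_closed)
  have "inv (pow3 a k) \<otimes> pow3 a i = inv (pow3 a k) \<otimes> (pow3 a i \<otimes> pow3 b j) \<otimes> inv (pow3 b j)"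
    using c by (simp add: m_assoc)
  also have "\<dots> = pow3 b l \<otimes> inv (pow3 b j)"
    unfolding eq using c by (simp add: m_assoc inv_cancel)
  also have "\<dots> = pow3 b (l - j)" using b by (simp add: pow3_minus)
  finally have bl: "pow3 b (l - j) = inv (pow3 a k) \<otimes> pow3 a i" by simp
  have sub: "subgroup {\<one>, a, inv a} G" using a(1,3) by (rule order3_subgroup)
  have "pow3 b (l - j) \<in> {\<one>, a, inv a}"
    unfolding bl by (rule subgroup.m_closed[OF sub subgroup.m_inv_closed[OF sub pow3_cases] pow3_cases])
  moreover have "inv b \<notin> {\<one>, a, inv a}"
    using subgroup.m_inv_closed[OF sub, of "inv b"] b by (metis inv_inv)
  ultimately have "l - j = 0"
    using cases_3[of "l - j"] b(3) by (elim disjE) (simp_all only: pow3_simps simp_thms)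
  then have jl: "j = l" by simp
  then have "pow3 a i = pow3 a k" using eq c by simp
  then have "pow3 a (i - k) = \<one>" using a c by (simp add: pow3_minus)
  then have "i - k = 0" by (rule pow3_eq_one[OF a(1,2)])
  then show "i = k \<and> j = l" using jl by simp
qed

lemma comm_inv:
  assumes "x \<in> carrier G" "y \<in> carrier G" "x \<otimes> y = y \<otimes> x"
  shows "inv x \<otimes> y = y \<otimes> inv x"
proof -
  have "inv x \<otimes> y = inv x \<otimes> (y \<otimes> x) \<otimes> inv x" using assms(1,2) by (simp add: m_assoc)
  also have "\<dots> = y \<otimes> inv x" unfolding assms(3)[symmetric] using assms(1,2) by (simp add: m_assoc inv_cancel)
  finally show ?thesis .
qed

lemma pow3_comm:
  assumes "a \<in> carrier G" "b \<in> carrier G" "a \<otimes> b = b \<otimes> a"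
  shows "pow3 a i \<otimes> pow3 b j = pow3 b j \<otimes> pow3 a i"
proof -
  have 1: "x \<otimes> pow3 b j = pow3 b j \<otimes> x" if x: "x \<in> carrier G" "x \<otimes> b = b \<otimes> x" for x
    using comm_inv[OF assms(2) x(1) x(2)[symmetric]] x by (simp add: pow3_def)
  have 2: "a \<otimes> pow3 b j = pow3 b j \<otimes> a" using assms(1,3) by (rule 1)
  have 3: "inv a \<otimes> pow3 b j = pow3 b j \<otimes> inv a"
    using assms(1) pow3_closed[OF assms(2)] 2 by (rule comm_inv)
  from pow3_cases[of a i] show ?thesis
  proof (elim insertE emptyE)
    assume "pow3 a i = \<one>"
    then show ?thesis using pow3_closed[OF assms(2)] by simp
  next
    assume "pow3 a i = a"
    then show ?thesis using 2 by simp
  next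
    assume "pow3 a i = inv a"
    then show ?thesis using 3 by simp
  qed
qed

text \<open>
  The twist interchanges the coordinates of \<open>a\<^sup>i b\<^sup>j\<close>.
\<close>

lemma not_mPCI_group_if_order_9_subgroup:
  assumes fin: "finite (carrier G)" and m: "m \<ge> 4"
    and a: "a \<in> carrier G" "a \<noteq> \<one>" "a \<otimes> a \<otimes> a = \<one>"
    and b: "b \<in> carrier G" "b \<otimes> b \<otimes> b = \<one>" "b \<notin> {\<one>, a, inv a}"
    and ab: "a \<otimes> b = b \<otimes> a"
  shows "\<not> mPCI_group G m"
proof -
  define E where "E = (\<lambda>(i, j). pow3 a i \<otimes> pow3 b j)"
  define H where "H = range E"
  define \<theta> where "\<theta> x = E (prod.swap (inv_into UNIV E x))" for x
  have inj: "inj E" unfolding E_def using a b by (rule inj_pow3_mult)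
  have \<theta>E: "\<theta> (E u) = E (prod.swap u)" for u by (simp add: \<theta>_def inj)
  have EG: "E u \<in> carrier G" for u using a b by (simp add: E_def pow3_closed split: prod.split)
  have mult: "E (i, j) \<otimes> E (k, l) = E (i + k, j + l)" for i j k l
  proof -
    have c: "pow3 a i \<in> carrier G" "pow3 b j \<in> carrier G" "pow3 a k \<in> carrier G" "pow3 b l \<in> carrier G"
      using a b by (simp_all add: pow3_closed)
    have "E (i, j) \<otimes> E (k, l) = pow3 a i \<otimes> (pow3 b j \<otimes> pow3 a k) \<otimes> pow3 b l"
      using c by (simp add: E_def m_assoc)
    also have "\<dots> = pow3 a i \<otimes> (pow3 a k \<otimes> pow3 b j) \<otimes> pow3 b l"
      using pow3_comm[OF a(1) b(1) ab] by simp
    also have "\<dots> = E (i + k, j + l)"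
      using c pow3_add[OF a(1,3)] pow3_add[OF b(1,2)] by (simp add: E_def m_assoc)
    finally show ?thesis .
  qed
  have E0: "E (0, 0) = \<one>" by (simp add: E_def pow3_simps)
  have Einv: "inv (E (i, j)) = E (- i, - j)" for i j
    using mult[of "- i" "- j" i j] E0 EG by (intro inv_equality) simp_all
  have H: "subgroup H G"
  proof (rule subgroupI)
    show "inv x \<in> H" if "x \<in> H" for x
    proof -
      obtain i j where "x = E (i, j)" using \<open>x \<in> H\<close> unfolding H_def by (metis image_iff surj_pair)
      then show ?thesis by (simp add: Einv H_def)
    qed
    show "x \<otimes> y \<in> H" if "x \<in> H" "y \<in> H" for x y
    proof -
      obtain i j k l where "x = E (i, j)" "y = E (k, l)"
        using \<open>x \<in> H\<close> \<open>y \<in> H\<close> unfolding H_def by (metis image_iff surj_pair)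
      then show ?thesis by (simp add: mult H_def)
    qed
  qed (use EG in \<open>auto simp: H_def\<close>)
  have \<theta>H: "\<theta> x \<in> H" if "x \<in> H" for x unfolding \<theta>_def H_def by (rule rangeI)
  interpret coset_twist G H H \<theta>
  proof (intro coset_twist.intro[OF is_group] coset_twist_axioms.intro H order_refl)
    show "x \<otimes> y = y \<otimes> x" if "x \<in> H" "y \<in> H" for x y
    proof -
      obtain i j k l where "x = E (i, j)" "y = E (k, l)" using \<open>x \<in> H\<close> \<open>y \<in> H\<close> unfolding H_def by (metis image_iff surj_pair)
      then show ?thesis by (simp add: mult add.commute)
    qed
    show "bij_betw \<theta> H H"
      by (rule bij_betw_byWitness[where f' = \<theta>]) (auto simp: H_def \<theta>E)
    show "\<theta> (x \<otimes> y) = \<theta> x \<otimes> \<theta> y" if "x \<in> H" "y \<in> H" for x y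
    proof -
      obtain i j k l where "x = E (i, j)" "y = E (k, l)" using \<open>x \<in> H\<close> \<open>y \<in> H\<close> unfolding H_def by (metis image_iff surj_pair)
      then show ?thesis by (simp add: mult \<theta>E)
    qed
    show "\<theta> x \<otimes> inv x \<in> H" if "x \<in> H" for x
      by (rule subgroup.m_closed[OF H \<theta>H[OF that] subgroup.m_inv_closed[OF H that]])
  qed
  have Eab: "E (1, 0) = a" "E (0, 1) = b" using a b by (simp_all add: E_def pow3_simps)
  have \<theta>a: "\<theta> a = b" using \<theta>E[of "(1, 0)"] by (simp add: Eab)
  have "a \<in> H" unfolding H_def using Eab(1) by (metis rangeI)
  moreover have "\<theta> a \<noteq> a" "\<theta> a \<noteq> inv a" using b(3) unfolding \<theta>a by simp_all
  moreover have "a \<otimes> a \<noteq> \<one>" using order3_square[OF a(1,3)] a(1,2) by simp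
  ultimately show ?thesis using not_mPCI_group_if_twist[OF fin m] by blast
qed

end

section \<open>The groups that remain\<close>

lemma of_int_mod_3: "of_int (x mod 3) = (of_int x :: 3)"
proof -
  have "(of_int x :: 3) = of_int (3 * (x div 3) + x mod 3)" by simp
  also have "\<dots> = 3 * of_int (x div 3) + of_int (x mod 3)"
    by (simp only: of_int_add of_int_mult of_int_numeral)
  also have "(3 :: 3) = 0" by simp
  also have "0 * of_int (x div 3) + of_int (x mod 3) = (of_int (x mod 3) :: 3)" by simp
  finally show ?thesis by simp
qed

lemma of_int_3_inj: "of_int x = (of_int y :: 3) \<Longrightarrow> x \<in> {0..<3} \<Longrightarrow> y \<in> {0..<3} \<Longrightarrow> x = y"
proof -
  assume *: "of_int x = (of_int y :: 3)" "x \<in> {0..<3}" "y \<in> {0..<3}"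
  then have "x = 0 \<or> x = 1 \<or> x = 2" "y = 0 \<or> y = 1 \<or> y = 2" by auto
  then show "x = y" using *(1) by auto
qed

context group begin

text \<open>
  Lagrange's theorem in the subgroup, with the order of the element computed in the whole group.
\<close>

lemma ord_dvd_card_subgroup:
  assumes "subgroup P G" "x \<in> P"
  shows "ord x dvd card P"
proof -
  interpret P: group "G\<lparr>carrier := P\<rparr>" using assms(1) by (rule subgroup_imp_group)
  have "x [^]\<^bsub>G\<lparr>carrier := P\<rparr>\<^esub> order (G\<lparr>carrier := P\<rparr>) = \<one>"
    using P.pow_order_eq_1[of x] assms(2) by simp
  then have "x [^] card P = \<one>" by (simp add: order_def nat_pow_consistent[symmetric])
  then show ?thesis using pow_eq_id subgroup.mem_carrier[OF assms] by simp
qed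

text \<open>
  Cauchy's theorem, obtained from Sylow's.
\<close>

lemma ex_ord_prime:
  assumes fin: "finite (carrier G)" and p: "normalization_semidom_class.prime (p::nat)" "p dvd order G"
  obtains x where "x \<in> carrier G" "ord x = p"
proof -
  obtain k where "order G = p ^ 1 * k" using p(2) by (auto simp: dvd_def)
  from sylow_thm[OF p(1) is_group this fin] obtain P where P: "subgroup P G" "card P = p" by auto
  have "card P \<noteq> 1" using P p(1) by auto
  then have "P \<noteq> {\<one>}" by auto
  then obtain x where x: "x \<in> P" "x \<noteq> \<one>" using subgroup.one_closed[OF P(1)] by blast
  have xG: "x \<in> carrier G" using P(1) x(1) by (rule subgroup.mem_carrier)
  have "ord x dvd p" using ord_dvd_card_subgroup[OF P(1) x(1)] P(2) by simp
  moreover have "ord x \<noteq> 1" using x(2) ord_eq_1[OF xG] by simp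
  ultimately have "ord x = p" using p(1) by (auto simp: prime_nat_iff)
  then show thesis using that xG by blast
qed

text \<open>
  Every order from four on is excluded by one of the cyclic twists.
\<close>

lemma ord_le_3_if_mPCI:
  assumes fin: "finite (carrier G)" and m: "m \<ge> 4" and mPCI: "mPCI_group G m" and a: "a \<in> carrier G"
  shows "ord a \<in> {1, 2, 3}"
proof -
  have "ord a \<ge> 1" using ord_ge_1[OF fin a] by simp
  moreover have "\<not> ord a \<ge> 4"
  proof
    assume ge: "ord a \<ge> 4"
    show False
    proof (cases "even (ord a)")
      case True
      then show False using not_mPCI_group_if_even_ord[OF fin m a _ ge] mPCI by blast
    next
      case False
      then have "ord a \<noteq> 4" by auto
      then have "ord a \<ge> 5" using ge by simp
      then show False using not_mPCI_group_if_odd_ord[OF fin m a False] mPCI by blast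
    qed
  qed
  ultimately have "1 \<le> ord a" "ord a \<le> 3" by simp_all
  then show ?thesis by auto
qed

lemma nat_pow_2: "x \<in> carrier G \<Longrightarrow> x [^] (2::nat) = x \<otimes> x"
  by (simp add: numeral_2_eq_2)

lemma nat_pow_3: "x \<in> carrier G \<Longrightarrow> x [^] (3::nat) = x \<otimes> x \<otimes> x"
  by (simp add: numeral_3_eq_3)

text \<open>
  A subgroup of order four without elements of order four is a four-group.
\<close>

lemma not_4_dvd_order_if_mPCI:
  assumes fin: "finite (carrier G)" and m: "m \<ge> 4" and mPCI: "mPCI_group G m"
  shows "\<not> 4 dvd order G"
proof
  assume "4 dvd order G"
  then obtain k where "order G = 2 ^ 2 * k" by (auto simp: dvd_def)
  from sylow_thm[OF two_is_prime_nat is_group this fin]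
  obtain P where P: "subgroup P G" "card P = 4" by auto
  have PG: "x \<in> carrier G" if "x \<in> P" for x using P(1) that by (rule subgroup.mem_carrier)
  have sq: "x \<otimes> x = \<one>" if x: "x \<in> P" for x
  proof -
    have "ord x dvd 4" using ord_dvd_card_subgroup[OF P(1) x] P(2) by simp
    moreover have "\<not> 3 dvd (4::nat)" by simp
    ultimately have "ord x = 1 \<or> ord x = 2" using ord_le_3_if_mPCI[OF fin m mPCI PG[OF x]] by auto
    then have "ord x dvd 2" by auto
    then show ?thesis using pow_eq_id[OF PG[OF x], of 2] nat_pow_2[OF PG[OF x]] by simp
  qed
  have finP: "finite P" using P(2) card.infinite by fastforce
  have "\<not> P \<subseteq> {\<one>}"
  proof
    assume "P \<subseteq> {\<one>}"
    from card_mono[OF _ this] show False using P(2) by simp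
  qed
  then obtain a where a: "a \<in> P" "a \<noteq> \<one>" by blast
  have "\<not> P \<subseteq> {\<one>, a}"
  proof
    assume "P \<subseteq> {\<one>, a}"
    from card_mono[OF _ this] show False using P(2) a by simp
  qed
  then obtain b where b: "b \<in> P" "b \<noteq> \<one>" "b \<noteq> a" by blast
  have ab: "a \<otimes> b \<in> P" using P(1) a(1) b(1) by (rule subgroup.m_closed)
  have "inv (a \<otimes> b) = a \<otimes> b" using sq[OF ab] PG[OF ab] by (simp add: inv_equality)
  moreover have "inv a = a" "inv b = b" using sq[OF a(1)] sq[OF b(1)] PG a(1) b(1) by (simp_all add: inv_equality)
  ultimately have "a \<otimes> b = b \<otimes> a" using inv_mult_group[OF PG[OF a(1)] PG[OF b(1)]] by simp
  then show False
    using not_mPCI_group_if_four_group[OF fin m PG[OF a(1)] a(2) sq[OF a(1)] PG[OF b(1)] b(2) sq[OF b(1)]]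
      b(3) mPCI by metis
qed

text \<open>
  If conjugation by \<open>y\<close> inverts \<open>x\<close>, so does conjugation by \<open>y\<^sup>3 = \<one>\<close>.
\<close>

lemma not_inverted_by_order3:
  assumes x: "x \<in> carrier G" "x \<noteq> \<one>" "x \<otimes> x \<otimes> x = \<one>" and y: "y \<in> carrier G" "y \<otimes> y \<otimes> y = \<one>"
  shows "y \<otimes> x \<noteq> inv x \<otimes> y"
proof
  assume eq: "y \<otimes> x = inv x \<otimes> y"
  have eq': "y \<otimes> inv x = x \<otimes> y"
  proof -
    have "x \<otimes> (y \<otimes> x) \<otimes> inv x = x \<otimes> (inv x \<otimes> y) \<otimes> inv x" using eq by simp
    then show ?thesis using x y by (simp add: m_assoc inv_cancel)
  qed
  have "y \<otimes> y \<otimes> y \<otimes> x = y \<otimes> (y \<otimes> (y \<otimes> x))" using x(1) y(1) by (simp add: m_assoc)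
  also have "\<dots> = y \<otimes> (y \<otimes> (inv x \<otimes> y))" by (simp only: eq)
  also have "\<dots> = y \<otimes> (y \<otimes> inv x) \<otimes> y" using x(1) y(1) by (simp add: m_assoc)
  also have "\<dots> = y \<otimes> (x \<otimes> y) \<otimes> y" by (simp only: eq')
  also have "\<dots> = (y \<otimes> x) \<otimes> y \<otimes> y" using x(1) y(1) by (simp add: m_assoc)
  also have "\<dots> = (inv x \<otimes> y) \<otimes> y \<otimes> y" by (simp only: eq)
  also have "\<dots> = inv x \<otimes> (y \<otimes> y \<otimes> y)" using x(1) y(1) by (simp add: m_assoc)
  finally have "y \<otimes> y \<otimes> y \<otimes> x = inv x \<otimes> (y \<otimes> y \<otimes> y)" .
  then have "x = inv x" unfolding y(2) using x by simp
  then show False using order3_neq_inv[OF x] by simp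
qed

text \<open>
  The nine products \<open>a\<^sup>i b\<^sup>j\<close> exhaust the subgroup, so \<open>b a\<close> is one of them. All except \<open>a b\<close> are
  excluded: some make \<open>a\<close> or \<open>b\<close> a power of the other, two make one of them invert the other, and
  the last makes \<open>b a\<close> an involution.
\<close>

lemma commute_if_order_9:
  assumes P: "subgroup P G" "card P = 9" and cube: "\<And>x. x \<in> P \<Longrightarrow> x \<otimes> x \<otimes> x = \<one>"
    and a: "a \<in> P" "a \<noteq> \<one>" and b: "b \<in> P" "b \<notin> {\<one>, a, inv a}"
  shows "a \<otimes> b = b \<otimes> a"
proof -
  have aG: "a \<in> carrier G" and bG: "b \<in> carrier G"
    using P(1) a(1) b(1) by (auto intro: subgroup.mem_carrier)
  have pw: "pow3 x k \<in> P" if "x \<in> P" for x k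
    using that P(1) by (simp add: pow3_def subgroup.one_closed subgroup.m_inv_closed)
  let ?E = "\<lambda>(i, j). pow3 a i \<otimes> pow3 b j"
  have inj: "inj ?E"
    by (rule inj_pow3_mult[OF aG a(2) cube[OF a(1)] bG cube[OF b(1)] b(2)])
  have "range ?E \<subseteq> P"
    using pw[OF a(1)] pw[OF b(1)] subgroup.m_closed[OF P(1)] by auto
  moreover have "card (range ?E) = card P"
    using inj P(2) by (simp add: card_image)
  moreover have "finite P" using P(2) card.infinite by fastforce
  ultimately have "range ?E = P" by (intro card_subset_eq)
  moreover have ba: "b \<otimes> a \<in> P" using P(1) b(1) a(1) by (rule subgroup.m_closed)
  ultimately obtain i j where ij: "b \<otimes> a = pow3 a i \<otimes> pow3 b j" by auto
  have sa: "a \<otimes> a = inv a" "inv a \<otimes> inv a = a" using order3_square[OF aG cube[OF a(1)]] by auto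
  have sb: "b \<otimes> b = inv b" "inv b \<otimes> inv b = b" using order3_square[OF bG cube[OF b(1)]] by auto
  have bne: "b \<noteq> \<one>" "b \<noteq> a" "b \<noteq> inv a" using b(2) by auto
  have n1: "b \<otimes> a \<noteq> \<one>"
  proof
    assume "b \<otimes> a = \<one>"
    then have "inv a = b" using aG bG by (simp add: inv_equality)
    then show False using bne by simp
  qed
  have n2: "b \<otimes> a \<noteq> inv b"
  proof
    assume "b \<otimes> a = inv b"
    then have "b \<otimes> a = b \<otimes> b" using sb by simp
    then show False using aG bG bne by simp
  qed
  have n3: "b \<otimes> a \<noteq> inv a"
  proof
    assume "b \<otimes> a = inv a"
    then have "b \<otimes> a = a \<otimes> a" using sa by simp
    then show False using aG bG bne by simp
  qed
  have n4: "b \<otimes> a \<noteq> inv a \<otimes> b"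
    by (rule not_inverted_by_order3[OF aG a(2) cube[OF a(1)] bG cube[OF b(1)]])
  have n5: "b \<otimes> a \<noteq> a \<otimes> inv b"
  proof
    assume eq: "b \<otimes> a = a \<otimes> inv b"
    have "a \<otimes> b = inv b \<otimes> a"
    proof -
      have "inv b \<otimes> (b \<otimes> a) \<otimes> b = inv b \<otimes> (a \<otimes> inv b) \<otimes> b" using eq by simp
      then show ?thesis using aG bG by (simp add: m_assoc inv_cancel)
    qed
    then show False using not_inverted_by_order3[OF bG bne(1) cube[OF b(1)] aG cube[OF a(1)]] by simp
  qed
  have n6: "b \<otimes> a \<noteq> inv a \<otimes> inv b"
  proof
    assume eq: "b \<otimes> a = inv a \<otimes> inv b"
    have "inv (b \<otimes> a) = b \<otimes> a" using eq aG bG by (simp add: inv_mult_group)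
    moreover have "b \<otimes> a \<in> carrier G" using aG bG by simp
    ultimately show False using order3_neq_inv[OF _ n1 cube[OF ba]] by simp
  qed
  from cases_3[of i] cases_3[of j] show ?thesis
    using ij n1 n2 n3 n4 n5 n6 aG bG a(2) bne
    by (elim disjE) (simp_all add: pow3_simps)
qed

lemma not_9_dvd_order_if_mPCI:
  assumes fin: "finite (carrier G)" and m: "m \<ge> 4" and mPCI: "mPCI_group G m"
  shows "\<not> 9 dvd order G"
proof
  assume "9 dvd order G"
  then obtain k where "order G = 3 ^ 2 * k" by (auto simp: dvd_def)
  moreover have "normalization_semidom_class.prime (3::nat)" by simp
  ultimately have "\<exists>P. subgroup P G \<and> card P = 3 ^ 2"
    using sylow_thm[OF _ is_group _ fin] by blast
  then obtain P where P: "subgroup P G" "card P = 9" by auto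
  have PG: "x \<in> carrier G" if "x \<in> P" for x using P(1) that by (rule subgroup.mem_carrier)
  have cube: "x \<otimes> x \<otimes> x = \<one>" if x: "x \<in> P" for x
  proof -
    have "ord x dvd 9" using ord_dvd_card_subgroup[OF P(1) x] P(2) by simp
    moreover have "\<not> 2 dvd (9::nat)" by simp
    ultimately have "ord x = 1 \<or> ord x = 3" using ord_le_3_if_mPCI[OF fin m mPCI PG[OF x]] by auto
    then have "ord x dvd 3" by auto
    then show ?thesis using pow_eq_id[OF PG[OF x], of 3] nat_pow_3[OF PG[OF x]] by simp
  qed
  have "\<not> P \<subseteq> {\<one>}"
  proof
    assume "P \<subseteq> {\<one>}"
    from card_mono[OF _ this] show False using P(2) by simp
  qed
  then obtain a where a: "a \<in> P" "a \<noteq> \<one>" by blast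
  have "\<not> P \<subseteq> {\<one>, a, inv a}"
  proof
    assume "P \<subseteq> {\<one>, a, inv a}"
    from card_mono[OF _ this] show False
      using P(2) order3_card[OF PG[OF a(1)] a(2) cube[OF a(1)]] by simp
  qed
  then obtain b where b: "b \<in> P" "b \<notin> {\<one>, a, inv a}" by blast
  have "a \<otimes> b = b \<otimes> a" by (rule commute_if_order_9[OF P cube a b])
  then show False
    using not_mPCI_group_if_order_9_subgroup[OF fin m PG[OF a(1)] a(2) cube[OF a(1)] PG[OF b(1)]
        cube[OF b(1)] b(2)] mPCI by blast
qed

lemma order_if_mPCI:
  assumes fin: "finite (carrier G)" and m: "m \<ge> 4" and mPCI: "mPCI_group G m"
  shows "order G \<in> {1, 2, 3, 6}"
proof -
  let ?n = "order G"
  have n0: "?n > 0" using fin by (simp add: order_gt_0_iff_finite)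
  have primes: "p = 2 \<or> p = 3"
    if p: "normalization_semidom_class.prime p" "p dvd ?n" for p :: nat
  proof -
    obtain x where "x \<in> carrier G" "ord x = p" by (rule ex_ord_prime[OF fin p])
    then have "p \<in> {1, 2, 3}" using ord_le_3_if_mPCI[OF fin m mPCI] by blast
    moreover have "p \<noteq> 1" using p(1) by auto
    ultimately show ?thesis by blast
  qed
  have no4: "\<not> 4 dvd ?n" using assms by (rule not_4_dvd_order_if_mPCI)
  have no9: "\<not> 9 dvd ?n" using assms by (rule not_9_dvd_order_if_mPCI)
  obtain k where k: "?n = gcd ?n 6 * k" by (metis gcd_dvd1 dvdE)
  \<comment> \<open>A prime factor of the cofactor of \<open>gcd(n, 6)\<close> would be \<open>2\<close> or \<open>3\<close> and divide \<open>n\<close> twice.\<close>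
  have "k = 1"
  proof (rule ccontr)
    assume "k \<noteq> 1"
    then obtain p :: nat where p: "normalization_semidom_class.prime p" "p dvd k" using prime_factor_nat by blast
    then have "p dvd ?n" using k by (metis dvd_mult)
    then have "p = 2 \<or> p = 3" using primes p(1) by blast
    moreover have "p dvd 6" using calculation by auto
    then have "p dvd gcd ?n 6" using \<open>p dvd ?n\<close> by simp
    then have "p * p dvd gcd ?n 6 * k" using p(2) by (rule mult_dvd_mono)
    then have "p * p dvd ?n" using k by simp
    ultimately show False using no4 no9 by auto
  qed
  then have "?n dvd 6" using k by (metis gcd_dvd2 mult.right_neutral)
  moreover have "?n \<le> 6" using calculation by (rule dvd_imp_le) simp
  ultimately show ?thesis using n0 no4
    by (cases "?n = 1 \<or> ?n = 2 \<or> ?n = 3 \<or> ?n = 4 \<or> ?n = 5 \<or> ?n = 6") auto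
qed

text \<open>
  The isomorphism is the inverse of \<open>k \<mapsto> a\<^sup>k\<close>.
\<close>

lemma iso_integer_mod_group_if_ord:
  assumes fin: "finite (carrier G)" and a: "a \<in> carrier G" and ord: "ord a = order G"
  shows "G \<cong> integer_mod_group (order G)"
proof -
  let ?n = "order G" and ?Z = "integer_mod_group (order G)"
  have n0: "?n > 0" using fin by (simp add: order_gt_0_iff_finite)
  then have car: "carrier ?Z = {0..<int ?n}" by (simp add: carrier_integer_mod_group)
  let ?h = "\<lambda>k::int. a [^] k"
  have inj: "inj_on ?h {0..<int ?n}"
  proof (rule inj_onI)
    fix k l assume kl: "k \<in> {0..<int ?n}" "l \<in> {0..<int ?n}" "a [^] k = a [^] l"
    then have dvd: "int ?n dvd l - k" using int_pow_eq[OF a] ord by simp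
    show "k = l"
    proof (rule ccontr)
      assume "k \<noteq> l"
      then have "int ?n \<le> \<bar>l - k\<bar>" using dvd_imp_le_int[OF _ dvd] by simp
      then show False using kl(1,2) by auto
    qed
  qed
  have "?h ` {0..<int ?n} = carrier G"
    using fin a inj by (intro card_subset_eq) (auto simp: card_image order_def)
  moreover have "?h \<in> hom ?Z G"
  proof (rule homI)
    fix k l assume "k \<in> carrier ?Z" "l \<in> carrier ?Z"
    have "int ?n dvd (k + l) - (k + l) mod int ?n" by (rule dvd_minus_mod)
    then have "a [^] ((k + l) mod int ?n) = a [^] (k + l)" using int_pow_eq[OF a] ord by simp
    then show "?h (k \<otimes>\<^bsub>?Z\<^esub> l) = ?h k \<otimes> ?h l" using a by (simp add: int_pow_mult)
  qed (use a in simp)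
  ultimately have "?h \<in> iso ?Z G" using inj car by (simp add: iso_def bij_betw_def)
  then have "?Z \<cong> G" by (auto simp: is_iso_def)
  then show ?thesis by (rule group.iso_sym[OF group_integer_mod_group])
qed

text \<open>
  Take \<open>a\<close> of order three and \<open>b\<close> of order two. The six products \<open>a\<^sup>k b\<^sup>s\<close> exhaust \<open>G\<close>, so \<open>b a =
  a\<^sup>i b\<^sup>s\<close> for some \<open>i, s\<close>. Here \<open>i = 1\<close> would make \<open>a b\<close> an element of order six; what remains is
  the dihedral relation \<open>b a = a\<^sup>-\<^sup>1 b\<close>.
\<close>

lemma iso_dihedral_group_3:
  assumes fin: "finite (carrier G)" and ord6: "order G = 6"
    and small: "\<And>x. x \<in> carrier G \<Longrightarrow> ord x \<in> {1, 2, 3}"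
  shows "G \<cong> dihedral_group 3"
proof -
  obtain a where a: "a \<in> carrier G" "ord a = 3"
    by (rule ex_ord_prime[OF fin, of 3]) (use ord6 in auto)
  obtain b where b: "b \<in> carrier G" "ord b = 2"
    by (rule ex_ord_prime[OF fin, of 2]) (use ord6 in auto)
  have a3: "a \<otimes> a \<otimes> a = \<one>" using pow_eq_id[OF a(1), of 3] a nat_pow_3 by simp
  have b2: "b \<otimes> b = \<one>" using pow_eq_id[OF b(1), of 2] b nat_pow_2 by simp
  have a1: "a \<noteq> \<one>" using a by auto
  have b1: "b \<noteq> \<one>" using b by auto
  have sub: "subgroup {\<one>, a, inv a} G" using a(1) a3 by (rule order3_subgroup)
  have bA: "b \<notin> {\<one>, a, inv a}"
  proof
    assume "b \<in> {\<one>, a, inv a}"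
    from ord_dvd_card_subgroup[OF sub this] show False
      using order3_card[OF a(1) a1 a3] b(2) by simp
  qed
  define B where "B s = (if s then b else \<one>)" for s
  define c where "c = (\<lambda>(k, s). pow3 a k \<otimes> B s)"
  have BG: "B s \<in> carrier G" for s using b by (simp add: B_def)
  have BB: "B s \<otimes> B t = B (s \<noteq> t)" for s t using b b2 by (auto simp: B_def)
  have pG: "pow3 a k \<in> carrier G" for k using a by (simp add: pow3_closed)
  have cG: "c u \<in> carrier G" for u by (simp add: c_def BG pG split: prod.split)
  have inj: "inj c"
  proof (rule injI)
    fix u v assume eq: "c u = c v"
    obtain k s l t where uv: "u = (k, s)" "v = (l, t)" by (metis surj_pair)
    have eq': "pow3 a k \<otimes> B s = pow3 a l \<otimes> B t" using eq by (simp add: uv c_def)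
    have Bst: "B (s \<noteq> t) = pow3 a (l - k)"
    proof -
      have "B (s \<noteq> t) = inv (pow3 a k) \<otimes> (pow3 a k \<otimes> B s) \<otimes> B t"
        using pG BG by (simp add: m_assoc inv_cancel BB)
      also have "\<dots> = inv (pow3 a k) \<otimes> pow3 a l \<otimes> (B t \<otimes> B t)"
        unfolding eq' using pG BG by (simp add: m_assoc)
      also have "\<dots> = inv (pow3 a k) \<otimes> pow3 a l" using pG b2 by (simp add: B_def)
      also have "\<dots> = pow3 a (l - k)"
      proof -
        have "pow3 a k \<otimes> pow3 a (l - k) = pow3 a l" using pow3_add[OF a(1) a3, of k "l - k"] by simp
        then show ?thesis using pG by (metis inv_cancel(1))
      qed
      finally show ?thesis .
    qed
    have "s = t"
    proof (rule ccontr)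
      assume "s \<noteq> t"
      then have "b = pow3 a (l - k)" using Bst by (simp add: B_def)
      then show False using bA pow3_cases[of a "l - k"] by simp
    qed
    then have "pow3 a (l - k) = \<one>" using Bst by (simp add: B_def)
    then have "l - k = 0" by (rule pow3_eq_one[OF a(1) a1])
    then show "u = v" using uv \<open>s = t\<close> by simp
  qed
  have "card (range c) = 6" using inj by (simp add: card_image UNIV_bool card_cartesian_product)
  then have surj: "range c = carrier G"
    using fin cG ord6 by (intro card_subset_eq) (auto simp: order_def)
  have "b \<otimes> a \<in> range c" unfolding surj using a b by simp
  then obtain i s where ba: "b \<otimes> a = pow3 a i \<otimes> B s" by (auto simp: c_def)
  have s: "s"
  proof (rule ccontr)
    assume "\<not> s"
    then have "b \<otimes> a = pow3 a i" using ba pG by (simp add: B_def)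
    then have "b = pow3 a i \<otimes> inv a" using a b pG by (metis inv_solve_right)
    then have "b \<in> {\<one>, a, inv a}"
      using subgroup.m_closed[OF sub pow3_cases[of a i], of "inv a"] by simp
    then show False using bA by blast
  qed
  have "i = 2"
  proof -
    have "i \<noteq> 0"
    proof
      assume "i = 0"
      then have "b \<otimes> a = b" using ba s b by (simp add: pow3_simps B_def)
      then show False using a b a1 by simp
    qed
    moreover have "i \<noteq> 1"
    proof
      assume "i = 1"
      then have ba1: "b \<otimes> a = a \<otimes> b" using ba s by (simp add: pow3_simps B_def)
      let ?x = "a \<otimes> b"
      have xG: "?x \<in> carrier G" using a b by simp
      have "?x \<otimes> ?x = a \<otimes> (b \<otimes> a) \<otimes> b" using a b by (simp add: m_assoc)
      also have "\<dots> = (a \<otimes> a) \<otimes> (b \<otimes> b)" unfolding ba1 using a b by (simp add: m_assoc)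
      also have "\<dots> = a \<otimes> a" using b2 a by simp
      finally have x2: "?x \<otimes> ?x = a \<otimes> a" .
      then have x3: "?x \<otimes> ?x \<otimes> ?x = b" using a b a3 by (simp flip: m_assoc)
      have "?x \<otimes> ?x \<noteq> \<one>" using x2 order3_square(1)[OF a(1) a3] a a1 by simp
      moreover have "?x \<noteq> \<one>"
      proof
        assume "?x = \<one>"
        then show False using x3 b1 by simp
      qed
      ultimately have "ord ?x \<notin> {1, 2, 3}"
        using pow_ord_eq_1[OF xG] nat_pow_2[OF xG] nat_pow_3[OF xG] x3 b1 nat_pow_eone[OF xG] by auto
      then show False using small[OF xG] by simp
    qed
    ultimately show ?thesis using cases_3[of i] by simp
  qed
  then have ba2: "b \<otimes> a = inv a \<otimes> b" using ba s by (simp add: pow3_simps B_def)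
  have b_inv: "b \<otimes> inv a = a \<otimes> b"
  proof -
    have "a \<otimes> (b \<otimes> a) \<otimes> inv a = a \<otimes> (inv a \<otimes> b) \<otimes> inv a" using ba2 by simp
    then show ?thesis using a b by (simp add: m_assoc inv_cancel)
  qed
  have bp: "b \<otimes> pow3 a l = pow3 a (- l) \<otimes> b" for l
  proof -
    have neg: "- (1::3) = 2" "- (2::3) = 1" by simp_all
    from cases_3[of l] show ?thesis
    proof (elim disjE)
      assume "l = 0" then show ?thesis using b by (simp add: pow3_simps)
    next
      assume "l = 1" then show ?thesis using ba2 by (simp only: neg pow3_simps)
    next
      assume "l = 2" then show ?thesis using b_inv by (simp only: neg pow3_simps)
    qed
  qed
  have c_mult: "c (k, s) \<otimes> c (l, t) = c (if s then k - l else k + l, s \<noteq> t)" for k s l t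
  proof -
    have "c (k, s) \<otimes> c (l, t) = pow3 a k \<otimes> (B s \<otimes> pow3 a l) \<otimes> B t"
      using pG BG by (simp add: c_def m_assoc)
    also have "B s \<otimes> pow3 a l = pow3 a (if s then - l else l) \<otimes> B s"
      using bp pG by (simp add: B_def)
    also have "pow3 a k \<otimes> (pow3 a (if s then - l else l) \<otimes> B s) \<otimes> B t =
        (pow3 a k \<otimes> pow3 a (if s then - l else l)) \<otimes> (B s \<otimes> B t)"
      using pG BG by (simp add: m_assoc)
    also have "pow3 a k \<otimes> pow3 a (if s then - l else l) = pow3 a (if s then k - l else k + l)"
      using pow3_add[OF a(1) a3, of k "- l"] pow3_add[OF a(1) a3, of k l] by simp
    finally show ?thesis by (simp add: c_def BB)
  qed
  define h where "h = (\<lambda>(k::int, s). c (of_int k, s))"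
  let ?D = "dihedral_group 3"
  have car: "carrier ?D = {0..<3} \<times> UNIV" by (simp add: dihedral_group_def)
  have "inj_on h (carrier ?D)"
  proof (rule inj_onI)
    fix u v assume uv: "u \<in> carrier ?D" "v \<in> carrier ?D" "h u = h v"
    obtain k s l t where [simp]: "u = (k, s)" "v = (l, t)" by (metis surj_pair)
    have "(of_int k :: 3, s) = (of_int l, t)" using injD[OF inj, of "(of_int k, s)" "(of_int l, t)"] uv(3) by (simp add: h_def)
    then show "u = v" using of_int_3_inj[of k l] uv(1,2) car by simp
  qed
  moreover from this have "h ` carrier ?D = carrier G"
  proof (intro card_subset_eq fin)
    show "h ` carrier ?D \<subseteq> carrier G" using cG by (auto simp: h_def)
    assume "inj_on h (carrier ?D)"
    then have "card (h ` carrier ?D) = card (carrier ?D)" by (rule card_image)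
    also have "\<dots> = 6" using order_dihedral_group[of 3] by (simp add: order_def)
    finally show "card (h ` carrier ?D) = card (carrier G)" using ord6 by (simp add: order_def)
  qed
  moreover have "h \<in> hom ?D G"
  proof (rule homI)
    show "h u \<in> carrier G" for u using cG by (simp add: h_def split: prod.split)
    fix u v :: "int \<times> bool"
    obtain k s l t where [simp]: "u = (k, s)" "v = (l, t)" by (metis surj_pair)
    show "h (u \<otimes>\<^bsub>?D\<^esub> v) = h u \<otimes> h v"
      by (simp add: h_def dihedral_group_def c_mult of_int_mod_3)
  qed
  ultimately have "h \<in> iso ?D G" by (simp add: iso_def bij_betw_def)
  then have "?D \<cong> G" by (auto simp: is_iso_def)
  then show ?thesis by (rule group.iso_sym[OF group_dihedral_group[of 3, simplified]])
qed

end

section \<open>Signs and translations over the integers modulo three\<close>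

lemma arith_3: "(3::3) = 0" "(4::3) = 1" "- (1::3) = 2" "- (2::3) = 1" "3 * x = (0::3)"
proof -
  show three: "(3::3) = 0" by simp
  show "3 * x = (0::3)" unfolding three by (rule mult_zero_left)
qed simp_all

text \<open>
  If the signs differ, the pair \<open>(w\<^sub>2 l - w\<^sub>1 k, l - k)\<close> takes all values, as its determinant \<open>w\<^sub>1
  - w\<^sub>2\<close> is invertible; hence the two predicates have one common constant value.
\<close>

lemma opposite_signs_constant:
  fixes A A' :: "3 \<Rightarrow> bool"
  assumes eq: "\<And>k l. A' (w2 * l - w1 * k + e) \<longleftrightarrow> A (l - k)"
    and sgn: "w1 \<in> {1, 2}" "w2 \<in> {1, 2}" and ne: "w1 \<noteq> w2"
  shows "A' a \<longleftrightarrow> A b"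
proof -
  \<comment> \<open>The solutions of these linear systems in the two cases.\<close>
  have 1: "1 * (2 * (a - e + b)) - 2 * (2 * (a - e - b)) + e = a"
    using cases_3[of a] cases_3[of b] cases_3[of e] by (elim disjE) simp_all
  have 2: "2 * (2 * (2 * (a - e) + b)) - 1 * (2 * (2 * (a - e) - b)) + e = a"
    using cases_3[of a] cases_3[of b] cases_3[of e] by (elim disjE) simp_all
  have 3: "2 * (z + b) - 2 * (z - b) = b" for z :: 3
    using cases_3[of z] cases_3[of b] by (elim disjE) simp_all
  consider "w2 = 1" "w1 = 2" | "w2 = 2" "w1 = 1" using sgn ne by auto
  then show ?thesis
  proof cases
    case 1
    then show ?thesis using eq[of "2 * (a - e + b)" "2 * (a - e - b)"] \<open>1 * _ - _ + e = a\<close> 3[of "a - e"]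
      by (simp only:)
  next
    case 2
    then show ?thesis using eq[of "2 * (2 * (a - e) + b)" "2 * (2 * (a - e) - b)"]
        \<open>2 * (2 * _) - _ + e = a\<close> 3[of "2 * (a - e)"]
      by (simp only:)
  qed
qed

lemma opposite_signs_constant':
  fixes B B' :: "3 \<Rightarrow> bool"
  assumes eq: "\<And>k l. B' (w1 * k + w2 * l + e) \<longleftrightarrow> B (k + l)"
    and sgn: "w1 \<in> {1, 2}" "w2 \<in> {1, 2}" and ne: "w1 \<noteq> w2"
  shows "B' a \<longleftrightarrow> B b"
proof (rule opposite_signs_constant[OF _ sgn ne])
  show "B' (w2 * l - w1 * k + e) \<longleftrightarrow> B (l - k)" for k l
    using eq[of "- k" l] by (simp add: algebra_simps)
qed

lemma shift_invariant_constant: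
  fixes A :: "3 \<Rightarrow> bool"
  assumes "\<And>t. A (t + e) \<longleftrightarrow> A t" "e \<noteq> 0"
  shows "A a \<longleftrightarrow> A b"
proof -
  have "A 0 = A 1 \<and> A 1 = A 2"
    using assms(1)[of 0] assms(1)[of 1] assms(1)[of 2] cases_3[of e] assms(2) by (auto simp: arith_3)
  then show ?thesis using cases_3[of a] cases_3[of b] by auto
qed

text \<open>
  Two of the three elements of \<open>\<int>\<^sub>3\<close> lie on the same side of \<open>A\<close>; the reflection that interchanges
  them fixes the third.
\<close>

lemma ex_reflection_3:
  fixes A :: "3 \<Rightarrow> bool"
  shows "\<exists>c. \<forall>t. A (c - t) \<longleftrightarrow> A t"
proof -
  have neg: "(0::3) - 1 = 2" "(0::3) - 2 = 1" "(1::3) - 2 = 2" by simp_all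
  have *: "(\<forall>t. Q t) \<longleftrightarrow> Q 0 \<and> Q 1 \<and> Q 2" for Q :: "3 \<Rightarrow> bool"
    using cases_3 by metis
  have "A 1 = A 2 \<or> A 0 = A 1 \<or> A 0 = A 2" by blast
  then have "(\<forall>t. A (0 - t) = A t) \<or> (\<forall>t. A (1 - t) = A t) \<or> (\<forall>t. A (2 - t) = A t)"
    unfolding * by (auto simp: neg arith_3)
  then show ?thesis by blast
qed

lemma sign_3_cases: "s \<in> {1, 2} \<Longrightarrow> t \<in> {1, 2} \<Longrightarrow> s \<noteq> t \<Longrightarrow> s = - t" for s t :: 3
  by auto

text \<open>
  This is one pair of copies \<open>i, j\<close> of a group with elements \<open>a\<^sup>k\<close> and \<open>a\<^sup>k b\<close>, where \<open>b\<close> inverts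
  \<open>a\<close>. The predicates \<open>A\<close> and \<open>B\<close> describe the exponents of the elements \<open>a\<^sup>t\<close> and \<open>a\<^sup>t b\<close> in
  \<open>S\<^sub>i\<^sub>j\<close>, and \<open>A'\<close>, \<open>B'\<close> those in \<open>T\<^sub>i\<^sub>j\<close>. An isomorphism acts by \<open>a\<^sup>k \<mapsto> a\<^bsup>w k\<^esup>\<close> and \<open>a\<^sup>k b \<mapsto> a\<^bsup>v
  k + d\<^esup> b\<close> on each of the two copies, with its own signs \<open>w, v\<close> and translation \<open>d\<close>; the four
  conditions say that it respects adjacency between the four pairs of cosets of \<open>\<langle>a\<rangle>\<close>.
\<close>

locale sign_pair =
  fixes w1 v1 d1 w2 v2 d2 :: 3 and A A' B B' :: "3 \<Rightarrow> bool"
  assumes signs: "w1 \<in> {1, 2}" "v1 \<in> {1, 2}" "w2 \<in> {1, 2}" "v2 \<in> {1, 2}"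
    and h00: "\<And>k l. A' (w2 * l - w1 * k) \<longleftrightarrow> A (l - k)"
    and h11: "\<And>k l. A' (v2 * l - v1 * k + (d2 - d1)) \<longleftrightarrow> A (l - k)"
    and h01: "\<And>k l. B' (w1 * k + v2 * l + d2) \<longleftrightarrow> B (k + l)"
    and h10: "\<And>k l. B' (v1 * k + w2 * l + d1) \<longleftrightarrow> B (k + l)"
begin

lemma h00': "A' (w2 * t) \<longleftrightarrow> A t" using h00[of t 0] by simp
lemma h11': "A' (v2 * t + (d2 - d1)) \<longleftrightarrow> A t" using h11[of t 0] by simp
lemma h01': "B' (v2 * t + d2) \<longleftrightarrow> B t" using h01[of 0 t] by simp
lemma h10': "B' (w2 * t + d1) \<longleftrightarrow> B t" using h10[of 0 t] by simp

lemma A_constant: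
  assumes "w1 \<noteq> w2 \<or> v1 \<noteq> v2"
  shows "A' a \<longleftrightarrow> A b"
  using assms
proof
  assume ne: "w1 \<noteq> w2"
  show ?thesis
    by (rule opposite_signs_constant[of A' w2 w1 0 A, OF _ signs(1,3) ne]) (simp add: h00)
next
  assume ne: "v1 \<noteq> v2"
  show ?thesis
    by (rule opposite_signs_constant[of A' v2 v1 "d2 - d1" A, OF _ signs(2,4) ne]) (rule h11)
qed

lemma B_constant:
  assumes "w1 \<noteq> v2 \<or> v1 \<noteq> w2"
  shows "B' a \<longleftrightarrow> B b"
  using assms
proof
  assume ne: "w1 \<noteq> v2"
  show ?thesis
    by (rule opposite_signs_constant'[of B' w1 v2 d2 B, OF _ signs(1,4) ne]) (rule h01)
next
  assume ne: "v1 \<noteq> w2"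
  show ?thesis
    by (rule opposite_signs_constant'[of B' v1 w2 d1 B, OF _ signs(2,3) ne]) (rule h10)
qed

lemma square_w2: "w2 * (w2 * t) = t" for t
  using signs(3) by (auto simp: arith_3 simp flip: mult.assoc)

text \<open>
  The two conditions that involve \<open>A\<close> then differ by the translation \<open>d\<^sub>2 - d\<^sub>1\<close>.
\<close>

lemma A_constant_if_shift:
  assumes "w2 = v2" "d1 \<noteq> d2"
  shows "A' a \<longleftrightarrow> A' b"
proof (rule shift_invariant_constant[of A' "d2 - d1"])
  show "A' (t + (d2 - d1)) \<longleftrightarrow> A' t" for t
    using h00'[of "w2 * t"] h11'[of "w2 * t", folded assms(1)] by (simp add: square_w2)
qed (use assms in simp)

lemma B_constant_if_shift:
  assumes "w2 = v2" "d1 \<noteq> d2"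
  shows "B' a \<longleftrightarrow> B' b"
proof (rule shift_invariant_constant[of B' "d2 - d1"])
  show "B' (t + (d2 - d1)) \<longleftrightarrow> B' t" for t
    using h01'[of "w2 * (t - d1)", folded assms(1)] h10'[of "w2 * (t - d1)"]
    unfolding square_w2 by (simp add: algebra_simps)
qed (use assms in simp)

text \<open>
  The translation to be used on a copy with signs \<open>w, v\<close> when the common sign is to be \<open>s\<close>. If the
  signs differ, the coset on which the sign is already \<open>s\<close> decides. If both are \<open>s\<close>, the
  translations enter \<open>B'\<close> as a sum, which has to be \<open>d\<close> for two copies with the same \<open>d\<close>; in \<open>\<int>\<^sub>3\<close>
  half of \<open>d\<close> is \<open>- d\<close>.
\<close>

definition correction :: "3 \<Rightarrow> 3 \<Rightarrow> 3 \<Rightarrow> 3 \<Rightarrow> 3" where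
  "correction s w v d = (if w = v then - d else if w = s then 0 else d)"

text \<open>
  A copy whose two signs agree is required to have the common sign \<open>s\<close>. If the predicate is not
  constant, both copies have the same signs, and the correction matches the condition for the
  coset with sign \<open>s\<close>.
\<close>

lemma correction_A:
  assumes s: "s \<in> {1, 2}" and good: "w1 = v1 \<longrightarrow> w1 = s" "w2 = v2 \<longrightarrow> w2 = s"
  shows "A' (s * t + (correction s w2 v2 d2 - correction s w1 v1 d1)) \<longleftrightarrow> A t"
proof (cases "w1 \<noteq> w2 \<or> v1 \<noteq> v2 \<or> w2 = v2 \<and> d1 \<noteq> d2")
  case True
  then show ?thesis
  proof (elim disjE conjE)
    assume "w2 = v2" "d1 \<noteq> d2"
    then show ?thesis using A_constant_if_shift h00' by metis
  qed (use A_constant in blast)+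
next
  case False
  then have eq: "w1 = w2" "v1 = v2" by auto
  show ?thesis
  proof (cases "w2 = v2")
    case True
    then show ?thesis using False eq good h00' by (simp add: correction_def)
  next
    case ne: False
    show ?thesis
    proof (cases "w2 = s")
      case True
      then show ?thesis using ne eq h00' by (simp add: correction_def)
    next
      case False
      then have "v2 = s" using ne s signs(3,4) by auto
      then show ?thesis using ne False eq h11' by (simp add: correction_def)
    qed
  qed
qed

lemma correction_B:
  assumes s: "s \<in> {1, 2}" and good: "w1 = v1 \<longrightarrow> w1 = s" "w2 = v2 \<longrightarrow> w2 = s"
  shows "B' (s * t + (correction s w1 v1 d1 + correction s w2 v2 d2)) \<longleftrightarrow> B t"
proof (cases "w1 \<noteq> v2 \<or> v1 \<noteq> w2 \<or> w2 = v2 \<and> d1 \<noteq> d2")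
  case True
  then show ?thesis
  proof (elim disjE conjE)
    assume "w2 = v2" "d1 \<noteq> d2"
    then show ?thesis using B_constant_if_shift h01' by metis
  qed (use B_constant in blast)+
next
  case False
  then have eq: "w1 = v2" "v1 = w2" by auto
  show ?thesis
  proof (cases "w2 = v2")
    case True
    have "- d2 + - d2 = d2" using cases_3[of d2] by (auto simp: arith_3)
    then have "correction s w1 v1 d1 + correction s w2 v2 d2 = d2"
      using True False eq by (simp add: correction_def)
    then show ?thesis using True good h01'[of t] by simp
  next
    case ne: False
    show ?thesis
    proof (cases "w2 = s")
      case True
      then show ?thesis using ne eq h10' by (simp add: correction_def)
    next
      case False
      then have "v2 = s" using ne s signs(3,4) by auto
      then show ?thesis using ne False eq h01' by (simp add: correction_def)
    qed
  qed
qed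

text \<open>
  Both copies act by \<open>- s\<close> throughout. Reflecting \<open>A\<close> and \<open>B\<close> changes this sign into \<open>s\<close> at the
  cost of one translation for each. These prescribe the difference and the sum of the translations
  on the two copies, and the resulting system is solvable because two is invertible modulo three.
\<close>

lemma ex_reversal:
  assumes s: "s \<in> {1, 2}" and "w1 = v1" "w2 = v2" "w1 \<noteq> s" "w2 \<noteq> s"
  shows "\<exists>c1 c2. \<forall>t. (A' (s * t + (c2 - c1)) \<longleftrightarrow> A t) \<and> (B' (s * t + (c1 + c2)) \<longleftrightarrow> B t)"
proof -
  have w2: "w2 = - s" using signs(3) s assms(5) by (intro sign_3_cases)
  have ss: "s * (s * z) = z" for z using s by (auto simp: arith_3 simp flip: mult.assoc)
  obtain p where p: "\<And>t. A (p - t) \<longleftrightarrow> A t" using ex_reflection_3 by metis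
  obtain q where q: "\<And>t. B (q - t) \<longleftrightarrow> B t" using ex_reflection_3 by metis
  have A: "A' (s * t + - (s * p)) \<longleftrightarrow> A t" for t
    using h00'[of "p - t"] p[of t] by (simp add: w2 algebra_simps)
  have B: "B' (s * t + (d2 - s * q)) \<longleftrightarrow> B t" for t
    using h01'[of "q - t"] q[of t] w2 assms(3) by (simp add: algebra_simps)
  define c2 where "c2 = 2 * (- (s * p) + (d2 - s * q))"
  define c1 where "c1 = 2 * ((d2 - s * q) + s * p)"
  \<comment> \<open>Doubling is halving in \<open>\<int>\<^sub>3\<close>.\<close>
  have dbl: "2 * (x + y) - 2 * (y - x) = x" "2 * (y - x) + 2 * (x + y) = y" for x y :: 3
    using cases_3[of x] cases_3[of y] by (elim disjE; simp)+
  have "c2 - c1 = - (s * p)" "c1 + c2 = d2 - s * q"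
    unfolding c1_def c2_def using dbl(1)[of "- (s * p)" "d2 - s * q"] dbl(2)[of "d2 - s * q" "- (s * p)"]
    by (simp_all only: diff_minus_eq_add)
  then show ?thesis using A B by metis
qed

end

text \<open>
  Call an index bad for \<open>s\<close> if both its signs are \<open>- s\<close>. No index is bad for both signs, so with
  at most five indices one sign has at most two bad ones. A bad index has the sign \<open>- s\<close> on both
  cosets and a good one has \<open>s\<close> on at least one, so the predicates between them are constant and
  accept any translation. What is left are pairs of good indices, where the corrections above
  apply, and at most one pair of bad indices, which is reflected.
\<close>

lemma ex_uniform_correction:
  fixes w v d :: "nat \<Rightarrow> 3" and A A' B B' :: "nat \<Rightarrow> nat \<Rightarrow> 3 \<Rightarrow> bool"
  assumes m: "m \<le> 5"
    and pairs: "\<And>i j. i \<in> {1..m} \<Longrightarrow> j \<in> {1..m} \<Longrightarrow>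
      sign_pair (w i) (v i) (d i) (w j) (v j) (d j) (A i j) (A' i j) (B i j) (B' i j)"
    and diag: "\<And>i t. i \<in> {1..m} \<Longrightarrow> \<not> A i i t \<and> \<not> A' i i t \<and> \<not> B i i t \<and> \<not> B' i i t"
    and symA: "\<And>i j t. i \<in> {1..m} \<Longrightarrow> j \<in> {1..m} \<Longrightarrow> A j i t = A i j (- t) \<and> A' j i t = A' i j (- t)"
    and symB: "\<And>i j t. i \<in> {1..m} \<Longrightarrow> j \<in> {1..m} \<Longrightarrow> B j i t = B i j t \<and> B' j i t = B' i j t"
  obtains s c where "s \<in> {1, 2}"
    "\<And>i j t. i \<in> {1..m} \<Longrightarrow> j \<in> {1..m} \<Longrightarrow>
       (A' i j (s * t + (c j - c i)) \<longleftrightarrow> A i j t) \<and> (B' i j (s * t + (c i + c j)) \<longleftrightarrow> B i j t)"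
proof -
  have sgn: "w i \<in> {1, 2}" "v i \<in> {1, 2}" if "i \<in> {1..m}" for i
    using pairs[OF that that] by (simp_all add: sign_pair_def)
  define bad where "bad s = {i \<in> {1..m}. w i = v i \<and> w i \<noteq> s}" for s
  have "card (bad 1) + card (bad 2) \<le> 5"
  proof -
    have "(1::3) \<noteq> 2" by simp
    then have "bad 1 \<inter> bad 2 = {}" using sgn by (auto simp: bad_def)
    then have "card (bad 1) + card (bad 2) = card (bad 1 \<union> bad 2)"
      by (intro card_Un_disjoint[symmetric]) (auto simp: bad_def)
    also have "\<dots> \<le> card {1..m}" by (intro card_mono) (auto simp: bad_def)
    finally show ?thesis using m by simp
  qed
  then have "card (bad 1) \<le> 2 \<or> card (bad 2) \<le> 2" by linarith
  then obtain s where s: "s \<in> {1, 2}" and card: "card (bad s) \<le> 2" by blast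
  have finbad: "finite (bad s)" by (simp add: bad_def)
  obtain p q where pq: "bad s \<subseteq> {p, q}"
  proof -
    consider "card (bad s) = 0" | "card (bad s) = 1" | "card (bad s) = 2" using card by linarith
    then show thesis
    proof cases
      case 1 then show thesis using that finbad by auto
    next
      case 2 then show thesis using that by (auto simp: card_1_singleton_iff)
    next
      case 3 then show thesis using that by (auto simp: card_2_iff)
    qed
  qed
  have "\<exists>cp cq. p \<noteq> q \<and> p \<in> bad s \<and> q \<in> bad s \<longrightarrow>
      (\<forall>t. (A' p q (s * t + (cq - cp)) \<longleftrightarrow> A p q t) \<and> (B' p q (s * t + (cp + cq)) \<longleftrightarrow> B p q t))"
  proof (cases "p \<noteq> q \<and> p \<in> bad s \<and> q \<in> bad s")
    case True
    then have "\<exists>cp cq. \<forall>t. (A' p q (s * t + (cq - cp)) \<longleftrightarrow> A p q t) \<and> (B' p q (s * t + (cp + cq)) \<longleftrightarrow> B p q t)"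
      by (intro sign_pair.ex_reversal[OF pairs s]) (auto simp: bad_def)
    then show ?thesis by blast
  qed blast
  then obtain cp cq where cpq: "p \<noteq> q \<Longrightarrow> p \<in> bad s \<Longrightarrow> q \<in> bad s \<Longrightarrow>
      (A' p q (s * t + (cq - cp)) \<longleftrightarrow> A p q t) \<and> (B' p q (s * t + (cp + cq)) \<longleftrightarrow> B p q t)" for t
    by blast
  define c where "c i = (if i \<in> bad s then if i = p then cp else cq
                         else sign_pair.correction s (w i) (v i) (d i))" for i
  have "(A' i j (s * t + (c j - c i)) \<longleftrightarrow> A i j t) \<and> (B' i j (s * t + (c i + c j)) \<longleftrightarrow> B i j t)"
    if i: "i \<in> {1..m}" and j: "j \<in> {1..m}" for i j t
  proof -
    interpret sign_pair "w i" "v i" "d i" "w j" "v j" "d j" "A i j" "A' i j" "B i j" "B' i j"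
      by (rule pairs[OF i j])
    consider "i = j" | "i \<noteq> j" "i \<in> bad s" "j \<in> bad s" | "i \<in> bad s \<longleftrightarrow> j \<notin> bad s"
      | "i \<notin> bad s" "j \<notin> bad s" by blast
    then show ?thesis
    proof cases
      case 1
      then show ?thesis using diag[OF i] by simp
    next
      case 2
      then consider "i = p" "j = q" | "i = q" "j = p" using pq by blast
      then show ?thesis
      proof cases
        case ij: 1
        then show ?thesis using cpq[of t] 2 by (simp add: c_def)
      next
        case ij: 2
        have "A' i j (s * t + (c j - c i)) \<longleftrightarrow> A' p q (s * (- t) + (cq - cp))"
          using symA[OF j i] 2 ij by (simp add: c_def algebra_simps)
        also have "\<dots> \<longleftrightarrow> A p q (- t)" using cpq[of "- t"] 2 ij by simp
        also have "\<dots> \<longleftrightarrow> A i j t" using symA[OF j i] ij by simp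
        finally have "A' i j (s * t + (c j - c i)) \<longleftrightarrow> A i j t" .
        moreover have "B' i j (s * t + (c i + c j)) \<longleftrightarrow> B i j t"
          using cpq[of t] symB[OF j i] 2 ij by (simp add: c_def add.commute)
        ultimately show ?thesis by blast
      qed
    next
      case 3
      then have "(w i = v i \<and> w i \<noteq> s) \<noteq> (w j = v j \<and> w j \<noteq> s)" using i j by (auto simp: bad_def)
      then have "w i \<noteq> w j \<or> v i \<noteq> v j" "w i \<noteq> v j \<or> v i \<noteq> w j" by auto
      then show ?thesis using A_constant B_constant by blast
    next
      case 4
      then have good: "w i = v i \<longrightarrow> w i = s" "w j = v j \<longrightarrow> w j = s" using i j by (auto simp: bad_def)
      show ?thesis
        using correction_A[OF s good, of t] correction_B[OF s good, of t] 4 by (simp add: c_def)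
    qed
  qed
  then show thesis using that s by blast
qed

section \<open>Conjugating permutations of order three\<close>

text \<open>
  Otherwise the orbits would partition \<open>A\<close> into triples.
\<close>

lemma ex_fixed_point_order3:
  assumes fin: "finite A" and into: "\<And>x. x \<in> A \<Longrightarrow> t x \<in> A"
    and cube: "\<And>x. x \<in> A \<Longrightarrow> t (t (t x)) = x" and card: "\<not> 3 dvd card A"
  obtains x where "x \<in> A" "t x = x"
proof -
  have "\<exists>x\<in>A. t x = x"
  proof (rule ccontr)
    assume "\<not> (\<exists>x\<in>A. t x = x)"
    then have nofix: "t x \<noteq> x" if "x \<in> A" for x using that by blast
    define orb where "orb x = {x, t x, t (t x)}" for x
    have sub: "orb x \<subseteq> A" if "x \<in> A" for x using that into by (auto simp: orb_def)
    have Un: "\<Union> (orb ` A) = A" using sub by (auto simp: orb_def)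
    have eq: "orb y = orb x" if "x \<in> A" "y \<in> orb x" for x y
      using that cube by (auto simp: orb_def)
    have "3 dvd card (\<Union> (orb ` A))"
    proof (rule dvd_partition)
      show "finite (\<Union> (orb ` A))" using fin Un by simp
      show "\<forall>c\<in>orb ` A. 3 dvd card c"
      proof
        fix c assume "c \<in> orb ` A"
        then obtain x where x: "x \<in> A" "c = orb x" by blast
        have "t x \<noteq> x" "t (t x) \<noteq> t x" using nofix into x(1) by auto
        moreover have "t (t x) \<noteq> x" using nofix[OF into[OF into[OF x(1)]]] cube[OF x(1)] by metis
        ultimately have "card c = 3" using x(2) by (simp add: orb_def card_insert_if)
        then show "3 dvd card c" by simp
      qed
      show "\<forall>c1\<in>orb ` A. \<forall>c2\<in>orb ` A. c1 \<noteq> c2 \<longrightarrow> c1 \<inter> c2 = {}"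
      proof (intro ballI impI)
        fix c1 c2 assume "c1 \<in> orb ` A" "c2 \<in> orb ` A" and ne: "c1 \<noteq> c2"
        then obtain x y where xy: "x \<in> A" "c1 = orb x" "y \<in> A" "c2 = orb y" by blast
        show "c1 \<inter> c2 = {}"
        proof (rule ccontr)
          assume "c1 \<inter> c2 \<noteq> {}"
          then obtain z where z: "z \<in> orb x" "z \<in> orb y" using xy by blast
          have "orb x = orb y" using eq[OF xy(1) z(1)] eq[OF xy(3) z(2)] by simp
          then show False using ne xy by simp
        qed
      qed
    qed
    then show False using card Un by simp
  qed
  then show thesis using that by blast
qed

text \<open>
  An element of order three permutes the cosets \<open>P x\<close>, whose number is not a multiple of three; a
  fixed coset \<open>P x q = P x\<close> puts \<open>x q x\<^sup>-\<^sup>1\<close> into \<open>P\<close>.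
\<close>

lemma (in group) order3_conjugate_in_subgroup:
  assumes fin: "finite (carrier G)" and P: "subgroup P G" and index: "\<not> 3 dvd card (rcosets P)"
    and q: "q \<in> carrier G" "q \<otimes> q \<otimes> q = \<one>"
  obtains x where "x \<in> carrier G" "x \<otimes> q \<otimes> inv x \<in> P"
proof -
  have PG: "P \<subseteq> carrier G" using P by (rule subgroup.subset)
  have C: "\<exists>x\<in>carrier G. c = P #> x" if "c \<in> rcosets P" for c
    using that by (auto simp: RCOSETS_def)
  have fr: "finite (rcosets P)"
    using fin by (simp add: RCOSETS_def)
  obtain c where c: "c \<in> rcosets P" "c #> q = c"
  proof (rule ex_fixed_point_order3[of "rcosets P" "\<lambda>c. c #> q", OF fr _ _ index])
    show "c #> q \<in> rcosets P" if c: "c \<in> rcosets P" for c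
    proof -
      obtain x where "x \<in> carrier G" "c = P #> x" using C[OF c] by blast
      then have "c #> q = P #> (x \<otimes> q)" using coset_mult_assoc[OF PG _ q(1)] by simp
      then show ?thesis using \<open>x \<in> carrier G\<close> q(1) PG by (simp add: rcosetsI)
    qed
    show "c #> q #> q #> q = c" if c: "c \<in> rcosets P" for c
    proof -
      obtain x where x: "x \<in> carrier G" "c = P #> x" using C[OF c] by blast
      then have "c #> q #> q #> q = P #> (x \<otimes> q \<otimes> q \<otimes> q)"
        using q(1) by (simp add: coset_mult_assoc[OF PG])
      also have "x \<otimes> q \<otimes> q \<otimes> q = x \<otimes> (q \<otimes> q \<otimes> q)" using x(1) q(1) by (simp add: m_assoc)
      also have "\<dots> = x" using x(1) q(2) by simp
      finally show ?thesis using x(2) by simp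
    qed
  qed blast
  obtain x where x: "x \<in> carrier G" "c = P #> x" using C[OF c(1)] by blast
  have "P #> (x \<otimes> q) = P #> x" using c(2) x q(1) by (simp add: coset_mult_assoc[OF PG])
  from coset_mult_inv2[OF this _ x(1) PG] have "P #> (x \<otimes> q \<otimes> inv x) = P" using x(1) q(1) by simp
  from coset_join1[OF this _ P] have "x \<otimes> q \<otimes> inv x \<in> P" using x(1) q(1) by simp
  then show thesis using that x(1) by blast
qed

text \<open>
  Conjugates \<open>x q x\<^sup>-\<^sup>1\<close> and \<open>y q' y\<^sup>-\<^sup>1\<close> lie in one Sylow \<open>3\<close>-subgroup \<open>P\<close>. An orbit of \<open>P\<close> has
  as its size a power of three below nine, and no fixed points of \<open>q\<close> means that the size is
  three. Both conjugates act on such an orbit as a \<open>3\<close>-cycle, hence agree there up to inversion;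
  \<open>h = y\<^sup>-\<^sup>1 x\<close> carries this back to \<open>q\<close> and \<open>q'\<close>. The exponent depends on the orbit, which is why
  it is chosen vertex by vertex.
\<close>

lemma order3_orbits_conjugate:
  assumes finV: "finite V" and A: "subgroup A (BijGroup V)"
    and q: "q \<in> A" "\<And>v. v \<in> V \<Longrightarrow> q (q (q v)) = v" "\<And>v. v \<in> V \<Longrightarrow> q v \<noteq> v"
    and q': "q' \<in> A" "\<And>v. v \<in> V \<Longrightarrow> q' (q' (q' v)) = v" "\<And>v. v \<in> V \<Longrightarrow> q' v \<noteq> v"
    and orbits: "\<And>v. v \<in> V \<Longrightarrow> card {n v | n. n \<in> A} < 9"
  obtains h where "h \<in> A" "\<And>v. v \<in> V \<Longrightarrow> q' (h v) \<in> {h (q v), h (q (q v))}"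
proof -
  let ?B = "BijGroup V" and ?A = "BijGroup V\<lparr>carrier := A\<rparr>"
  interpret B: group ?B by (rule group_BijGroup)
  interpret A: group ?A using A by (rule B.subgroup_imp_group)
  have car: "carrier ?B = Bij V" by (simp add: BijGroup_def)
  have AB: "n \<in> Bij V" if "n \<in> A" for n using subgroup.subset[OF A] that car by blast
  have app: "(n \<otimes>\<^bsub>?A\<^esub> k) v = n (k v)" if "n \<in> A" "k \<in> A" "v \<in> V" for n k v
    using AB[OF that(1)] AB[OF that(2)] that(3) by (simp add: BijGroup_def compose_eq)
  have one: "\<one>\<^bsub>?A\<^esub> v = v" if "v \<in> V" for v using that by (simp add: BijGroup_def)
  have inV: "n v \<in> V" if "n \<in> A" "v \<in> V" for n v
    using AB[OF that(1)] that(2) Bij_imp_funcset by blast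
  have inv_app: "(inv\<^bsub>?A\<^esub> n) (n v) = v" "n ((inv\<^bsub>?A\<^esub> n) v) = v" "inv\<^bsub>?A\<^esub> n \<in> A"
    if n: "n \<in> A" and v: "v \<in> V" for n v
  proof -
    show i: "inv\<^bsub>?A\<^esub> n \<in> A" using A.inv_closed n by simp
    have "(inv\<^bsub>?A\<^esub> n \<otimes>\<^bsub>?A\<^esub> n) v = v" "(n \<otimes>\<^bsub>?A\<^esub> inv\<^bsub>?A\<^esub> n) v = v"
      using A.l_inv[of n] A.r_inv[of n] n one[OF v] by simp_all
    then show "(inv\<^bsub>?A\<^esub> n) (n v) = v" "n ((inv\<^bsub>?A\<^esub> n) v) = v"
      using app[OF i n v] app[OF n i v] by simp_all
  qed
  have ext: "n = k" if "n \<in> A" "k \<in> A" "\<And>v. v \<in> V \<Longrightarrow> n v = k v" for n k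
    using AB[OF that(1)] AB[OF that(2)] that(3) by (auto simp: Bij_def intro: extensionalityI)
  have cube: "n \<otimes>\<^bsub>?A\<^esub> n \<otimes>\<^bsub>?A\<^esub> n = \<one>\<^bsub>?A\<^esub>" if n: "n \<in> A" "\<And>v. v \<in> V \<Longrightarrow> n (n (n v)) = v" for n
  proof (rule ext)
    have nn: "n \<otimes>\<^bsub>?A\<^esub> n \<in> A" using A.m_closed[of n n] n by simp
    then show "n \<otimes>\<^bsub>?A\<^esub> n \<otimes>\<^bsub>?A\<^esub> n \<in> A" using A.m_closed[of "n \<otimes>\<^bsub>?A\<^esub> n" n] n by simp
    show "\<one>\<^bsub>?A\<^esub> \<in> A" using A.one_closed by simp
    show "(n \<otimes>\<^bsub>?A\<^esub> n \<otimes>\<^bsub>?A\<^esub> n) v = \<one>\<^bsub>?A\<^esub> v" if v: "v \<in> V" for v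
      unfolding app[OF nn n(1) v] app[OF n(1) n(1) inV[OF n(1) v]] n(2)[OF v] one[OF v] ..
  qed
  have "finite (V \<rightarrow>\<^sub>E V)" using finV by (intro finite_PiE) auto
  moreover have "A \<subseteq> V \<rightarrow>\<^sub>E V"
    unfolding PiE_def using Bij_imp_funcset[OF AB] Bij_imp_extensional[OF AB] by blast
  ultimately have finA: "finite (carrier ?A)" using finite_subset by simp
  have "order ?A > 0" using finA A.order_gt_0_iff_finite by blast
  then obtain k r where kr: "order ?A = 3 ^ k * r" "\<not> 3 dvd r"
  proof -
    have "order ?A \<noteq> 0" "\<not> is_unit (3::nat)" using \<open>order ?A > 0\<close> by simp_all
    then show thesis using multiplicity_decompose'[of "order ?A" 3] that by metis
  qed
  from sylow_thm[OF _ A.is_group kr(1) finA] obtain P where P: "subgroup P ?A" "card P = 3 ^ k" by auto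
  have PA: "P \<subseteq> A" using subgroup.subset[OF P(1)] by simp
  have "card (rcosets\<^bsub>?A\<^esub> P) * 3 ^ k = order ?A" using A.lagrange[OF P(1)] P(2) by simp
  then have "card (rcosets\<^bsub>?A\<^esub> P) = r" using kr(1) by simp
  then have index: "\<not> 3 dvd card (rcosets\<^bsub>?A\<^esub> P)" using kr(2) by simp
  obtain x where x: "x \<in> A" "x \<otimes>\<^bsub>?A\<^esub> q \<otimes>\<^bsub>?A\<^esub> inv\<^bsub>?A\<^esub> x \<in> P"
    using A.order3_conjugate_in_subgroup[OF finA P(1) index, of q] q(1) cube[OF q(1,2)] by auto
  obtain y where y: "y \<in> A" "y \<otimes>\<^bsub>?A\<^esub> q' \<otimes>\<^bsub>?A\<^esub> inv\<^bsub>?A\<^esub> y \<in> P"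
    using A.order3_conjugate_in_subgroup[OF finA P(1) index, of q'] q'(1) cube[OF q'(1,2)] by auto
  define p1 where "p1 = x \<otimes>\<^bsub>?A\<^esub> q \<otimes>\<^bsub>?A\<^esub> inv\<^bsub>?A\<^esub> x"
  define p2 where "p2 = y \<otimes>\<^bsub>?A\<^esub> q' \<otimes>\<^bsub>?A\<^esub> inv\<^bsub>?A\<^esub> y"
  have conj: "(z \<otimes>\<^bsub>?A\<^esub> n \<otimes>\<^bsub>?A\<^esub> inv\<^bsub>?A\<^esub> z) (z v) = z (n v)"
    if z: "z \<in> A" and n: "n \<in> A" and v: "v \<in> V" for z n v
  proof -
    have zn: "z \<otimes>\<^bsub>?A\<^esub> n \<in> A" using A.m_closed[of z n] z n by simp
    have "(z \<otimes>\<^bsub>?A\<^esub> n \<otimes>\<^bsub>?A\<^esub> inv\<^bsub>?A\<^esub> z) (z v) = (z \<otimes>\<^bsub>?A\<^esub> n) v"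
      using app[OF zn inv_app(3)[OF z v] inV[OF z v]] inv_app(1)[OF z v] by simp
    then show ?thesis using app[OF z n v] by simp
  qed
  have p12: "p1 \<in> P" "p2 \<in> P" using x y by (simp_all add: p1_def p2_def)
  have p1_app: "p1 (x v) = x (q v)" if "v \<in> V" for v unfolding p1_def using x(1) q(1) that by (rule conj)
  have p2_app: "p2 (y v) = y (q' v)" if "v \<in> V" for v unfolding p2_def using y(1) q'(1) that by (rule conj)
  have inj: "n u = n v \<Longrightarrow> u = v" if "n \<in> A" "u \<in> V" "v \<in> V" for n u v
    using inv_app(1)[OF that(1,2)] inv_app(1)[OF that(1,3)] by metis
  let ?P = "BijGroup V\<lparr>carrier := P\<rparr>"
  interpret act: group_action ?P V "\<lambda>n. n"
  proof (intro group_action.intro group_hom.intro group_hom_axioms.intro homI)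
    show "group ?P" using A.subgroup_imp_group[OF P(1)] by simp
    show "n \<in> carrier ?B" if "n \<in> carrier ?P" for n using that PA AB car by auto
  qed (simp_all add: group_BijGroup)
  have orbP: "Group_Action.orbit ?P (\<lambda>n. n) w = {w, p1 w, p1 (p1 w)}" "p1 (p1 w) \<noteq> w" "p1 w \<noteq> w"
    if w: "w \<in> V" for w
  proof -
    let ?o = "Group_Action.orbit ?P (\<lambda>n. n) w"
    let ?v = "(inv\<^bsub>?A\<^esub> x) w"
    have v: "?v \<in> V" "x ?v = w" using inv_app[OF x(1) w] inV w by auto
    have p1w: "p1 w = x (q ?v)" using p1_app[OF v(1)] v(2) by simp
    have qv: "q ?v \<in> V" "q (q ?v) \<in> V" using inV[OF q(1)] v(1) by auto
    have p11w: "p1 (p1 w) = x (q (q ?v))" unfolding p1w using p1_app[OF qv(1)] .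
    have n1: "p1 w \<noteq> w" using inj[OF x(1) qv(1) v(1)] q(3)[OF v(1)] p1w v(2) by auto
    have n2: "p1 (p1 w) \<noteq> p1 w" using inj[OF x(1) qv(2) qv(1)] q(3)[OF qv(1)] p1w p11w by auto
    have "q (q ?v) \<noteq> ?v" using q(3)[OF qv(2)] q(2)[OF v(1)] by metis
    then have n3: "p1 (p1 w) \<noteq> w" using inj[OF x(1) qv(2) v(1)] p11w v(2) by auto
    have p1A: "p1 \<in> A" using p12 PA by blast
    have "p1 \<otimes>\<^bsub>?A\<^esub> p1 \<in> P" using subgroup.m_closed[OF P(1) p12(1) p12(1)] .
    moreover have "(p1 \<otimes>\<^bsub>?A\<^esub> p1) w = p1 (p1 w)" using app[OF p1A p1A w] .
    moreover have "\<one>\<^bsub>?A\<^esub> \<in> P" using subgroup.one_closed[OF P(1)] .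
    ultimately have "w \<in> ?o" "p1 w \<in> ?o" "p1 (p1 w) \<in> ?o"
      using p12(1) one[OF w] unfolding Group_Action.orbit_def by (auto, metis, metis)
    then have sub: "{w, p1 w, p1 (p1 w)} \<subseteq> ?o" by blast
    have card3: "card {w, p1 w, p1 (p1 w)} = 3" using n1 n2 n3 by (simp add: card_insert_if)
    have o: "?o \<subseteq> {n w | n. n \<in> A}" using PA by (auto simp: Group_Action.orbit_def)
    have finO: "finite {n w | n. n \<in> A}" using finA by simp
    have fino: "finite ?o" using o finO by (rule finite_subset)
    have less: "card ?o < 9" using card_mono[OF finO o] orbits[OF w] by (rule le_less_trans)
    have "card ?o * card (stabilizer ?P (\<lambda>n. n) w) = 3 ^ k"
      using act.orbit_stabilizer_theorem[OF w] P(2) by (simp add: order_def)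
    then have "card ?o dvd 3 ^ k" by (rule dvdI[OF sym])
    moreover have "normalization_semidom_class.prime (3::nat)" by simp
    ultimately have "\<exists>l\<le>k. card ?o = 3 ^ l" by (simp only: divides_primepow_nat)
    then obtain l where l: "card ?o = 3 ^ l" by blast
    have "l < 2"
    proof (rule ccontr)
      assume "\<not> l < 2"
      then have "(3::nat) ^ 2 \<le> 3 ^ l" by (intro power_increasing) auto
      then show False using less l by simp
    qed
    moreover have "3 \<le> card ?o" using card_mono[OF fino sub] card3 by simp
    ultimately have "card ?o = 3" using l by (cases l) auto
    then show "?o = {w, p1 w, p1 (p1 w)}" using card_subset_eq[OF fino sub] card3 by simp
    show "p1 (p1 w) \<noteq> w" "p1 w \<noteq> w" using n1 n3 by auto
  qed
  define h where "h = inv\<^bsub>?A\<^esub> y \<otimes>\<^bsub>?A\<^esub> x"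
  have hA: "h \<in> A" using A.m_closed[of "inv\<^bsub>?A\<^esub> y" x] A.inv_closed[of y] x(1) y(1) by (simp add: h_def)
  have iyA: "inv\<^bsub>?A\<^esub> y \<in> A" using A.inv_closed[of y] y(1) by simp
  have happ: "h v = (inv\<^bsub>?A\<^esub> y) (x v)" if "v \<in> V" for v unfolding h_def using app[OF iyA x(1) that] .
  have "q' (h v) \<in> {h (q v), h (q (q v))}" if v: "v \<in> V" for v
  proof -
    let ?w = "x v"
    have w: "?w \<in> V" using inV[OF x(1) v] .
    have hv: "h v \<in> V" using inV[OF hA v] .
    have yh: "y (h v) = ?w" using happ[OF v] inv_app(2)[OF y(1) w] by simp
    have p2w: "p2 ?w = y (q' (h v))" using p2_app[OF hv] yh by simp
    have "p2 ?w \<noteq> ?w"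
      using inj[OF y(1) inV[OF q'(1) hv] hv] q'(3)[OF hv] p2w yh by auto
    moreover have "p2 ?w \<in> Group_Action.orbit ?P (\<lambda>n. n) ?w" using p12(2) by (auto simp: Group_Action.orbit_def)
    ultimately have "p2 ?w \<in> {p1 ?w, p1 (p1 ?w)}" using orbP(1)[OF w] by blast
    moreover have "p1 ?w = x (q v)" using p1_app[OF v] .
    moreover have "p1 (x (q v)) = x (q (q v))" using p1_app[OF inV[OF q(1) v]] .
    ultimately have "y (q' (h v)) \<in> {x (q v), x (q (q v))}" using p2w by simp
    then have "(inv\<^bsub>?A\<^esub> y) (y (q' (h v))) \<in> {h (q v), h (q (q v))}"
      using happ inV[OF q(1)] v by auto
    then show ?thesis using inv_app(1)[OF y(1) inV[OF q'(1) hv]] by simp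
  qed
  then show thesis using that hA by blast
qed

section \<open>Isomorphisms that permute the cosets of a subgroup of order three\<close>

context group begin

text \<open>
  The last property says that \<open>f\<^sub>i\<close> maps each coset \<open>x \<langle>a\<rangle>\<close> onto a coset of \<open>\<langle>a\<rangle>\<close>. Right
  multiplication by \<open>a\<close> is an automorphism of both digraphs; transported from the second digraph
  to the first it becomes \<open>q'\<close> next to the original \<open>q\<close>. Both lie in the group of automorphisms
  that fix each copy, and the previous lemma yields an automorphism \<open>h\<close> of the first digraph by
  which any given isomorphism can be corrected. The bound on the order of \<open>G\<close> keeps the orbits
  below nine points.
\<close>

lemma copy_isomorphism_normalizing_order3:
  assumes fin: "finite (carrier G)" and small: "order G < 9"
    and a: "a \<in> carrier G" "a \<noteq> \<one>" "a \<otimes> a \<otimes> a = \<one>"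
    and iso: "copy_isomorphic m S T"
  obtains \<sigma> f where "bij_betw \<sigma> {1..m} {1..m}"
    "\<And>i. i \<in> {1..m} \<Longrightarrow> bij_betw (f i) (carrier G) (carrier G)"
    "\<And>i j x y. \<lbrakk>i \<in> {1..m}; j \<in> {1..m}; x \<in> carrier G; y \<in> carrier G\<rbrakk> \<Longrightarrow>
       f j y \<otimes> inv (f i x) \<in> T (\<sigma> i) (\<sigma> j) \<longleftrightarrow> y \<otimes> inv x \<in> S i j"
    "\<And>i x. i \<in> {1..m} \<Longrightarrow> x \<in> carrier G \<Longrightarrow> f i x \<otimes> a \<in> {f i (x \<otimes> a), f i (x \<otimes> a \<otimes> a)}"
proof -
  obtain \<sigma> f where \<sigma>: "bij_betw \<sigma> {1..m} {1..m}"
    and f: "\<And>i. i \<in> {1..m} \<Longrightarrow> bij_betw (f i) (carrier G) (carrier G)"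
    and adj: "\<And>i j x y. \<lbrakk>i \<in> {1..m}; j \<in> {1..m}; x \<in> carrier G; y \<in> carrier G\<rbrakk> \<Longrightarrow>
         f j y \<otimes> inv (f i x) \<in> T (\<sigma> i) (\<sigma> j) \<longleftrightarrow> y \<otimes> inv x \<in> S i j"
    using iso unfolding copy_isomorphic_iff by metis
  have fG: "f i x \<in> carrier G" if "i \<in> {1..m}" "x \<in> carrier G" for i x
    using f[OF that(1)] that(2) by (rule bij_betwE[THEN bspec])
  have f_inj: "f i x = f i y \<longleftrightarrow> x = y" if "i \<in> {1..m}" "x \<in> carrier G" "y \<in> carrier G" for i x y
    using inj_on_eq_iff[OF bij_betw_imp_inj_on[OF f[OF that(1)]] that(2,3)] .
  define g where "g i = inv_into (carrier G) (f i)" for i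
  have gG: "g i y \<in> carrier G" and fg: "f i (g i y) = y" if "i \<in> {1..m}" "y \<in> carrier G" for i y
    using that bij_betw_imp_surj_on[OF f[OF that(1)]]
    by (simp_all add: g_def inv_into_into f_inv_into_f)
  have gf: "g i (f i x) = x" if "i \<in> {1..m}" "x \<in> carrier G" for i x
    using bij_betw_inv_into_left[OF f[OF that(1)] that(2)] by (simp add: g_def)
  define V where "V = copies G m"
  have VI: "(x, i) \<in> V \<longleftrightarrow> x \<in> carrier G \<and> i \<in> {1..m}" for x i by (simp add: V_def in_copies)
  have finV: "finite V" using fin by (auto simp: V_def copies_def copy_def)
  define A where "A = {n \<in> Bij V. (\<forall>v\<in>V. snd (n v) = snd v) \<and>
      (\<forall>u\<in>V. \<forall>v\<in>V. adjacent S (n u) (n v) \<longleftrightarrow> adjacent S u v)}"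
  have Bij_in: "n v \<in> V" if "n \<in> Bij V" "v \<in> V" for n v
    using that Bij_imp_funcset by blast
  have A: "subgroup A (BijGroup V)"
  proof (rule group.subgroupI[OF group_BijGroup])
    show "A \<subseteq> carrier (BijGroup V)" by (auto simp: A_def carrier_BijGroup)
    have "(\<lambda>v\<in>V. v) \<in> A" by (simp add: A_def id_Bij)
    then show "A \<noteq> {}" by blast
    show "inv\<^bsub>BijGroup V\<^esub> n \<in> A" if n: "n \<in> A" for n
    proof -
      have nB: "n \<in> Bij V" using n by (simp add: A_def)
      let ?k = "inv\<^bsub>BijGroup V\<^esub> n"
      have k: "?k = (\<lambda>x\<in>V. inv_into V n x)" using nB by (rule inv_BijGroup)
      then have kB: "?k \<in> Bij V" using restrict_inv_into_Bij[OF nB] by simp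
      have nk: "n (?k v) = v" if "v \<in> V" for v
        using that nB by (simp add: k Bij_def bij_betw_def f_inv_into_f)
      have "snd (?k v) = snd v" if v: "v \<in> V" for v
      proof -
        have "snd (n (?k v)) = snd (?k v)" using n Bij_in[OF kB v] by (simp add: A_def)
        then show ?thesis using nk[OF v] by simp
      qed
      moreover have "adjacent S (?k u) (?k v) \<longleftrightarrow> adjacent S u v" if uv: "u \<in> V" "v \<in> V" for u v
      proof -
        have "adjacent S (n (?k u)) (n (?k v)) \<longleftrightarrow> adjacent S (?k u) (?k v)"
          using n Bij_in[OF kB uv(1)] Bij_in[OF kB uv(2)] by (simp add: A_def)
        then show ?thesis using nk[OF uv(1)] nk[OF uv(2)] by simp
      qed
      ultimately show ?thesis using kB unfolding A_def by blast
    qed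
    show "n \<otimes>\<^bsub>BijGroup V\<^esub> k \<in> A" if nk: "n \<in> A" "k \<in> A" for n k
    proof -
      have B: "n \<in> Bij V" "k \<in> Bij V" using nk by (simp_all add: A_def)
      have eq: "n \<otimes>\<^bsub>BijGroup V\<^esub> k = compose V n k" using B by (rule BijGroup_mult)
      have "compose V n k \<in> Bij V" using B by (rule compose_Bij)
      moreover have "snd (compose V n k v) = snd v" if "v \<in> V" for v
        using nk that Bij_in[OF B(2) that] by (simp add: A_def compose_eq)
      moreover have "adjacent S (compose V n k u) (compose V n k v) \<longleftrightarrow> adjacent S u v"
        if "u \<in> V" "v \<in> V" for u v
        using nk that Bij_in[OF B(2) that(1)] Bij_in[OF B(2) that(2)] by (simp add: A_def compose_eq)
      ultimately show ?thesis unfolding eq A_def by blast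
    qed
  qed
  define q where "q = (\<lambda>(x, i)\<in>V. (x \<otimes> a, i))"
  define q' where "q' = (\<lambda>(x, i)\<in>V. (g i (f i x \<otimes> a), i))"
  have q_app: "q (x, i) = (x \<otimes> a, i)" and q'_app: "q' (x, i) = (g i (f i x \<otimes> a), i)"
    if "x \<in> carrier G" "i \<in> {1..m}" for x i
    using that by (simp_all add: q_def q'_def VI)
  have aaa: "x \<otimes> a \<otimes> a \<otimes> a = x" if "x \<in> carrier G" for x
  proof -
    have "x \<otimes> a \<otimes> a \<otimes> a = x \<otimes> (a \<otimes> a \<otimes> a)" using that a(1) by (simp add: m_assoc)
    then show ?thesis using that a by simp
  qed
  have q3: "q (q (q v)) = v" and qV: "q v \<in> V" and q_ne: "q v \<noteq> v" if "v \<in> V" for v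
    using that a(1,2) by (cases v; simp add: VI q_app aaa)+
  have q'3: "q' (q' (q' v)) = v" and q'V: "q' v \<in> V" if "v \<in> V" for v
    using that a(1) by (cases v; simp add: VI q'_app fG gG fg gf aaa)+
  have q'_ne: "q' v \<noteq> v" if v: "v \<in> V" for v
  proof -
    obtain x i where xi: "v = (x, i)" by (cases v)
    have c: "x \<in> carrier G" "i \<in> {1..m}" using v xi VI by auto
    have "f i (g i (f i x \<otimes> a)) \<noteq> f i x" using c a(1,2) by (simp add: fg fG)
    then show ?thesis using c by (auto simp: xi q'_app)
  qed
  have Bij_of_cube: "n \<in> Bij V"
    if "\<And>v. v \<in> V \<Longrightarrow> n v \<in> V" "\<And>v. v \<in> V \<Longrightarrow> n (n (n v)) = v" "n \<in> extensional V" for n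
  proof -
    have "bij_betw n V V"
    proof (rule bij_betw_byWitness[where f' = "\<lambda>v. n (n v)"])
      show "n ` V \<subseteq> V" using that(1) by (rule image_subsetI)
      show "(\<lambda>v. n (n v)) ` V \<subseteq> V" by (rule image_subsetI) (rule that(1)[OF that(1)])
    qed (use that(2) in blast)+
    then show ?thesis using that(3) by (simp add: Bij_def)
  qed
  have qB: "q \<in> Bij V" using qV q3 by (rule Bij_of_cube) (simp_all only: q_def restrict_extensional)
  have q'B: "q' \<in> Bij V" using q'V q'3 by (rule Bij_of_cube) (simp_all only: q'_def restrict_extensional)
  have qA: "q \<in> A"
  proof -
    have "adjacent S (q u) (q v) \<longleftrightarrow> adjacent S u v" if "u \<in> V" "v \<in> V" for u v
    proof -
      obtain x i y j where uv: "u = (x, i)" "v = (y, j)" by (metis surj_pair)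
      have c: "x \<in> carrier G" "i \<in> {1..m}" "y \<in> carrier G" "j \<in> {1..m}" using that uv VI by auto
      then show ?thesis using a(1) by (simp add: uv q_app adjacent_def inv_mult_group m_assoc inv_cancel)
    qed
    moreover have "snd (q v) = snd v" if "v \<in> V" for v using that by (cases v) (simp add: VI q_app)
    ultimately show ?thesis using qB unfolding A_def by blast
  qed
  have q'A: "q' \<in> A"
  proof -
    have "adjacent S (q' u) (q' v) \<longleftrightarrow> adjacent S u v" if "u \<in> V" "v \<in> V" for u v
    proof -
      obtain x i y j where uv: "u = (x, i)" "v = (y, j)" by (metis surj_pair)
      have c: "x \<in> carrier G" "i \<in> {1..m}" "y \<in> carrier G" "j \<in> {1..m}" using that uv VI by auto
      have d: "g i (f i x \<otimes> a) \<in> carrier G" "g j (f j y \<otimes> a) \<in> carrier G"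
        using c a(1) by (simp_all add: gG fG)
      have "adjacent S (q' u) (q' v) \<longleftrightarrow> g j (f j y \<otimes> a) \<otimes> inv (g i (f i x \<otimes> a)) \<in> S i j"
        using c by (simp add: uv q'_app adjacent_def)
      also have "\<dots> \<longleftrightarrow> (f j y \<otimes> a) \<otimes> inv (f i x \<otimes> a) \<in> T (\<sigma> i) (\<sigma> j)"
        using adj[OF c(2,4) d] c a(1) by (simp add: fg fG)
      also have "(f j y \<otimes> a) \<otimes> inv (f i x \<otimes> a) = f j y \<otimes> inv (f i x)"
        using c a(1) fG by (simp add: inv_mult_group m_assoc inv_cancel)
      also have "f j y \<otimes> inv (f i x) \<in> T (\<sigma> i) (\<sigma> j) \<longleftrightarrow> adjacent S u v"
        using adj[OF c(2,4,1,3)] by (simp add: uv adjacent_def)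
      finally show ?thesis .
    qed
    moreover have "snd (q' v) = snd v" if "v \<in> V" for v using that by (cases v) (simp add: VI q'_app)
    ultimately show ?thesis using q'B unfolding A_def by blast
  qed
  have orbits: "card {n v | n. n \<in> A} < 9" if v: "v \<in> V" for v
  proof -
    have "{n v | n. n \<in> A} \<subseteq> carrier G \<times> {snd v}"
    proof
      fix w assume "w \<in> {n v | n. n \<in> A}"
      then obtain n where n: "n \<in> A" "w = n v" by blast
      then have "w \<in> V" "snd w = snd v" using v Bij_in by (auto simp: A_def)
      then show "w \<in> carrier G \<times> {snd v}" using VI by (cases w) simp
    qed
    from card_mono[OF _ this] have "card {n v | n. n \<in> A} \<le> order G"
      using fin by (simp add: order_def card_cartesian_product)
    then show ?thesis using small by simp
  qed
  obtain h where hA: "h \<in> A" and h: "\<And>v. v \<in> V \<Longrightarrow> q' (h v) \<in> {h (q v), h (q (q v))}"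
    using order3_orbits_conjugate[OF finV A qA q3 q_ne q'A q'3 q'_ne orbits] by blast
  have hB: "h \<in> Bij V" using hA by (simp add: A_def)
  define k where "k i x = fst (h (x, i))" for i x
  have h_form: "h (x, i) = (k i x, i)" if "x \<in> carrier G" "i \<in> {1..m}" for x i
    using hA that VI by (auto simp: A_def k_def intro: prod_eqI)
  have kG: "k i x \<in> carrier G" if "x \<in> carrier G" "i \<in> {1..m}" for x i
    using Bij_in[OF hB, of "(x, i)"] that h_form[OF that] VI by simp
  have k_bij: "bij_betw (k i) (carrier G) (carrier G)" if i: "i \<in> {1..m}" for i
  proof -
    have inj: "inj_on (k i) (carrier G)"
    proof (rule inj_onI)
      fix x y assume *: "x \<in> carrier G" "y \<in> carrier G" "k i x = k i y"
      then have eq: "h (x, i) = h (y, i)" using h_form i by simp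
      have "inj_on h V" using hB by (simp add: Bij_def bij_betw_def)
      from inj_onD[OF this eq] show "x = y" using * i VI by simp
    qed
    then have "k i ` carrier G = carrier G"
      using kG i by (intro endo_inj_surj fin image_subsetI)
    then show ?thesis using inj by (simp add: bij_betw_def)
  qed
  show thesis
  proof (rule that[of \<sigma> "\<lambda>i x. f i (k i x)"])
    show "bij_betw \<sigma> {1..m} {1..m}" by (rule \<sigma>)
    show "bij_betw (\<lambda>x. f i (k i x)) (carrier G) (carrier G)" if "i \<in> {1..m}" for i
      using bij_betw_trans[OF k_bij[OF that] f[OF that]] by (simp add: comp_def)
    show "f j (k j y) \<otimes> inv (f i (k i x)) \<in> T (\<sigma> i) (\<sigma> j) \<longleftrightarrow> y \<otimes> inv x \<in> S i j"
      if c: "i \<in> {1..m}" "j \<in> {1..m}" "x \<in> carrier G" "y \<in> carrier G" for i j x y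
    proof -
      have "adjacent S (h (x, i)) (h (y, j)) \<longleftrightarrow> adjacent S (x, i) (y, j)"
        using hA c VI by (simp add: A_def)
      then show ?thesis using adj[OF c(1,2) kG kG] c by (simp add: h_form adjacent_def)
    qed
    show "f i (k i x) \<otimes> a \<in> {f i (k i (x \<otimes> a)), f i (k i (x \<otimes> a \<otimes> a))}"
      if c: "i \<in> {1..m}" "x \<in> carrier G" for i x
    proof -
      have "q' (h (x, i)) \<in> {h (q (x, i)), h (q (q (x, i)))}" using h c VI by blast
      then have "g i (f i (k i x) \<otimes> a) \<in> {k i (x \<otimes> a), k i (x \<otimes> a \<otimes> a)}"
        using c a(1) by (auto simp: h_form q_app q'_app kG)
      then have "f i (g i (f i (k i x) \<otimes> a)) \<in> {f i (k i (x \<otimes> a)), f i (k i (x \<otimes> a \<otimes> a))}" by auto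
      then show ?thesis using c a(1) kG fG by (simp add: fg)
    qed
  qed
qed

end

section \<open>The groups of order three and six with at most five copies\<close>

text \<open>
  There are six permutations of \<open>\<int>\<^sub>3\<close> and six maps \<open>k \<mapsto> w k + c\<close> with \<open>w = 1, 2\<close>.
\<close>

lemma inj_3_affine:
  fixes F :: "3 \<Rightarrow> 3"
  assumes "inj F"
  obtains w where "w \<in> {1, 2}" "\<And>k. F k = w * k + F 0"
proof -
  have ne: "F 0 \<noteq> F 1" "F 0 \<noteq> F 2" "F 1 \<noteq> F 2" using injD[OF assms] by fastforce+
  define w where "w = F 1 - F 0"
  have w: "w \<in> {1, 2}" using cases_3[of w] ne by (auto simp: w_def)
  have "F 2 = 2 * w + F 0"
    using cases_3[of "F 0"] cases_3[of "F 1"] cases_3[of "F 2"] ne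
    by (elim disjE) (simp_all add: w_def arith_3)
  then have "F k = w * k + F 0" for k
    using cases_3[of k] by (auto simp: w_def)
  then show thesis using that w by blast
qed

text \<open>
  Here \<open>el k False\<close> is \<open>a\<^sup>k\<close> and \<open>el k True\<close> is \<open>a\<^sup>k b\<close>. The set \<open>E\<close> of allowed second coordinates
  makes it possible to treat the cyclic group of order three, with \<open>E = {False}\<close>, and the dihedral
  group of order six, with \<open>E = UNIV\<close>, together; for a second coordinate outside \<open>E\<close> the value of
  \<open>el\<close> is arbitrary.
\<close>

locale order3_coordinates = group +
  fixes E :: "bool set" and el :: "3 \<Rightarrow> bool \<Rightarrow> 'a"
  assumes F_in_E: "False \<in> E"
    and el_closed: "e \<in> E \<Longrightarrow> el k e \<in> carrier G"
    and el_surj: "x \<in> carrier G \<Longrightarrow> \<exists>k. \<exists>e\<in>E. x = el k e"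
    and el_inj: "e \<in> E \<Longrightarrow> e' \<in> E \<Longrightarrow> el k e = el l e' \<Longrightarrow> k = l \<and> e = e'"
    and el_mult_F: "e \<in> E \<Longrightarrow> el k False \<otimes> el l e = el (k + l) e"
    and el_mult_T: "True \<in> E \<Longrightarrow> e \<in> E \<Longrightarrow> el k True \<otimes> el l e = el (k - l) (\<not> e)"
begin

lemma el_eq_iff: "e \<in> E \<Longrightarrow> e' \<in> E \<Longrightarrow> el k e = el l e' \<longleftrightarrow> k = l \<and> e = e'"
  using el_inj by blast

lemma el_0: "el 0 False = \<one>"
  using el_mult_F[OF F_in_E, of 0 0] el_closed[OF F_in_E, of 0] by simp

lemma inv_el_F: "inv (el k False) = el (- k) False"
  using el_mult_F[OF F_in_E, of "- k" k] el_0 el_closed[OF F_in_E] by (simp add: inv_equality)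

lemma inv_el_T: "True \<in> E \<Longrightarrow> inv (el k True) = el k True"
  using el_mult_T[of True k k] el_0 el_closed by (simp add: inv_equality)

lemma carrier_eq: "carrier G = (\<lambda>(k, e). el k e) ` (UNIV \<times> E)"
  using el_surj el_closed by fastforce

lemma finite_carrier: "finite (carrier G)"
  unfolding carrier_eq by (rule finite_imageI) (simp add: finite_cartesian_product)

lemma order_less_9: "order G < 9"
proof -
  have "card (carrier G) \<le> card (UNIV \<times> E :: (3 \<times> bool) set)"
    unfolding carrier_eq by (rule card_image_le) (simp add: finite_cartesian_product)
  also have "\<dots> \<le> card (UNIV :: (3 \<times> bool) set)" by (rule card_mono) auto
  also have "\<dots> = 6" by (simp add: card_prod UNIV_bool)
  finally show ?thesis by (simp add: order_def)
qed

text \<open>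
  The automorphism \<open>a\<^sup>k b\<^sup>e \<mapsto> a\<^bsup>s k\<^esup> b\<^sup>e\<close>.
\<close>

definition sign_aut :: "3 \<Rightarrow> 'a \<Rightarrow> 'a" where
  "sign_aut s x = (THE y. \<exists>k. \<exists>e\<in>E. x = el k e \<and> y = el (s * k) e)"

lemma sign_aut_el: "e \<in> E \<Longrightarrow> sign_aut s (el k e) = el (s * k) e"
  unfolding sign_aut_def by (rule the_equality) (auto simp: el_eq_iff)

lemma sign_aut_iso:
  assumes s: "s \<in> {1, 2}"
  shows "sign_aut s \<in> iso G G"
proof -
  have ss: "s * (s * z) = z" for z using s by (auto simp: arith_3 simp flip: mult.assoc)
  have hom: "sign_aut s \<in> hom G G"
  proof (rule homI)
    show "sign_aut s x \<in> carrier G" if "x \<in> carrier G" for x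
      using el_surj[OF that] sign_aut_el el_closed by auto
    fix x y assume "x \<in> carrier G" "y \<in> carrier G"
    then obtain k e l e' where xy: "x = el k e" "e \<in> E" "y = el l e'" "e' \<in> E" using el_surj by metis
    show "sign_aut s (x \<otimes> y) = sign_aut s x \<otimes> sign_aut s y"
    proof (cases e)
      case True
      then have T: "True \<in> E" using xy by simp
      then have "(\<not> e') \<in> E" using F_in_E by (cases e') auto
      then show ?thesis using True T xy by (simp add: el_mult_T sign_aut_el right_diff_distrib)
    next
      case False
      then show ?thesis using xy by (simp add: el_mult_F sign_aut_el distrib_left)
    qed
  qed
  have closed: "sign_aut s x \<in> carrier G" if "x \<in> carrier G" for x
    using hom that by (auto simp: hom_def)
  have invol: "sign_aut s (sign_aut s x) = x" if "x \<in> carrier G" for x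
    using el_surj[OF that] by (auto simp: sign_aut_el ss)
  have "bij_betw (sign_aut s) (carrier G) (carrier G)"
    by (rule bij_betw_byWitness[where f' = "sign_aut s"]) (use closed invol in auto)
  then show ?thesis using hom by (simp add: iso_def)
qed

text \<open>
  Since \<open>f\<close> permutes the at most two cosets of \<open>\<langle>a\<rangle>\<close> and fixes the identity, it fixes both cosets;
  on each it is a permutation of three elements and therefore affine.
\<close>

lemma block_coordinates:
  assumes bij: "bij_betw f (carrier G) (carrier G)" and f1: "f \<one> = \<one>"
    and block: "\<And>x. x \<in> carrier G \<Longrightarrow>
      f x \<otimes> el 1 False \<in> {f (x \<otimes> el 1 False), f (x \<otimes> el 1 False \<otimes> el 1 False)}"
    and e: "e \<in> E"
  obtains w d where "w \<in> {1, 2}" "\<And>k. f (el k e) = el (w * k + d) e" "\<not> e \<Longrightarrow> d = 0"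
proof -
  have fG: "f x \<in> carrier G" if "x \<in> carrier G" for x using bij that by (rule bij_betwE[THEN bspec])
  have f_inj: "f x = f y \<Longrightarrow> x = y" if "x \<in> carrier G" "y \<in> carrier G" for x y
    using inj_onD[OF bij_betw_imp_inj_on[OF bij]] that by blast
  have mult_a: "el k e' \<otimes> el 1 False = el (if e' then k - 1 else k + 1) e'" if "e' \<in> E" for k e'
    using that el_mult_F[OF F_in_E] el_mult_T[OF _ F_in_E] by (cases e') auto
  have ex: "\<exists>l. \<exists>e''\<in>E. f (el k e') = el l e''" if "e' \<in> E" for k e'
    using el_surj[OF fG[OF el_closed[OF that]]] .
  \<comment> \<open>The second coordinate of an image, which shows the coset that contains it.\<close>
  define p where "p k e' = (THE e''. e'' \<in> E \<and> (\<exists>l. f (el k e') = el l e''))" for k e'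
  have p: "p k e' \<in> E" "\<exists>l. f (el k e') = el l (p k e')" if e': "e' \<in> E" for k e'
  proof -
    obtain l e'' where l: "e'' \<in> E" "f (el k e') = el l e''" using ex[OF e'] by blast
    then have "p k e' = e''" unfolding p_def by (intro the_equality) (auto simp: el_eq_iff)
    then show "p k e' \<in> E" "\<exists>l. f (el k e') = el l (p k e')" using l by auto
  qed
  have p_unique: "e'' = p k e'" if "e' \<in> E" "e'' \<in> E" "f (el k e') = el l e''" for k e' l e''
    using p[OF that(1), of k] that(2,3) el_eq_iff by metis
  have step: "p k e' = p (k + 1) e' \<or> p k e' = p (k + 2) e'" if e': "e' \<in> E" for k e'
  proof -
    obtain l where l: "f (el k e') = el l (p k e')" using p[OF e'] by blast
    have "f (el k e') \<otimes> el 1 False = el (if p k e' then l - 1 else l + 1) (p k e')"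
      unfolding l using mult_a[OF p(1)[OF e']] .
    moreover have "f (el k e') \<otimes> el 1 False \<in> {f (el (k + 1) e'), f (el (k + 2) e')}"
    proof -
      let ?x = "el k e'" and ?a = "el 1 False"
      have "?x \<otimes> ?a = el (k + 2) e' \<and> ?x \<otimes> ?a \<otimes> ?a = el (k + 1) e' \<or>
          ?x \<otimes> ?a = el (k + 1) e' \<and> ?x \<otimes> ?a \<otimes> ?a = el (k + 2) e'"
      proof (cases e')
        case True
        have "k - 1 = k + 2" "k + 2 - 1 = k + 1" using cases_3[of k] by (auto simp: arith_3)
        moreover have "?x \<otimes> ?a = el (k - 1) e'" "el (k + 2) e' \<otimes> ?a = el (k + 2 - 1) e'"
          using mult_a[OF e', of k] mult_a[OF e', of "k + 2"] True by (simp_all only: if_True)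
        ultimately show ?thesis by (simp only: simp_thms)
      next
        case False
        have "k + 1 + 1 = k + 2" by simp
        moreover have "?x \<otimes> ?a = el (k + 1) e'" "el (k + 1) e' \<otimes> ?a = el (k + 1 + 1) e'"
          using mult_a[OF e', of k] mult_a[OF e', of "k + 1"] False by (simp_all only: if_False)
        ultimately show ?thesis by (simp only: simp_thms)
      qed
      then have "{f (?x \<otimes> ?a), f (?x \<otimes> ?a \<otimes> ?a)} = {f (el (k + 1) e'), f (el (k + 2) e')}"
        by (elim disjE conjE) (simp_all only: insert_commute)
      then show ?thesis using block[OF el_closed[OF e']] by metis
    qed
    ultimately have "f (el (k + 1) e') = el (if p k e' then l - 1 else l + 1) (p k e') \<or>
        f (el (k + 2) e') = el (if p k e' then l - 1 else l + 1) (p k e')" by auto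
    then show ?thesis using p_unique[OF e' p(1)[OF e', of k]] by metis
  qed
  have const: "p k e' = p 0 e'" if e': "e' \<in> E" for k e'
    using step[OF e', of 0] step[OF e', of 1] step[OF e', of 2] cases_3[of k]
    by (auto simp: arith_3)
  have pF: "p k False = False" for k
  proof -
    have "f (el 0 False) = el 0 False" using f1 el_0 by simp
    then have "p 0 False = False" using p_unique[OF F_in_E F_in_E] by metis
    then show ?thesis using const[OF F_in_E] by simp
  qed
  have "p k e = e" for k
  proof (cases e)
    case True
    show ?thesis
    proof (rule ccontr)
      assume "p k e \<noteq> e"
      then have pk: "p k e = False" using True by simp
      obtain F where F: "\<And>k. f (el k False) = el (F k) False" using p(2)[OF F_in_E] pF by metis
      have "inj F"
      proof (rule injI)
        fix k l assume "F k = F l"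
        then have "f (el k False) = f (el l False)" using F by simp
        then have "el k False = el l False" by (rule f_inj[OF el_closed[OF F_in_E] el_closed[OF F_in_E]])
        then show "k = l" using el_eq_iff[OF F_in_E F_in_E] by simp
      qed
      then have "surj F" by (simp add: finite_UNIV_inj_surj)
      obtain l where "f (el k e) = el l False" using p(2)[OF e] pk by metis
      moreover obtain k' where "F k' = l" using \<open>surj F\<close> by (metis surjD)
      ultimately have "f (el k e) = f (el k' False)" using F by simp
      then have "el k e = el k' False" by (rule f_inj[OF el_closed[OF e] el_closed[OF F_in_E]])
      then show False using el_eq_iff[OF e F_in_E] True by simp
    qed
  qed (use pF in simp)
  then have "\<forall>k. \<exists>l. f (el k e) = el l e" using p(2)[OF e] by simp
  from choice[OF this] obtain F where F: "\<And>k. f (el k e) = el (F k) e" by blast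
  have "inj F"
  proof (rule injI)
    fix k l assume "F k = F l"
    then have "f (el k e) = f (el l e)" using F by simp
    then have "el k e = el l e" by (rule f_inj[OF el_closed[OF e] el_closed[OF e]])
    then show "k = l" using el_eq_iff[OF e e] by simp
  qed
  then obtain w where w: "w \<in> {1, 2}" "\<And>k. F k = w * k + F 0" using inj_3_affine by blast
  show thesis
  proof (rule that[OF w(1)])
    show "f (el k e) = el (w * k + F 0) e" for k using F w(2) by metis
    assume "\<not> e"
    then have "el (F 0) False = el 0 False" using F[of 0] f1 el_0 by simp
    then show "F 0 = 0" using el_eq_iff[OF F_in_E F_in_E] by simp
  qed
qed

text \<open>
  With \<open>\<alpha>(a) = a\<^sup>s\<close>, \<open>\<alpha>(b) = b\<close> and \<open>g\<^sub>i = a\<^bsup>c(i)\<^esup>\<close>, the element \<open>g\<^sub>j \<alpha>(z) g\<^sub>i\<^sup>-\<^sup>1\<close> has exponent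
  \<open>s t + (c\<^sub>j - c\<^sub>i)\<close> for \<open>z = a\<^sup>t\<close> and \<open>s t + (c\<^sub>i + c\<^sub>j)\<close> for \<open>z = a\<^sup>t b\<close>; so the claim is the
  existence of a uniform correction.
\<close>

lemma normalized_affinely_equivalent:
  fixes S T :: "nat \<Rightarrow> nat \<Rightarrow> 'a set" and f :: "nat \<Rightarrow> 'a \<Rightarrow> 'a"
  assumes m: "m \<le> 5"
    and S: "\<And>i. i \<in> {1..m} \<Longrightarrow> S i i = {}" and T: "\<And>i. i \<in> {1..m} \<Longrightarrow> T i i = {}"
    and symS: "\<And>i j z. i \<in> {1..m} \<Longrightarrow> j \<in> {1..m} \<Longrightarrow> z \<in> carrier G \<Longrightarrow> z \<in> S j i \<longleftrightarrow> inv z \<in> S i j"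
    and symT: "\<And>i j z. i \<in> {1..m} \<Longrightarrow> j \<in> {1..m} \<Longrightarrow> z \<in> carrier G \<Longrightarrow> z \<in> T j i \<longleftrightarrow> inv z \<in> T i j"
    and f: "\<And>i. i \<in> {1..m} \<Longrightarrow> bij_betw (f i) (carrier G) (carrier G)"
    and f1: "\<And>i. i \<in> {1..m} \<Longrightarrow> f i \<one> = \<one>"
    and adj: "\<And>i j x y. \<lbrakk>i \<in> {1..m}; j \<in> {1..m}; x \<in> carrier G; y \<in> carrier G\<rbrakk> \<Longrightarrow>
       f j y \<otimes> inv (f i x) \<in> T i j \<longleftrightarrow> y \<otimes> inv x \<in> S i j"
    and block: "\<And>i x. i \<in> {1..m} \<Longrightarrow> x \<in> carrier G \<Longrightarrow>
       f i x \<otimes> el 1 False \<in> {f i (x \<otimes> el 1 False), f i (x \<otimes> el 1 False \<otimes> el 1 False)}"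
  obtains \<alpha> g where "\<alpha> \<in> iso G G" "\<And>i. i \<in> {1..m} \<Longrightarrow> g i \<in> carrier G"
    "\<And>i j z. i \<in> {1..m} \<Longrightarrow> j \<in> {1..m} \<Longrightarrow> z \<in> carrier G \<Longrightarrow>
       g j \<otimes> \<alpha> z \<otimes> inv (g i) \<in> T i j \<longleftrightarrow> z \<in> S i j"
proof -
  have "\<exists>w. w \<in> {1, 2} \<and> (\<forall>k. f i (el k False) = el (w * k) False)" if i: "i \<in> {1..m}" for i
    using block_coordinates[OF f[OF i] f1[OF i] block[OF i] F_in_E] by (metis add_0_right)
  then obtain w where w: "\<And>i. i \<in> {1..m} \<Longrightarrow> w i \<in> {1, 2}"
    and fw: "\<And>i k. i \<in> {1..m} \<Longrightarrow> f i (el k False) = el (w i * k) False"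
    by metis
  \<comment> \<open>For the cyclic group the second coset is empty; giving it the sign of the first one makes all
    conditions on it hold.\<close>
  have "\<exists>v d. v \<in> {1, 2} \<and> (True \<in> E \<longrightarrow> (\<forall>k. f i (el k True) = el (v * k + d) True)) \<and>
      (True \<notin> E \<longrightarrow> v = w i \<and> d = 0)" if i: "i \<in> {1..m}" for i
  proof (cases "True \<in> E")
    case True
    then show ?thesis
      using block_coordinates[OF f[OF i] f1[OF i] block[OF i] True] by metis
  qed (use w[OF i] in blast)
  then obtain v d where v: "\<And>i. i \<in> {1..m} \<Longrightarrow> v i \<in> {1, 2}"
    and fv: "\<And>i k. i \<in> {1..m} \<Longrightarrow> True \<in> E \<Longrightarrow> f i (el k True) = el (v i * k + d i) True"
    and no_T: "\<And>i. i \<in> {1..m} \<Longrightarrow> True \<notin> E \<Longrightarrow> v i = w i \<and> d i = 0"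
    by metis
  have elF: "el k False \<in> carrier G" for k using el_closed[OF F_in_E] .
  define A where "A U i j t \<longleftrightarrow> el t False \<in> U i j" for U :: "nat \<Rightarrow> nat \<Rightarrow> 'a set" and i j t
  define B where "B U i j t \<longleftrightarrow> True \<in> E \<and> el t True \<in> U i j" for U :: "nat \<Rightarrow> nat \<Rightarrow> 'a set" and i j t
  have pairs: "sign_pair (w i) (v i) (d i) (w j) (v j) (d j) (A S i j) (A T i j) (B S i j) (B T i j)"
    if i: "i \<in> {1..m}" and j: "j \<in> {1..m}" for i j
  proof
    show "w i \<in> {1, 2}" "v i \<in> {1, 2}" "w j \<in> {1, 2}" "v j \<in> {1, 2}" using w v i j by auto
    show h00: "A T i j (w j * l - w i * k) \<longleftrightarrow> A S i j (l - k)" for k l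
      using adj[OF i j elF elF, of l k] F_in_E by (simp add: fw[OF i] fw[OF j] inv_el_F el_mult_F A_def)
    show "A T i j (v j * l - v i * k + (d j - d i)) \<longleftrightarrow> A S i j (l - k)" for k l
    proof (cases "True \<in> E")
      case True
      show ?thesis
        using adj[OF i j el_closed[OF True] el_closed[OF True], of l k] True
        by (simp add: fv[OF i True] fv[OF j True] inv_el_T el_mult_T A_def algebra_simps)
    next
      case False
      then show ?thesis using h00 no_T[OF i] no_T[OF j] by simp
    qed
    show "B T i j (w i * k + v j * l + d j) \<longleftrightarrow> B S i j (k + l)" for k l
    proof (cases "True \<in> E")
      case True
      show ?thesis
        using adj[OF i j elF el_closed[OF True], of l k] True F_in_E
        by (simp add: fw[OF i] fv[OF j True] inv_el_F el_mult_T B_def algebra_simps)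
    next
      case False
      then show ?thesis by (simp add: B_def)
    qed
    show "B T i j (v i * k + w j * l + d i) \<longleftrightarrow> B S i j (k + l)" for k l
    proof (cases "True \<in> E")
      case True
      show ?thesis
        using adj[OF i j el_closed[OF True] elF, of l k] True
        by (simp add: fw[OF j] fv[OF i True] inv_el_T el_mult_F B_def algebra_simps)
    next
      case False
      then show ?thesis by (simp add: B_def)
    qed
  qed
  have diag: "\<not> A S i i t \<and> \<not> A T i i t \<and> \<not> B S i i t \<and> \<not> B T i i t" if "i \<in> {1..m}" for i t
    using S[OF that] T[OF that] by (simp add: A_def B_def)
  have symA: "A S j i t = A S i j (- t) \<and> A T j i t = A T i j (- t)"
    if "i \<in> {1..m}" "j \<in> {1..m}" for i j t
    using symS[OF that elF] symT[OF that elF] by (simp add: A_def inv_el_F)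
  have symB: "B S j i t = B S i j t \<and> B T j i t = B T i j t"
    if "i \<in> {1..m}" "j \<in> {1..m}" for i j t
  proof (cases "True \<in> E")
    case True
    then show ?thesis
      using symS[OF that el_closed[OF True]] symT[OF that el_closed[OF True]] by (simp add: B_def inv_el_T)
  qed (simp add: B_def)
  obtain s c where s: "s \<in> {1, 2}" and c: "\<And>i j t. i \<in> {1..m} \<Longrightarrow> j \<in> {1..m} \<Longrightarrow>
       (A T i j (s * t + (c j - c i)) \<longleftrightarrow> A S i j t) \<and> (B T i j (s * t + (c i + c j)) \<longleftrightarrow> B S i j t)"
    using ex_uniform_correction[where w = w and v = v and d = d and A = "A S" and A' = "A T"
        and B = "B S" and B' = "B T", OF m pairs diag symA symB] by blast
  show thesis
  proof (rule that[of "sign_aut s" "\<lambda>i. el (c i) False"])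
    show "sign_aut s \<in> iso G G" using s by (rule sign_aut_iso)
    show "el (c i) False \<in> carrier G" for i by (rule elF)
    show "el (c j) False \<otimes> sign_aut s z \<otimes> inv (el (c i) False) \<in> T i j \<longleftrightarrow> z \<in> S i j"
      if i: "i \<in> {1..m}" and j: "j \<in> {1..m}" and z: "z \<in> carrier G" for i j z
    proof -
      obtain t e where te: "z = el t e" "e \<in> E" using el_surj[OF z] by blast
      show ?thesis
      proof (cases e)
        case True
        then have T: "True \<in> E" using te by simp
        show ?thesis
          using c[OF i j, of t] True te T F_in_E
          by (simp add: sign_aut_el el_mult_F el_mult_T inv_el_F B_def algebra_simps)
      next
        case False
        show ?thesis
          using c[OF i j, of t] False te F_in_E
          by (simp add: sign_aut_el el_mult_F inv_el_F A_def algebra_simps)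
      qed
    qed
  qed
qed

text \<open>
  Left translations on the copies and the permutation \<open>\<sigma>\<close> of the indices belong to affine maps, so
  the isomorphism may be assumed to fix all indices and the identity of each copy.
\<close>

lemma mPCI_group_if_le_5:
  assumes m0: "m > 0" and m: "m \<le> 5"
  shows "mPCI_group G m"
  unfolding mPCI_group_iff[OF finite_carrier m0]
proof (intro allI impI, elim conjE)
  fix S T
  assume S: "PCayley_family G m S" and T: "PCayley_family G m T"
    and symS: "inverse_symmetric m S" and symT: "inverse_symmetric m T" and iso: "copy_isomorphic m S T"
  let ?a = "el 1 False"
  have a: "?a \<in> carrier G" using el_closed[OF F_in_E] .
  have a1: "?a \<noteq> \<one>" using el_eq_iff[OF F_in_E F_in_E, of 1 0] el_0 by simp
  have a3: "?a \<otimes> ?a \<otimes> ?a = \<one>" using F_in_E by (simp add: el_mult_F el_0 arith_3)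
  obtain \<sigma> f where \<sigma>: "bij_betw \<sigma> {1..m} {1..m}"
    and f: "\<And>i. i \<in> {1..m} \<Longrightarrow> bij_betw (f i) (carrier G) (carrier G)"
    and adj: "\<And>i j x y. \<lbrakk>i \<in> {1..m}; j \<in> {1..m}; x \<in> carrier G; y \<in> carrier G\<rbrakk> \<Longrightarrow>
       f j y \<otimes> inv (f i x) \<in> T (\<sigma> i) (\<sigma> j) \<longleftrightarrow> y \<otimes> inv x \<in> S i j"
    and block: "\<And>i x. i \<in> {1..m} \<Longrightarrow> x \<in> carrier G \<Longrightarrow>
       f i x \<otimes> ?a \<in> {f i (x \<otimes> ?a), f i (x \<otimes> ?a \<otimes> ?a)}"
    using copy_isomorphism_normalizing_order3[OF finite_carrier order_less_9 a a1 a3 iso] by blast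
  have fG: "f i x \<in> carrier G" if "i \<in> {1..m}" "x \<in> carrier G" for i x
    using f[OF that(1)] that(2) by (rule bij_betwE[THEN bspec])
  have \<sigma>m: "\<sigma> i \<in> {1..m}" if "i \<in> {1..m}" for i using \<sigma> that by (rule bij_betwE[THEN bspec])
  define b where "b i = f i \<one>" for i
  have bG: "b i \<in> carrier G" if "i \<in> {1..m}" for i using fG[OF that] by (simp add: b_def)
  define f' where "f' i x = inv (b i) \<otimes> f i x" for i x
  define T' where "T' i j = {z. b j \<otimes> z \<otimes> inv (b i) \<in> T (\<sigma> i) (\<sigma> j)}" for i j
  have symU: "z \<in> U j i \<longleftrightarrow> inv z \<in> U i j"
    if U: "inverse_symmetric m U" and c: "i \<in> {1..m}" "j \<in> {1..m}" "z \<in> carrier G"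
      and sub: "PCayley_family G m U" for U i j z
  proof -
    have UG: "U i j \<subseteq> carrier G" using sub c unfolding PCayley_family_def by blast
    have "U j i = m_inv G ` U i j" using U c unfolding inverse_symmetric_def by blast
    then have "z \<in> U j i \<longleftrightarrow> (\<exists>u\<in>U i j. z = inv u)" by blast
    also have "\<dots> \<longleftrightarrow> inv z \<in> U i j" using c(3) UG by (metis inv_inv subsetD)
    finally show ?thesis .
  qed
  obtain \<alpha> g where \<alpha>: "\<alpha> \<in> iso G G" and g: "\<And>i. i \<in> {1..m} \<Longrightarrow> g i \<in> carrier G"
    and eq: "\<And>i j z. i \<in> {1..m} \<Longrightarrow> j \<in> {1..m} \<Longrightarrow> z \<in> carrier G \<Longrightarrow>
       g j \<otimes> \<alpha> z \<otimes> inv (g i) \<in> T' i j \<longleftrightarrow> z \<in> S i j"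
  proof (rule normalized_affinely_equivalent[OF m, of S T' f'])
    show "S i i = {}" if "i \<in> {1..m}" for i using S that by (simp add: PCayley_family_def)
    show "T' i i = {}" if "i \<in> {1..m}" for i
      using T \<sigma>m[OF that] by (simp add: PCayley_family_def T'_def)
    show "z \<in> S j i \<longleftrightarrow> inv z \<in> S i j" if "i \<in> {1..m}" "j \<in> {1..m}" "z \<in> carrier G" for i j z
      using symS that S by (rule symU)
    show "z \<in> T' j i \<longleftrightarrow> inv z \<in> T' i j" if c: "i \<in> {1..m}" "j \<in> {1..m}" "z \<in> carrier G" for i j z
    proof -
      have "z \<in> T' j i \<longleftrightarrow> inv (b i \<otimes> z \<otimes> inv (b j)) \<in> T (\<sigma> i) (\<sigma> j)"
        using symU[OF symT \<sigma>m[OF c(1)] \<sigma>m[OF c(2)] _ T, of "b i \<otimes> z \<otimes> inv (b j)"] c bG by (simp add: T'_def)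
      also have "inv (b i \<otimes> z \<otimes> inv (b j)) = b j \<otimes> inv z \<otimes> inv (b i)"
        using c bG by (simp add: inv_mult_group m_assoc)
      finally show ?thesis by (simp add: T'_def)
    qed
    show "bij_betw (f' i) (carrier G) (carrier G)" if i: "i \<in> {1..m}" for i
    proof -
      have "bij_betw (\<lambda>y. inv (b i) \<otimes> y) (carrier G) (carrier G)"
        by (rule bij_betw_byWitness[where f' = "\<lambda>y. b i \<otimes> y"]) (use bG[OF i] in \<open>auto simp: inv_cancel\<close>)
      from bij_betw_trans[OF f[OF i] this] show ?thesis by (simp add: comp_def f'_def[abs_def])
    qed
    show "f' i \<one> = \<one>" if "i \<in> {1..m}" for i using bG[OF that] by (simp add: f'_def b_def)
    show "f' j y \<otimes> inv (f' i x) \<in> T' i j \<longleftrightarrow> y \<otimes> inv x \<in> S i j"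
      if c: "i \<in> {1..m}" "j \<in> {1..m}" "x \<in> carrier G" "y \<in> carrier G" for i j x y
    proof -
      have "b j \<otimes> (f' j y \<otimes> inv (f' i x)) \<otimes> inv (b i) = f j y \<otimes> inv (f i x)"
        using c bG fG by (simp add: f'_def inv_mult_group m_assoc inv_cancel)
      then show ?thesis using adj[OF c] by (simp add: T'_def)
    qed
    show "f' i x \<otimes> ?a \<in> {f' i (x \<otimes> ?a), f' i (x \<otimes> ?a \<otimes> ?a)}"
      if c: "i \<in> {1..m}" "x \<in> carrier G" for i x
    proof -
      have "f' i x \<otimes> ?a = inv (b i) \<otimes> (f i x \<otimes> ?a)"
        using c a bG fG by (simp add: f'_def m_assoc)
      then show ?thesis using block[OF c] by (auto simp: f'_def)
    qed
  qed blast
  have "b j \<otimes> g j \<otimes> \<alpha> z \<otimes> inv (b i \<otimes> g i) \<in> T (\<sigma> i) (\<sigma> j) \<longleftrightarrow> z \<in> S i j"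
    if c: "i \<in> {1..m}" "j \<in> {1..m}" "z \<in> carrier G" for i j z
  proof -
    have "\<alpha> z \<in> carrier G" using \<alpha> c(3) by (auto simp: iso_def hom_def)
    then have "b j \<otimes> g j \<otimes> \<alpha> z \<otimes> inv (b i \<otimes> g i) = b j \<otimes> (g j \<otimes> \<alpha> z \<otimes> inv (g i)) \<otimes> inv (b i)"
      using c bG g by (simp add: inv_mult_group m_assoc)
    then show ?thesis using eq[OF c] by (simp add: T'_def)
  qed
  moreover have "(\<lambda>i. b i \<otimes> g i) \<in> {1..m} \<rightarrow> carrier G" using bG g by blast
  ultimately show "affinely_equivalent m S T"
    unfolding affinely_equivalent_def using \<sigma> \<alpha> by blast
qed

end

section \<open>Coordinates on the cyclic and the dihedral group\<close>

text \<open>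
  The concrete groups are built on the integers \<open>0, 1, 2\<close>, the coordinates on the ring \<open>\<int>\<^sub>3\<close>.
\<close>

definition rep_3 :: "3 \<Rightarrow> int" where
  "rep_3 k = (if k = 0 then 0 else if k = 1 then 1 else 2)"

lemma rep_3_range: "rep_3 k \<in> {0..<3}" by (simp add: rep_3_def)

lemma rep_3_inj: "rep_3 k = rep_3 l \<longleftrightarrow> k = l"
  using cases_3[of k] cases_3[of l] by (auto simp: rep_3_def)

lemma rep_3_surj: "x \<in> {0..<3} \<Longrightarrow> \<exists>k. x = rep_3 k"
proof -
  assume "x \<in> {0..<3}"
  then consider "x = 0" | "x = 1" | "x = 2" by (auto simp: atLeastLessThan_iff) linarith
  then show ?thesis
  proof cases
    case 1
    then show ?thesis by (intro exI[of _ 0]) (simp add: rep_3_def)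
  next
    case 2
    then show ?thesis by (intro exI[of _ 1]) (simp add: rep_3_def)
  next
    case 3
    then show ?thesis by (intro exI[of _ 2]) (simp add: rep_3_def)
  qed
qed

lemma rep_3_add: "rep_3 (k + l) = (rep_3 k + rep_3 l) mod 3"
  using cases_3[of k] cases_3[of l] by (elim disjE) (simp_all add: rep_3_def arith_3)

lemma rep_3_diff: "rep_3 (k - l) = (rep_3 k - rep_3 l) mod 3"
  using cases_3[of k] cases_3[of l] by (elim disjE) (simp_all add: rep_3_def arith_3)

lemma order3_coordinates_integer_mod_group:
  assumes "group G" "G \<cong> integer_mod_group 3"
  shows "\<exists>el. order3_coordinates G {False} el"
proof -
  interpret group G by fact
  let ?Z = "integer_mod_group 3"
  obtain h where h: "h \<in> iso ?Z G"
    using iso_sym[OF assms(2)] by (auto simp: is_iso_def)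
  have car: "carrier ?Z = {0..<3}" by (simp add: carrier_integer_mod_group)
  have inj: "inj_on h {0..<3}" and im: "h ` {0..<3} = carrier G"
    using h car by (auto simp: iso_def bij_betw_def)
  have hom: "h ((x + y) mod 3) = h x \<otimes>\<^bsub>G\<^esub> h y" if "x \<in> {0..<3}" "y \<in> {0..<3}" for x y
    using h that car by (auto simp: iso_def hom_def)
  have "order3_coordinates G {False} (\<lambda>k e. h (rep_3 k))"
  proof (intro order3_coordinates.intro[OF is_group] order3_coordinates_axioms.intro)
    show "h (rep_3 k) \<in> carrier G" for k using im rep_3_range by blast
    show "\<exists>k. \<exists>e\<in>{False}. x = h (rep_3 k)" if "x \<in> carrier G" for x
    proof -
      obtain z where "z \<in> {0..<3}" "x = h z" using \<open>x \<in> carrier G\<close> im by blast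
      then show ?thesis using rep_3_surj[of z] by auto
    qed
    show "k = l \<and> e = e'" if "e \<in> {False}" "e' \<in> {False}" "h (rep_3 k) = h (rep_3 l)" for e e' k l
      using inj_onD[OF inj that(3) rep_3_range rep_3_range] that(1,2) by (simp add: rep_3_inj)
    show "h (rep_3 k) \<otimes>\<^bsub>G\<^esub> h (rep_3 l) = h (rep_3 (k + l))" for k l
      using hom[OF rep_3_range rep_3_range] by (simp add: rep_3_add)
  qed auto
  then show ?thesis by blast
qed

lemma order3_coordinates_dihedral_group:
  assumes "group G" "G \<cong> dihedral_group 3"
  shows "\<exists>el. order3_coordinates G UNIV el"
proof -
  interpret group G by fact
  let ?D = "dihedral_group 3"
  obtain h where h: "h \<in> iso ?D G"
    using iso_sym[OF assms(2)] by (auto simp: is_iso_def)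
  have car: "carrier ?D = {0..<3} \<times> UNIV" by (simp add: dihedral_group_def)
  have inj: "inj_on h (carrier ?D)" and im: "h ` carrier ?D = carrier G"
    using h by (auto simp: iso_def bij_betw_def)
  have hom: "h (x \<otimes>\<^bsub>?D\<^esub> y) = h x \<otimes>\<^bsub>G\<^esub> h y" if "x \<in> carrier ?D" "y \<in> carrier ?D" for x y
    using h that by (auto simp: iso_def hom_def)
  have mem: "(rep_3 k, e) \<in> carrier ?D" for k e using rep_3_range car by simp
  have "order3_coordinates G UNIV (\<lambda>k e. h (rep_3 k, e))"
  proof (intro order3_coordinates.intro[OF is_group] order3_coordinates_axioms.intro)
    show "h (rep_3 k, e) \<in> carrier G" for k e using im mem by blast
    show "\<exists>k. \<exists>e\<in>UNIV. x = h (rep_3 k, e)" if "x \<in> carrier G" for x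
    proof -
      have "x \<in> h ` carrier ?D" using \<open>x \<in> carrier G\<close> im by simp
      then obtain u where "u \<in> carrier ?D" "x = h u" by (rule imageE)
      moreover obtain z e where "u = (z, e)" by (cases u)
      ultimately have "z \<in> {0..<3}" "x = h (z, e)" using car by simp_all
      then show ?thesis using rep_3_surj[of z] by auto
    qed
    show "k = l \<and> e = e'" if "h (rep_3 k, e) = h (rep_3 l, e')" for e e' k l
      using inj_onD[OF inj that mem mem] by (simp add: rep_3_inj)
    show "h (rep_3 k, False) \<otimes>\<^bsub>G\<^esub> h (rep_3 l, e) = h (rep_3 (k + l), e)" for k l e
      using hom[OF mem mem, of k False l e] by (simp add: dihedral_group_def rep_3_add)
    show "h (rep_3 k, True) \<otimes>\<^bsub>G\<^esub> h (rep_3 l, e) = h (rep_3 (k - l), \<not> e)" for k l e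
      using hom[OF mem mem, of k True l e] by (simp add: dihedral_group_def rep_3_diff)
  qed auto
  then show ?thesis by blast
qed

section \<open>The classification\<close>

lemma order_eq_if_iso:
  assumes "G \<cong> H"
  shows "order G = order H"
  using assms by (auto simp: is_iso_def iso_def order_def dest: bij_betw_same_card)

lemma order_integer_mod_group: "n > 0 \<Longrightarrow> order (integer_mod_group n) = n"
  by (simp add: order_def carrier_integer_mod_group)

theorem theorem5p10:
  fixes G :: "('a, 'b) monoid_scheme" and m :: nat
  assumes "m \<ge> 4" and "group G" and "finite (carrier G)"
  shows "(mPCI_group G m \<longleftrightarrow>
            G \<cong> integer_mod_group 1 \<or>
            G \<cong> integer_mod_group 2 \<or>
            ((G \<cong> integer_mod_group 3 \<or> G \<cong> dihedral_group 3) \<and> (m = 4 \<or> m = 5))) \<and>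
         (mPDCI_group G m \<longleftrightarrow>
            G \<cong> integer_mod_group 1 \<or> G \<cong> integer_mod_group 2)"
proof -
  interpret group G by fact
  have m0: "m > 0" using assms(1) by simp
  note fin = assms(3)
  have small: "mPDCI_group G m" if "G \<cong> integer_mod_group 1 \<or> G \<cong> integer_mod_group 2"
  proof -
    have "order G \<le> 2"
      using that order_eq_if_iso order_integer_mod_group[of 1] order_integer_mod_group[of 2] by fastforce
    then show ?thesis
      unfolding mPDCI_group_iff[OF fin m0] using affinely_equivalent_if_order_le_2 fin by blast
  qed
  have three: "mPCI_group G m"
    if "G \<cong> integer_mod_group 3 \<or> G \<cong> dihedral_group 3" "m = 4 \<or> m = 5"
  proof -
    have "m \<le> 5" using that(2) by auto
    then show ?thesis
      using that(1) order3_coordinates.mPCI_group_if_le_5[OF _ m0]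
        order3_coordinates_integer_mod_group[OF assms(2)] order3_coordinates_dihedral_group[OF assms(2)]
      by blast
  qed
  have forward: "G \<cong> integer_mod_group 1 \<or> G \<cong> integer_mod_group 2 \<or>
      (G \<cong> integer_mod_group 3 \<or> G \<cong> dihedral_group 3) \<and> 3 dvd order G"
    if mPCI: "mPCI_group G m"
  proof -
    note ords = ord_le_3_if_mPCI[OF fin assms(1) mPCI]
    have cyc: "G \<cong> integer_mod_group p" if p: "normalization_semidom_class.prime p" "order G = p" for p
    proof -
      have "p dvd order G" using p(2) by simp
      then obtain x where "x \<in> carrier G" "ord x = p" by (rule ex_ord_prime[OF fin p(1)])
      then show ?thesis using iso_integer_mod_group_if_ord[OF fin, of x] \<open>order G = p\<close> by simp
    qed
    consider "order G = 1" | "order G = 2" | "order G = 3" | "order G = 6"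
      using order_if_mPCI[OF fin assms(1) mPCI] by auto
    then show ?thesis
    proof cases
      case 1
      then show ?thesis using iso_integer_mod_group_if_ord[OF fin one_closed] by simp
    next
      case 2
      then show ?thesis using cyc[of 2] by simp
    next
      case 3
      then show ?thesis using cyc[of 3] by simp
    next
      case 4
      then show ?thesis using iso_dihedral_group_3[OF fin 4 ords] by simp
    qed
  qed
  have element: "\<exists>a. a \<in> carrier G \<and> a \<noteq> \<one>\<^bsub>G\<^esub> \<and> a \<otimes>\<^bsub>G\<^esub> a \<otimes>\<^bsub>G\<^esub> a = \<one>\<^bsub>G\<^esub>" if dvd: "3 dvd order G"
  proof -
    have "normalization_semidom_class.prime (3::nat)" by simp
    from ex_ord_prime[OF fin this dvd] obtain a where a: "a \<in> carrier G" "ord a = 3" .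
    then have "a \<otimes>\<^bsub>G\<^esub> a \<otimes>\<^bsub>G\<^esub> a = \<one>\<^bsub>G\<^esub>" using pow_eq_id[OF a(1), of 3] nat_pow_3[OF a(1)] by simp
    moreover have "a \<noteq> \<one>\<^bsub>G\<^esub>" using a by auto
    ultimately show ?thesis using a by blast
  qed
  have "m = 4 \<or> m = 5" if "mPCI_group G m" "3 dvd order G"
  proof (rule ccontr)
    assume "\<not> (m = 4 \<or> m = 5)"
    then have "m \<ge> 6" using assms(1) by linarith
    then show False using not_mPCI_group_if_order3[OF fin] element[OF that(2)] that(1) by blast
  qed
  moreover have "\<not> 3 dvd order G" if "mPDCI_group G m"
    using not_mPDCI_group_if_order3[OF fin assms(1)] element that by blast
  ultimately show ?thesis
    using small three forward mPCI_group_if_mPDCI_group[of G m] by blast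
qed

end
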